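(* Let $\mathcal{K}$ be a field, $\Gamma\leq\mathbb{R}$ an additive subgroup, $\Lambda=\Lambda^{\mathcal{K},\Gamma}$. For a Floer-type complex $(C_*,\partial_C,\ell_C)$ over $\Lambda$ let $\mathcal{B}_{C,k}$ denote the degree-$k$ part of its concise barcode and $\mathcal{B}(C_*,\partial_C,\ell_C)=\{\mathcal{B}_{C,k}\}_{k\in\mathbb{Z}}$. Then for any Floer-type complexes $(C_*,\partial_C,\ell_C)$ and $(D_*,\partial_D,\ell_D)$ over $\Lambda$: (i) $$d_Q\big((C_*,\partial_C,\ell_C),(D_*,\partial_D,\ell_D)\big)\leq d_B\big(\mathcal{B}(C_*,\partial_C,\ell_C),\mathcal{B}(D_*,\partial_D,\ell_D)\big)\leq 2\,d_Q\big((C_*,\partial_C,\ell_C),(D_*,\partial_D,\ell_D)\big).$$ (ii) For $k\in\mathbb{Z}$ let $\Delta_{D,k}>0$ denote the smallest second coordinate $L$ of all of the elements of $\mathcal{B}_{D,k}$. If $d_Q((C_*,\partial_C,\ell_C),(D_*,\partial_D,\ell_D))<\frac{\Delta_{D,k}}{4}$, then $$d_B(\mathcal{B}_{C,k},\mathcal{B}_{D,k})\leq d_Q\big((C_*,\partial_C,\ell_C),(D_*,\partial_D,\ell_D)\big).$$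
   Context: **Novikov field.** $\Lambda=\Lambda^{\mathcal{K},\Gamma}$ is the field of formal sums $\sum_{g\in\Gamma}a_gT^g$ with $a_g\in\mathcal{K}$ such that for every $C\in\mathbb{R}$ only finitely many $g<C$ have $a_g\neq 0$, with power-series addition and multiplication. Its valuation is $\nu(\sum a_gT^g)=\min\{g\mid a_g\neq 0\}$, $\nu(0)=\infty$. **Orthogonalizable spaces.** A non-Archimedean normed vector space over $\Lambda$ is a pair $(C,\ell)$ with $C$ a $\Lambda$-vector space and $\ell\colon C\to\mathbb{R}\cup\{-\infty\}$ (filtration function) satisfying: $\ell(x)=-\infty$ iff $x=0$; $\ell(\lambda x)=\ell(x)-\nu(\lambda)$; $\ell(x+y)\leq\max\{\ell(x),\ell(y)\}$. A finite ordered collection $(w_1,\dots,w_r)$ in $C$ is orthogonal if $\ell(\sum_i\lambda_iw_i)=\max_i\ell(\lambda_iw_i)$ for all $\lambda_i\in\Lambda$. An orthogonalizable $\Lambda$-space is a finite-dimensional non-Archimedean normed vector space admitting an orthogonal basis; subspaces of orthogonalizable spaces (with restricted $\ell$) are again orthogonalizable. **Singular value decomposition.** Let $A\colon C\to D$ be a $\Lambda$-linear map of rank $r$ between orthogonalizable $\Lambda$-spaces $(C,\ell_C)$, $(D,\ell_D)$. A singular value decomposition of $A$ is a choice of orthogonal ordered bases $(y_1,\dots,y_n)$ of $C$ and $(x_1,\dots,x_m)$ of $D$ such that: $(y_{r+1},\dots,y_n)$ is an orthogonal ordered basis of $\ker A$; $(x_1,\dots,x_r)$ is an orthogonal ordered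 basis of $\mathrm{Im}\,A$; $Ay_i=x_i$ for $1\leq i\leq r$; and $\ell_C(y_1)-\ell_D(x_1)\geq\cdots\geq\ell_C(y_r)-\ell_D(x_r)$. **Floer-type complex.** A Floer-type complex $(C_*,\partial,\ell)$ over $\Lambda$ is a chain complex $(C_*=\bigoplus_{k\in\mathbb{Z}}C_k,\partial)$ of $\Lambda$-vector spaces ($\partial$ is $\Lambda$-linear, $\partial C_k\subset C_{k-1}$, $\partial^2=0$) together with a function $\ell$ such that each $(C_k,\ell|_{C_k})$ is an orthogonalizable $\Lambda$-space and $\ell(\partial x)\leq\ell(x)$ for each $x\in C_k$. **Barcodes.** For $k\in\mathbb{Z}$ write $\partial_k=\partial|_{C_k}$, $Z_k=\ker\partial_k$. Choose a singular value decomposition $((y_1,\dots,y_n),(x_1,\dots,x_m))$ of $\partial_{k+1}\colon C_{k+1}\to Z_k$ and let $r$ be the rank of $\partial_{k+1}$. The degree-$k$ verbose barcode is the multiset of elements of $(\mathbb{R}/\Gamma)\times[0,\infty]$ consisting of $(\ell(x_i)\bmod\Gamma,\ \ell(y_i)-\ell(x_i))$ for $i=1,\dots,r$ and $(\ell(x_i)\bmod\Gamma,\ \infty)$ for $i=r+1,\dots,m$. Singular value decompositions always exist and this multiset does not depend on the chosen one. The degree-$k$ concise barcode is the submultiset of elements whose second coordinate is positive. **Bottleneck distance.** For multisets $\mathcal{S},\mathcal{T}$ of elements of $(\mathbb{R}/\Gamma)\times[0,\infty]$ and $\delta\geq 0$, a $\delta$-matching consists of: submultisets $\mathcal{S}_{short}\subset\mathcal{S}$,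 $\mathcal{T}_{short}\subset\mathcal{T}$ such that every $([a],L)\in\mathcal{S}_{short}\cup\mathcal{T}_{short}$ has $L\leq 2\delta$; and a bijection $\sigma\colon\mathcal{S}\setminus\mathcal{S}_{short}\to\mathcal{T}\setminus\mathcal{T}_{short}$ such that for each $([a],L)\in\mathcal{S}\setminus\mathcal{S}_{short}$ ($a\in\mathbb{R}$) we have $\sigma([a],L)=([a'],L')$ where for all $\epsilon>0$ the representative $a'$ of $[a']\in\mathbb{R}/\Gamma$ can be chosen so that both $|a'-a|\leq\delta+\epsilon$ and either $L=L'=\infty$ or $|(a'+L')-(a+L)|\leq\delta+\epsilon$. $d_B(\mathcal{S},\mathcal{T})\in[0,\infty]$ is the infimum of $\delta\geq 0$ for which a $\delta$-matching exists. For families $\mathcal{S}=\{\mathcal{S}_k\}_{k\in\mathbb{Z}}$, $\mathcal{T}=\{\mathcal{T}_k\}_{k\in\mathbb{Z}}$, $d_B(\mathcal{S},\mathcal{T})=\sup_kd_B(\mathcal{S}_k,\mathcal{T}_k)$. **Quasiequivalence distance.** For $\delta\geq0$, a $\delta$-quasiequivalence between $(C_*,\partial_C,\ell_C)$ and $(D_*,\partial_D,\ell_D)$ is a quadruple $(\Phi,\Psi,K_C,K_D)$ of $\Lambda$-linear maps where $\Phi\colon C_*\to D_*$, $\Psi\colon D_*\to C_*$ are degree-$0$ chain maps with $\ell_D(\Phi c)\leq\ell_C(c)+\delta$, $\ell_C(\Psi d)\leq\ell_D(d)+\delta$, and $K_C\colon C_*\to C_{*+1}$, $K_D\colon D_*\to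 D_{*+1}$ satisfy $\Psi\Phi-I_{C_*}=\partial_CK_C+K_C\partial_C$, $\Phi\Psi-I_{D_*}=\partial_DK_D+K_D\partial_D$, $\ell_C(K_Cc)\leq\ell_C(c)+2\delta$, $\ell_D(K_Dd)\leq\ell_D(d)+2\delta$, for all homogeneous $c\in C_*$, $d\in D_*$. $d_Q$ is the infimum of $\delta\geq 0$ for which a $\delta$-quasiequivalence exists ($\infty$ if none). Convention: $\Delta_{D,k}=\infty$ if $\mathcal{B}_{D,k}$ is empty. *)

theory Defs
  imports Complex_Main "HOL-Library.Extended_Real" "HOL-Library.Multiset"
begin

section \<open>The Novikov field\<close>

text \<open>
  An additive subgroup \<open>\<Gamma>\<close> of the reals is given by a type together with an injective homomorphism
  to the reals; the subgroup itself is the range of that homomorphism.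
\<close>

class real_subgroup = ab_group_add +
  fixes incl :: "'a \<Rightarrow> real"
  assumes incl_add: "incl (g + h) = incl g + incl h"
    and incl_inject: "incl g = incl h \<Longrightarrow> g = h"
begin

lemma incl_zero [simp]: "incl 0 = 0"
  using incl_add[of 0 0] by simp

lemma incl_diff: "incl (g - h) = incl g - incl h"
  using incl_add[of "g - h" h] by simp

lemma incl_eq_iff [simp]: "incl g = incl h \<longleftrightarrow> g = h"
  using incl_inject by blast

end

instantiation real :: real_subgroup
begin
definition "incl (x :: real) = x"
instance by standard (auto simp: incl_real_def)
end

instantiation int :: real_subgroup
begin
definition "incl (n :: int) = real_of_int n"
instance by standard (auto simp: incl_int_def)
end

typedef (overloaded) ('k, 'g) novikov =
  "{a :: 'g::real_subgroup \<Rightarrow> 'k::field. \<forall>C. finite {g. incl g < C \<and> a g \<noteq> 0}}"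
  morphisms coeff Novikov
  by (rule exI[of _ "\<lambda>_. 0"]) auto

lemma novikov_eqI: "(\<And>g. coeff x g = coeff y g) \<Longrightarrow> x = y"
  by (metis coeff_inject ext)

lemma finite_coeff_less: "finite {g. incl g < C \<and> coeff x g \<noteq> 0}"
  using coeff[of x] by auto

lemma finite_coeff_le: "finite {g. coeff x g \<noteq> 0 \<and> incl g \<le> C}"
  by (rule finite_subset[OF _ finite_coeff_less[of "C + 1" x]]) auto

lemma coeff_Novikov:
  assumes "\<And>C. finite {g. incl g < C \<and> a g \<noteq> 0}"
  shows "coeff (Novikov a) = a"
  using assms by (intro Novikov_inverse) auto

lemma coeff_lower_bound: "\<exists>b. \<forall>g. coeff x g \<noteq> 0 \<longrightarrow> b \<le> incl g"
proof -
  define S where "S = {g. coeff x g \<noteq> 0 \<and> incl g \<le> 0}"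
  have fin: "finite S"
    unfolding S_def by (rule finite_coeff_le)
  define b where "b = Min (insert 0 (incl ` S))"
  have "b \<le> incl g" if "coeff x g \<noteq> 0" for g
  proof (cases "incl g \<le> 0")
    case True
    then have "incl g \<in> insert 0 (incl ` S)" using that by (auto simp: S_def)
    then show ?thesis unfolding b_def using fin by (intro Min_le) auto
  next
    case False
    have "b \<le> 0" unfolding b_def using fin by (intro Min_le) auto
    then show ?thesis using False by linarith
  qed
  then show ?thesis by blast
qed

instantiation novikov :: (field, real_subgroup) comm_ring_1
begin

definition "0 = Novikov (\<lambda>_. 0)"
definition "1 = Novikov (\<lambda>g. if g = 0 then 1 else 0)"
definition "x + y = Novikov (\<lambda>g. coeff x g + coeff y g)"
definition "- x = Novikov (\<lambda>g. - coeff x g)"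
definition "x - y = Novikov (\<lambda>g. coeff x g - coeff y g)"
definition "x * y =
  Novikov (\<lambda>g. \<Sum>h | coeff x h \<noteq> 0 \<and> coeff y (g - h) \<noteq> 0. coeff x h * coeff y (g - h))"

lemma coeff_zero [simp]: "coeff (0 :: ('a, 'b) novikov) g = 0"
  unfolding zero_novikov_def by (subst coeff_Novikov) auto

lemma coeff_one: "coeff (1 :: ('a, 'b) novikov) g = (if g = 0 then 1 else 0)"
  unfolding one_novikov_def
proof (subst coeff_Novikov)
  show "finite {g :: 'b. incl g < C \<and> (if g = 0 then 1 else 0) \<noteq> (0 :: 'a)}" for C
    by (rule finite_subset[of _ "{0}"]) (auto split: if_splits)
qed auto

lemma coeff_add [simp]: "coeff (x + y :: ('a, 'b) novikov) g = coeff x g + coeff y g"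
  unfolding plus_novikov_def
proof (subst coeff_Novikov)
  show "finite {g. incl g < C \<and> coeff x g + coeff y g \<noteq> 0}" for C
    by (rule finite_subset[OF _ finite_UnI[OF finite_coeff_less[of C x] finite_coeff_less[of C y]]])
      auto
qed auto

lemma coeff_minus [simp]: "coeff (- x :: ('a, 'b) novikov) g = - coeff x g"
  unfolding uminus_novikov_def
  by (subst coeff_Novikov) (use finite_coeff_less in auto)

lemma coeff_diff [simp]: "coeff (x - y :: ('a, 'b) novikov) g = coeff x g - coeff y g"
  unfolding minus_novikov_def
proof (subst coeff_Novikov)
  show "finite {g. incl g < C \<and> coeff x g - coeff y g \<noteq> 0}" for C
    by (rule finite_subset[OF _ finite_UnI[OF finite_coeff_less[of C x] finite_coeff_less[of C y]]])
      auto
qed auto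

lemma coeff_times:
  "coeff (x * y :: ('a, 'b) novikov) g =
    (\<Sum>h | coeff x h \<noteq> 0 \<and> coeff y (g - h) \<noteq> 0. coeff x h * coeff y (g - h))"
  unfolding times_novikov_def
proof (subst coeff_Novikov)
  fix C
  obtain bx where bx: "\<And>g. coeff x g \<noteq> 0 \<Longrightarrow> bx \<le> incl g"
    using coeff_lower_bound by blast
  obtain b' where b': "\<And>g. coeff y g \<noteq> 0 \<Longrightarrow> b' \<le> incl g"
    using coeff_lower_bound by blast
  let ?P = "\<lambda>g h. coeff x h \<noteq> 0 \<and> coeff y (g - h) \<noteq> 0"
  have "{g. incl g < C \<and> (\<Sum>h | ?P g h. coeff x h * coeff y (g - h)) \<noteq> 0}
    \<subseteq> (\<lambda>(h, i). h + i) ` ({h. incl h < C - b' \<and> coeff x h \<noteq> 0} \<times> {i. incl i < C - bx \<and> coeff y i \<noteq> 0})"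
    (is "?L \<subseteq> ?R")
  proof
    fix g assume g: "g \<in> ?L"
    then have "{h. ?P g h} \<noteq> {}" by force
    then obtain h where h: "?P g h" by blast
    have "bx \<le> incl h" "b' \<le> incl (g - h)" using h bx b' by auto
    with g h show "g \<in> ?R"
      by (intro image_eqI[of _ _ "(h, g - h)"]) (auto simp: incl_diff)
  qed
  then show "finite ?L"
    by (rule finite_subset) (intro finite_imageI finite_cartesian_product finite_coeff_less)
qed auto

lemma coeff_times_superset:
  fixes x y :: "('a, 'b) novikov"
  assumes "finite F" "\<And>h. coeff x h \<noteq> 0 \<Longrightarrow> coeff y (g - h) \<noteq> 0 \<Longrightarrow> h \<in> F"
  shows "coeff (x * y) g = (\<Sum>h\<in>F. coeff x h * coeff y (g - h))"
  unfolding coeff_times using assms by (intro sum.mono_neutral_left) auto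

lemma coeff_times_nonzero:
  fixes x y :: "('a, 'b) novikov"
  assumes "coeff (x * y) g \<noteq> 0"
  shows "\<exists>h. coeff x h \<noteq> 0 \<and> coeff y (g - h) \<noteq> 0"
proof -
  have "{h. coeff x h \<noteq> 0 \<and> coeff y (g - h) \<noteq> 0} \<noteq> {}"
    using assms unfolding coeff_times by (metis (no_types, lifting) sum.empty)
  then show ?thesis by blast
qed

lemma novikov_mult_commute: "x * y = y * (x :: ('a, 'b) novikov)"
proof (rule novikov_eqI)
  fix g :: 'b
  show "coeff (x * y) g = coeff (y * x) g"
    unfolding coeff_times
    by (rule sum.reindex_bij_witness[of _ "\<lambda>h. g - h" "\<lambda>h. g - h"]) (auto simp: mult.commute)
qed

lemma novikov_mult_assoc: "(x * y) * z = x * (y * (z :: ('a, 'b) novikov))"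
proof (rule novikov_eqI)
  fix g :: 'b
  obtain bx where bx: "\<And>g. coeff x g \<noteq> 0 \<Longrightarrow> bx \<le> incl g"
    using coeff_lower_bound by blast
  obtain b' where b': "\<And>g. coeff y g \<noteq> 0 \<Longrightarrow> b' \<le> incl g"
    using coeff_lower_bound by blast
  obtain bz where bz: "\<And>g. coeff z g \<noteq> 0 \<Longrightarrow> bz \<le> incl g"
    using coeff_lower_bound by blast
  define F where "F = {h. coeff x h \<noteq> 0 \<and> incl h \<le> incl g - b' - bz}"
  define H where "H = {j. coeff z j \<noteq> 0 \<and> incl j \<le> incl g - bx - b'}"
  have finF: "finite F" and finH: "finite H"
    unfolding F_def H_def by (rule finite_coeff_le)+
  have "coeff ((x * y) * z) g = coeff (z * (x * y)) g"
    by (simp add: novikov_mult_commute)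
  also have "\<dots> = (\<Sum>j\<in>H. coeff z j * coeff (x * y) (g - j))"
  proof (rule coeff_times_superset[OF finH])
    fix j assume j: "coeff z j \<noteq> 0" "coeff (x * y) (g - j) \<noteq> 0"
    obtain h where "coeff x h \<noteq> 0" "coeff y (g - j - h) \<noteq> 0" using coeff_times_nonzero[OF j(2)] by blast
    then show "j \<in> H" using bx[of h] b'[of "g - j - h"] j by (auto simp: H_def incl_diff)
  qed
  also have "\<dots> = (\<Sum>j\<in>H. coeff z j * (\<Sum>h\<in>F. coeff x h * coeff y (g - j - h)))"
  proof (intro sum.cong refl arg_cong2[of _ _ _ _ "(*)"] coeff_times_superset[OF finF])
    fix j h assume "j \<in> H" "coeff x h \<noteq> 0" "coeff y (g - j - h) \<noteq> 0"
    then show "h \<in> F" using bz[of j] b'[of "g - j - h"] by (auto simp: F_def H_def incl_diff)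
  qed
  also have "\<dots> = (\<Sum>h\<in>F. coeff x h * (\<Sum>j\<in>H. coeff z j * coeff y (g - h - j)))"
  proof -
    have swap: "g - j - h = g - h - j" for j h :: 'b
      by (simp add: diff_diff_eq add.commute)
    show ?thesis
      unfolding sum_distrib_left
      by (subst sum.swap) (simp add: swap mult.left_commute)
  qed
  also have "\<dots> = (\<Sum>h\<in>F. coeff x h * coeff (z * y) (g - h))"
  proof (intro sum.cong refl arg_cong2[of _ _ _ _ "(*)"] coeff_times_superset[OF finH, symmetric])
    fix h j assume "h \<in> F" "coeff z j \<noteq> 0" "coeff y (g - h - j) \<noteq> 0"
    then show "j \<in> H" using bx[of h] b'[of "g - h - j"] by (auto simp: F_def H_def incl_diff)
  qed
  also have "\<dots> = coeff (x * (z * y)) g"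
  proof (rule coeff_times_superset[OF finF, symmetric])
    fix h assume h: "coeff x h \<noteq> 0" "coeff (z * y) (g - h) \<noteq> 0"
    obtain j where "coeff z j \<noteq> 0" "coeff y (g - h - j) \<noteq> 0" using coeff_times_nonzero[OF h(2)] by blast
    then show "h \<in> F" using bz[of j] b'[of "g - h - j"] h by (auto simp: F_def incl_diff)
  qed
  finally show "coeff (x * y * z) g = coeff (x * (y * z)) g"
    by (simp add: novikov_mult_commute[of z y])
qed

lemma novikov_mult_one: "1 * x = (x :: ('a, 'b) novikov)"
proof (rule novikov_eqI)
  fix g :: 'b
  have "coeff (1 * x) g = (\<Sum>h\<in>{0}. coeff (1 :: ('a, 'b) novikov) h * coeff x (g - h))"
    by (rule coeff_times_superset) (auto simp: coeff_one split: if_splits)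
  then show "coeff (1 * x) g = coeff x g" by (simp add: coeff_one)
qed

lemma novikov_distrib: "(x + y) * z = x * z + y * (z :: ('a, 'b) novikov)"
proof (rule novikov_eqI)
  fix g :: 'b
  obtain bz where bz: "\<And>g. coeff z g \<noteq> 0 \<Longrightarrow> bz \<le> incl g"
    using coeff_lower_bound by blast
  define F where "F = {h. coeff x h \<noteq> 0 \<and> incl h \<le> incl g - bz} \<union> {h. coeff y h \<noteq> 0 \<and> incl h \<le> incl g - bz}"
  have F: "finite F" unfolding F_def by (intro finite_UnI finite_coeff_le)
  have *: "coeff (u * z) g = (\<Sum>h\<in>F. coeff u h * coeff z (g - h))"
    if "\<And>h. coeff u h \<noteq> 0 \<Longrightarrow> coeff x h \<noteq> 0 \<or> coeff y h \<noteq> 0" for u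
  proof (rule coeff_times_superset[OF F])
    fix h assume "coeff u h \<noteq> 0" "coeff z (g - h) \<noteq> 0"
    then show "h \<in> F" using that[of h] bz[of "g - h"] by (auto simp: F_def incl_diff)
  qed
  have "coeff ((x + y) * z) g = (\<Sum>h\<in>F. coeff (x + y) h * coeff z (g - h))"
    by (rule *) auto
  also have "\<dots> = (\<Sum>h\<in>F. coeff x h * coeff z (g - h)) + (\<Sum>h\<in>F. coeff y h * coeff z (g - h))"
    by (simp add: distrib_right sum.distrib)
  also have "\<dots> = coeff (x * z) g + coeff (y * z) g"
    using *[of x] *[of y] by simp
  finally show "coeff ((x + y) * z) g = coeff (x * z + y * z) g" by simp
qed

instance
proof
  fix a b c :: "('a, 'b) novikov"
  show "a * b * c = a * (b * c)" by (rule novikov_mult_assoc)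
  show "a * b = b * a" by (rule novikov_mult_commute)
  show "1 * a = a" by (rule novikov_mult_one)
  show "(a + b) * c = a * c + b * c" by (rule novikov_distrib)
  show "0 \<noteq> (1 :: ('a, 'b) novikov)"
    by (metis coeff_one coeff_zero zero_neq_one)
qed (rule novikov_eqI; simp)+

end

lemma coeff_sum: "coeff (\<Sum>i\<in>A. f i) g = (\<Sum>i\<in>A. coeff (f i) g)"
  by (induction A rule: infinite_finite_induct) auto

lemma novikov_geometric_inverse:
  fixes u :: "('k::field, 'g::real_subgroup) novikov"
  assumes pos: "\<And>h. coeff u h \<noteq> 0 \<Longrightarrow> 0 < incl h"
  shows "\<exists>y. (1 - u) * y = 1"
proof -
  define S where "S = {h. coeff u h \<noteq> 0 \<and> incl h \<le> 1}"
  have finS: "finite S" unfolding S_def by (rule finite_coeff_le)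
  define e where "e = Min (insert 1 (incl ` S))"
  have e: "0 < e" unfolding e_def using finS pos by (subst Min_gr_iff) (auto simp: S_def)
  have ue: "e \<le> incl h" if "coeff u h \<noteq> 0" for h
  proof (cases "incl h \<le> 1")
    case True
    then show ?thesis unfolding e_def using that finS by (intro Min_le) (auto simp: S_def)
  next
    case False
    have "e \<le> 1" unfolding e_def using finS by (intro Min_le) auto
    then show ?thesis using False by linarith
  qed
  have pow: "real n * e \<le> incl g" if "coeff (u ^ n) g \<noteq> 0" for n g
    using that
  proof (induction n arbitrary: g)
    case 0
    then show ?case by (auto simp: coeff_one split: if_splits)
  next
    case (Suc n)
    then obtain h where h: "coeff u h \<noteq> 0" "coeff (u ^ n) (g - h) \<noteq> 0"
      using coeff_times_nonzero[of u "u ^ n" g] by auto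
    show ?case using ue[OF h(1)] Suc.IH[OF h(2)] by (simp add: incl_diff algebra_simps)
  qed
  define P where "P M = (\<Sum>n<M. u ^ n)" for M :: nat
  have P_mono: "coeff (P M) g = coeff (P N) g" if "M \<le> N" "incl g < real M * e" for M N g
    unfolding P_def coeff_sum
  proof (rule sum.mono_neutral_left)
    show "\<forall>i\<in>{..<N} - {..<M}. coeff (u ^ i) g = 0"
    proof
      fix i assume "i \<in> {..<N} - {..<M}"
      then have "real M * e \<le> real i * e" using e by auto
      then show "coeff (u ^ i) g = 0" using pow[of i g] that by force
    qed
  qed (use that in auto)
  have P_eq: "coeff (P M) g = coeff (P N) g" if "incl g < real M * e" "incl g < real N * e" for M N g
    by (metis P_mono that nle_le)
  have ex: "\<exists>M. C < real M * e" for C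
    using ex_less_of_nat_mult[OF e] by blast
  define N where "N g = (SOME M. incl g < real M * e)" for g :: 'g
  have N: "incl g < real (N g) * e" for g
    unfolding N_def using someI_ex[OF ex] .
  have PN: "coeff (P (N g)) g = coeff (P M) g" if "incl g < real M * e" for g M
    by (rule P_eq[OF N that])
  define y where "y = Novikov (\<lambda>g. coeff (P (N g)) g)"
  have y: "coeff y g = coeff (P (N g)) g" for g
    unfolding y_def
  proof (subst coeff_Novikov)
    fix C
    obtain M where M: "C < real M * e" using ex by blast
    have "{g. incl g < C \<and> coeff (P (N g)) g \<noteq> 0} \<subseteq> {g. incl g < C \<and> coeff (P M) g \<noteq> 0}"
    proof (intro subsetI CollectI conjI)
      fix g assume "g \<in> {g. incl g < C \<and> coeff (P (N g)) g \<noteq> 0}"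
      then have g: "incl g < C" "coeff (P (N g)) g \<noteq> 0" by auto
      show "incl g < C" by (rule g(1))
      have "incl g < real M * e" using g(1) M by (rule less_trans)
      then show "coeff (P M) g \<noteq> 0" using g(2) by (simp only: PN not_False_eq_True)
    qed
    then show "finite {g. incl g < C \<and> coeff (P (N g)) g \<noteq> 0}"
      by (rule finite_subset) (rule finite_coeff_less)
  qed simp
  have "(1 - u) * y = 1"
  proof (rule novikov_eqI)
    fix g :: 'g
    obtain M where M: "incl g < real M * e" using ex by blast
    have d: "coeff (y - P M) h = 0" if "incl h \<le> incl g" for h
    proof -
      have "incl h < real M * e" using that M by (rule le_less_trans)
      then have "coeff y h = coeff (P M) h" unfolding y by (rule PN)
      then show ?thesis by simp
    qed
    have "1 - u ^ M = (1 - u) * P M"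
      unfolding P_def by (rule one_diff_power_eq)
    then have "(1 - u) * y = 1 - u ^ M + (1 - u) * (y - P M)"
      by (simp only: right_diff_distrib) simp
    moreover have "coeff (u ^ M) g = 0" using pow[of M g] M by force
    moreover have "coeff ((1 - u) * (y - P M)) g = 0"
    proof (rule ccontr)
      assume "coeff ((1 - u) * (y - P M)) g \<noteq> 0"
      then obtain h where h: "coeff (1 - u) h \<noteq> 0" "coeff (y - P M) (g - h) \<noteq> 0"
        using coeff_times_nonzero by blast
      have "0 \<le> incl h"
        using h(1) pos[of h] by (cases "h = 0") (auto simp: coeff_one)
      then show False using d[of "g - h"] h(2) by (simp add: incl_diff)
    qed
    ultimately show "coeff ((1 - u) * y) g = coeff 1 g" by simp
  qed
  then show ?thesis by blast
qed

lemma novikov_inverse_exists: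
  fixes x :: "('k::field, 'g::real_subgroup) novikov"
  assumes "x \<noteq> 0"
  shows "\<exists>y. x * y = 1"
proof -
  obtain h where h: "coeff x h \<noteq> 0" using assms novikov_eqI[of x 0] by auto
  define S where "S = {g. coeff x g \<noteq> 0 \<and> incl g \<le> incl h}"
  have S: "finite S" "S \<noteq> {}" using h unfolding S_def by (auto intro: finite_coeff_le)
  have "Min (incl ` S) \<in> incl ` S" using S by (intro Min_in) auto
  then obtain m where m: "m \<in> S" "incl m = Min (incl ` S)" by auto
  have min: "incl m \<le> incl g" if "coeff x g \<noteq> 0" for g
  proof (cases "incl g \<le> incl h")
    case True
    then show ?thesis using m that S by (auto simp: S_def)
  next
    case False
    then show ?thesis using m by (auto simp: S_def)
  qed
  define t :: "('k, 'g) novikov" where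
    "t = Novikov (\<lambda>g. if g = - m then inverse (coeff x m) else 0)"
  have t: "coeff t g = (if g = - m then inverse (coeff x m) else 0)" for g
    unfolding t_def
  proof (subst coeff_Novikov)
    show "finite {g. incl g < C \<and> (if g = - m then inverse (coeff x m) else 0) \<noteq> 0}" for C
      by (rule finite_subset[of _ "{- m}"]) (auto split: if_splits)
  qed simp
  have tx: "coeff (t * x) g = inverse (coeff x m) * coeff x (g + m)" for g
  proof -
    have "coeff (t * x) g = (\<Sum>h\<in>{- m}. coeff t h * coeff x (g - h))"
      by (rule coeff_times_superset) (auto simp: t split: if_splits)
    then show ?thesis by (simp add: t)
  qed
  have "coeff x m \<noteq> 0" using m by (simp add: S_def)
  have "\<exists>y. (1 - (1 - t * x)) * y = 1"
  proof (rule novikov_geometric_inverse)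
    fix g assume g: "coeff (1 - t * x) g \<noteq> 0"
    then have "g \<noteq> 0" using \<open>coeff x m \<noteq> 0\<close> by (auto simp: coeff_one tx)
    moreover have "coeff x (g + m) \<noteq> 0" using g \<open>g \<noteq> 0\<close> by (auto simp: coeff_one tx)
    then have "0 \<le> incl g" using min[of "g + m"] by (simp add: incl_add)
    moreover have "incl g \<noteq> 0" using \<open>g \<noteq> 0\<close> incl_eq_iff[of g 0] by simp
    ultimately show "0 < incl g" by linarith
  qed
  then obtain y where "(t * x) * y = 1" by auto
  then have "x * (t * y) = 1" by (simp add: ac_simps)
  then show ?thesis by blast
qed

instantiation novikov :: (field, real_subgroup) field
begin

definition "inverse (x :: ('a, 'b) novikov) = (if x = 0 then 0 else (SOME y. x * y = 1))"
definition "x div y = x * inverse (y :: ('a, 'b) novikov)"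

instance
proof
  fix x :: "('a, 'b) novikov"
  assume "x \<noteq> 0"
  then have "x * inverse x = 1"
    using someI_ex[OF novikov_inverse_exists] by (simp add: inverse_novikov_def)
  then show "inverse x * x = 1" by (simp only: mult.commute)
qed (simp_all add: inverse_novikov_def divide_novikov_def)

end

text \<open>The minimum is attained because the support has finitely many points below any bound.\<close>

definition valuation :: "('k::field, 'g::real_subgroup) novikov \<Rightarrow> ereal" where
  "valuation x = (if x = 0 then \<infinity> else ereal (LEAST r. r \<in> incl ` {g. coeff x g \<noteq> 0}))"


section \<open>Orthogonalizable spaces\<close>

text \<open>
  Spaces over the Novikov field are subspaces \<open>V\<close> of an ambient vector space with scalar
  multiplication \<open>s\<close>, and ordered collections are lists, indexed from 0.
\<close>

definition na_normed_space ::
  "(('k::field, 'g::real_subgroup) novikov \<Rightarrow> 'c \<Rightarrow> 'c) \<Rightarrow> 'c::ab_group_add set \<Rightarrow> ('c \<Rightarrow> ereal) \<Rightarrow> bool"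
where
  "na_normed_space s V l \<longleftrightarrow>
     vector_space s \<and> module.subspace s V \<and>
     (\<forall>x\<in>V. l x \<noteq> \<infinity>) \<and>
     (\<forall>x\<in>V. l x = -\<infinity> \<longleftrightarrow> x = 0) \<and>
     (\<forall>x\<in>V. \<forall>c. l (s c x) = l x - valuation c) \<and>
     (\<forall>x\<in>V. \<forall>y\<in>V. l (x + y) \<le> max (l x) (l y))"

text \<open>The supremum is a maximum, with value \<open>-\<infinity>\<close> for the empty list, matching the filtration of the
  empty sum.\<close>

definition orthogonal ::
  "(('k::field, 'g::real_subgroup) novikov \<Rightarrow> 'c \<Rightarrow> 'c) \<Rightarrow> ('c::ab_group_add \<Rightarrow> ereal) \<Rightarrow> 'c list \<Rightarrow> bool"
where
  "orthogonal s l ws \<longleftrightarrow>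
     (\<forall>c :: nat \<Rightarrow> ('k, 'g) novikov.
        l (\<Sum>i<length ws. s (c i) (ws ! i)) = (SUP i\<in>{..<length ws}. l (s (c i) (ws ! i))))"

definition ordered_basis ::
  "(('k::field, 'g::real_subgroup) novikov \<Rightarrow> 'c \<Rightarrow> 'c) \<Rightarrow> 'c::ab_group_add set \<Rightarrow> 'c list \<Rightarrow> bool"
where
  "ordered_basis s V ws \<longleftrightarrow>
     distinct ws \<and> \<not> module.dependent s (set ws) \<and> module.span s (set ws) = V"

definition orthogonal_ordered_basis ::
  "(('k::field, 'g::real_subgroup) novikov \<Rightarrow> 'c \<Rightarrow> 'c) \<Rightarrow> 'c::ab_group_add set \<Rightarrow> ('c \<Rightarrow> ereal)
     \<Rightarrow> 'c list \<Rightarrow> bool"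
where
  "orthogonal_ordered_basis s V l ws \<longleftrightarrow> ordered_basis s V ws \<and> orthogonal s l ws"

text \<open>Finite-dimensionality is implied by the existence of a basis that is a (finite) list.\<close>

definition orthogonalizable_space ::
  "(('k::field, 'g::real_subgroup) novikov \<Rightarrow> 'c \<Rightarrow> 'c) \<Rightarrow> 'c::ab_group_add set \<Rightarrow> ('c \<Rightarrow> ereal) \<Rightarrow> bool"
where
  "orthogonalizable_space s V l \<longleftrightarrow>
     na_normed_space s V l \<and> (\<exists>ws. orthogonal_ordered_basis s V l ws)"


section \<open>Singular value decompositions\<close>

definition map_rank ::
  "(('k::field, 'g::real_subgroup) novikov \<Rightarrow> 'd \<Rightarrow> 'd) \<Rightarrow> 'c set \<Rightarrow> ('c \<Rightarrow> 'd::ab_group_add) \<Rightarrow> nat"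
where
  "map_rank s V A = vector_space.dim s (A ` V)"

definition is_svd ::
  "(('k::field, 'g::real_subgroup) novikov \<Rightarrow> 'c \<Rightarrow> 'c) \<Rightarrow> 'c::ab_group_add set \<Rightarrow> ('c \<Rightarrow> ereal) \<Rightarrow>
   (('k, 'g) novikov \<Rightarrow> 'd \<Rightarrow> 'd) \<Rightarrow> 'd::ab_group_add set \<Rightarrow> ('d \<Rightarrow> ereal) \<Rightarrow>
   ('c \<Rightarrow> 'd) \<Rightarrow> 'c list \<Rightarrow> 'd list \<Rightarrow> bool"
where
  "is_svd s V lV t W lW A ys xs \<longleftrightarrow>
     (let r = map_rank t V A in
        orthogonal_ordered_basis s V lV ys \<and>
        orthogonal_ordered_basis t W lW xs \<and>
        orthogonal_ordered_basis s {v \<in> V. A v = 0} lV (drop r ys) \<and>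
        orthogonal_ordered_basis t (A ` V) lW (take r xs) \<and>
        (\<forall>i<r. A (ys ! i) = xs ! i) \<and>
        (\<forall>i j. i \<le> j \<longrightarrow> j < r \<longrightarrow>
           lV (ys ! i) - lW (xs ! i) \<ge> lV (ys ! j) - lW (xs ! j)))"


section \<open>Floer-type complexes\<close>

text \<open>The type \<open>'c\<close> is the total space, \<open>grade k\<close> its degree-\<open>k\<close> summand.\<close>

record (overloaded) ('k, 'g, 'c) floer =
  smul :: "('k, 'g) novikov \<Rightarrow> 'c \<Rightarrow> 'c"
  grade :: "int \<Rightarrow> 'c set"
  bdry :: "'c \<Rightarrow> 'c"
  filt :: "'c \<Rightarrow> ereal"

definition internal_direct_sum :: "(int \<Rightarrow> 'c::ab_group_add set) \<Rightarrow> bool" where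
  "internal_direct_sum V \<longleftrightarrow>
     (\<forall>x. \<exists>!f. (\<forall>k. f k \<in> V k) \<and> finite {k. f k \<noteq> 0} \<and> x = (\<Sum>k | f k \<noteq> 0. f k))"

definition floer_complex ::
  "('k::field, 'g::real_subgroup, 'c::ab_group_add) floer \<Rightarrow> bool"
where
  "floer_complex C \<longleftrightarrow>
     vector_space (smul C) \<and>
     (\<forall>k. module.subspace (smul C) (grade C k)) \<and>
     internal_direct_sum (grade C) \<and>
     Vector_Spaces.linear (smul C) (smul C) (bdry C) \<and>
     (\<forall>k. bdry C ` grade C k \<subseteq> grade C (k - 1)) \<and>
     (\<forall>x. bdry C (bdry C x) = 0) \<and>
     (\<forall>k. orthogonalizable_space (smul C) (grade C k) (filt C)) \<and>
     (\<forall>k. \<forall>x\<in>grade C k. filt C (bdry C x) \<le> filt C x)"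

definition cycles :: "('k, 'g, 'c::ab_group_add) floer \<Rightarrow> int \<Rightarrow> 'c set" where
  "cycles C k = {x \<in> grade C k. bdry C x = 0}"


section \<open>Barcodes\<close>

text \<open>An element of the quotient of the reals by \<open>\<Gamma>\<close> is a coset, i.e. a set of reals; the type argument
  only serves to determine \<open>\<Gamma>\<close>.\<close>

type_synonym bar = "real set \<times> ereal"

definition coset_mod :: "'g::real_subgroup itself \<Rightarrow> real \<Rightarrow> real set" where
  "coset_mod _ a = {a + incl g | g :: 'g. True}"

text \<open>Filtration values of basis elements are finite, so \<^const>\<open>real_of_ereal\<close> loses nothing.\<close>

definition svd_barcode ::
  "('k::field, 'g::real_subgroup, 'c) floer \<Rightarrow> nat \<Rightarrow> 'c list \<Rightarrow> 'c list \<Rightarrow> bar multiset"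
where
  "svd_barcode C r ys xs =
     (let cls = (\<lambda>x. coset_mod TYPE('g) (real_of_ereal (filt C x))) in
        mset (map (\<lambda>i. (cls (xs ! i), filt C (ys ! i) - filt C (xs ! i))) [0..<r]) +
        mset (map (\<lambda>i. (cls (xs ! i), \<infinity>)) [r..<length xs]))"

definition verbose_barcode ::
  "('k::field, 'g::real_subgroup, 'c::ab_group_add) floer \<Rightarrow> int \<Rightarrow> bar multiset"
where
  "verbose_barcode C k =
     (let (ys, xs) = (SOME (ys, xs).
            is_svd (smul C) (grade C (k + 1)) (filt C) (smul C) (cycles C k) (filt C) (bdry C) ys xs)
      in svd_barcode C (map_rank (smul C) (grade C (k + 1)) (bdry C)) ys xs)"

definition concise_barcode ::
  "('k::field, 'g::real_subgroup, 'c::ab_group_add) floer \<Rightarrow> int \<Rightarrow> bar multiset"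
where
  "concise_barcode C k = filter_mset (\<lambda>(A, L). L > 0) (verbose_barcode C k)"

definition shortest_length :: "bar multiset \<Rightarrow> ereal" where
  "shortest_length S = (if S = {#} then \<infinity> else Min (snd ` set_mset S))"


section \<open>Bottleneck distance\<close>

text \<open>For cosets of \<open>\<Gamma>\<close> the condition does not depend on the representative \<open>a\<close>.  In \<open>ereal\<close>, if exactly
  one of the lengths is infinite, the last inequality fails.\<close>

definition bars_close :: "real \<Rightarrow> bar \<Rightarrow> bar \<Rightarrow> bool" where
  "bars_close \<delta> = (\<lambda>(A, L) (A', L').
     \<forall>a\<in>A. \<forall>\<epsilon>>0. \<exists>a'\<in>A'.
       \<bar>a' - a\<bar> \<le> \<delta> + \<epsilon> \<and>
       (L = \<infinity> \<and> L' = \<infinity> \<or> \<bar>(ereal a' + L') - (ereal a + L)\<bar> \<le> ereal (\<delta> + \<epsilon>)))"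

text \<open>\<^const>\<open>rel_mset\<close> asserts a bijection, respecting multiplicities, between related elements.\<close>

definition matching :: "real \<Rightarrow> bar multiset \<Rightarrow> bar multiset \<Rightarrow> bool" where
  "matching \<delta> S T \<longleftrightarrow>
     (\<exists>Ss Ts. Ss \<subseteq># S \<and> Ts \<subseteq># T \<and>
        (\<forall>(A, L)\<in>#Ss + Ts. L \<le> ereal (2 * \<delta>)) \<and>
        rel_mset (bars_close \<delta>) (S - Ss) (T - Ts))"

definition bottleneck_dist :: "bar multiset \<Rightarrow> bar multiset \<Rightarrow> ereal" where
  "bottleneck_dist S T = Inf {ereal \<delta> | \<delta>. 0 \<le> \<delta> \<and> matching \<delta> S T}"

definition bottleneck_dist_family :: "(int \<Rightarrow> bar multiset) \<Rightarrow> (int \<Rightarrow> bar multiset) \<Rightarrow> ereal" where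
  "bottleneck_dist_family S T = (SUP k. bottleneck_dist (S k) (T k))"


section \<open>Quasiequivalence distance\<close>

definition quasiequivalence ::
  "real \<Rightarrow> ('k::field, 'g::real_subgroup, 'c::ab_group_add) floer \<Rightarrow>
   ('k, 'g, 'd::ab_group_add) floer \<Rightarrow>
   ('c \<Rightarrow> 'd) \<Rightarrow> ('d \<Rightarrow> 'c) \<Rightarrow> ('c \<Rightarrow> 'c) \<Rightarrow> ('d \<Rightarrow> 'd) \<Rightarrow> bool"
where
  "quasiequivalence \<delta> C D \<Phi> \<Psi> KC KD \<longleftrightarrow>
     Vector_Spaces.linear (smul C) (smul D) \<Phi> \<and>
     Vector_Spaces.linear (smul D) (smul C) \<Psi> \<and>
     Vector_Spaces.linear (smul C) (smul C) KC \<and>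
     Vector_Spaces.linear (smul D) (smul D) KD \<and>
     (\<forall>k. \<Phi> ` grade C k \<subseteq> grade D k) \<and>
     (\<forall>k. \<Psi> ` grade D k \<subseteq> grade C k) \<and>
     (\<forall>k. KC ` grade C k \<subseteq> grade C (k + 1)) \<and>
     (\<forall>k. KD ` grade D k \<subseteq> grade D (k + 1)) \<and>
     (\<forall>c. \<Phi> (bdry C c) = bdry D (\<Phi> c)) \<and>
     (\<forall>d. \<Psi> (bdry D d) = bdry C (\<Psi> d)) \<and>
     (\<forall>c. \<Psi> (\<Phi> c) - c = bdry C (KC c) + KC (bdry C c)) \<and>
     (\<forall>d. \<Phi> (\<Psi> d) - d = bdry D (KD d) + KD (bdry D d)) \<and>
     (\<forall>k. \<forall>c\<in>grade C k. filt D (\<Phi> c) \<le> filt C c + ereal \<delta>) \<and>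
     (\<forall>k. \<forall>d\<in>grade D k. filt C (\<Psi> d) \<le> filt D d + ereal \<delta>) \<and>
     (\<forall>k. \<forall>c\<in>grade C k. filt C (KC c) \<le> filt C c + ereal (2 * \<delta>)) \<and>
     (\<forall>k. \<forall>d\<in>grade D k. filt D (KD d) \<le> filt D d + ereal (2 * \<delta>))"

definition quasiequivalence_dist ::
  "('k::field, 'g::real_subgroup, 'c::ab_group_add) floer \<Rightarrow>
   ('k, 'g, 'd::ab_group_add) floer \<Rightarrow> ereal"
where
  "quasiequivalence_dist C D =
     Inf {ereal \<delta> | \<delta>. 0 \<le> \<delta> \<and> (\<exists>\<Phi> \<Psi> KC KD. quasiequivalence \<delta> C D \<Phi> \<Psi> KC KD)}"

end

theory Submission
  imports Defs
begin

text \<open>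
  The bottleneck distance is in fact at most the quasiequivalence distance in every degree.  In the bases
  of two singular value decompositions, the coefficients of a chain map \<open>\<Phi>\<close> of a
  \<open>\<delta>\<close>-quasiequivalence raise births and deaths by at most \<open>\<delta>\<close>, and the homotopy makes
  \<open>\<Psi>\<Phi>\<close> the identity up to terms that lower the midpoint of every bar longer than
  \<open>2\<delta>\<close>.  A path through \<open>\<Phi>\<close> and \<open>\<Psi>\<close> that does not lower the midpoint
  passes through a bar \<open>\<delta>\<close>-close to one of its ends (an idea of Bjerkevik), so the product of the
  matrices restricted to the bars close to a set of \<open>n\<close> long bars is invertible, and there are at
  least \<open>n\<close> such bars.  Hall's theorem matches the long bars of each complex into the other, and the
  theorem of Mendelsohn and Dulmage combines the two matchings.

  Conversely, the singular value decompositions in all degrees give bases adapted to the boundary map; a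
  matching defines \<open>\<Phi>\<close> and \<open>\<Psi>\<close> on them by shifting matched basis elements by powers of
  \<open>T\<close> and killing unmatched ones, which the homotopy sending \<open>x\<^sub>i\<close> to \<open>-y\<^sub>i\<close> compensates.
\<close>

section \<open>Valuations\<close>

text \<open>One matrix carries both bounds. Births are read off from \<Phi> on the cycles
  \<open>svd_x\<close>, deaths from \<Phi> on \<open>svd_y\<close>, because the boundary turns the
  coefficients of the latter into those of the former. The midpoint, half of birth plus death, is
  the weight that detects closeness: along one leg of a path neither number rises by more than
  \<delta>, so if the leg is not \<delta>-close then one of them falls by more than \<delta>, and
  the midpoint falls.

  The subgroup \<Gamma> may be dense, so the slack \<epsilon> in the definition of a matching need
  not be absorbed by a single shift. A quasiequivalence yields shifts as exponents of nonzero
  coefficients, without loss; in the converse direction every \<delta>' above \<delta> is used, and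
  the infimum removes the loss.

  The decompositions in adjacent degrees choose their bases independently. An adapted basis keeps
  the vectors with nonzero boundary from one of them and takes its cycles from the other.\<close>

lemma novikov_min_support:
  assumes "x \<noteq> 0"
  shows "\<exists>g. coeff x g \<noteq> 0 \<and> (\<forall>h. coeff x h \<noteq> 0 \<longrightarrow> incl g \<le> incl h)"
proof -
  obtain h where h: "coeff x h \<noteq> 0"
    using assms by (metis coeff_zero novikov_eqI)
  define S where "S = {g. coeff x g \<noteq> 0 \<and> incl g \<le> incl h}"
  have S: "finite S" "S \<noteq> {}"
    using h unfolding S_def by (auto intro: finite_coeff_le)
  have "Min (incl ` S) \<in> incl ` S" using S by (intro Min_in) auto
  then obtain m where m: "m \<in> S" "incl m = Min (incl ` S)" by auto
  have "incl m \<le> incl g" if "coeff x g \<noteq> 0" for g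
  proof (cases "incl g \<le> incl h")
    case True
    then show ?thesis using m that S by (auto simp: S_def)
  next
    case False
    then show ?thesis using m by (auto simp: S_def)
  qed
  then show ?thesis using m by (auto simp: S_def)
qed

lemma valuation_zero [simp]: "valuation 0 = \<infinity>"
  by (simp add: valuation_def)

lemma valuation_eqI:
  assumes "coeff x g \<noteq> 0" "\<And>h. coeff x h \<noteq> 0 \<Longrightarrow> incl g \<le> incl h"
  shows "valuation x = ereal (incl g)"
proof -
  have "(LEAST r. r \<in> incl ` {g. coeff x g \<noteq> 0}) = incl g"
    using assms by (intro Least_equality) auto
  then show ?thesis using assms(1) by (auto simp: valuation_def)
qed

lemma valuation_attained:
  assumes "x \<noteq> 0"
  obtains g where "coeff x g \<noteq> 0" "valuation x = ereal (incl g)"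
  using novikov_min_support[OF assms] valuation_eqI by blast

lemma valuation_le_incl: "coeff x g \<noteq> 0 \<Longrightarrow> valuation x \<le> ereal (incl g)"
  by (metis coeff_zero ereal_less_eq(3) novikov_min_support valuation_eqI)

lemma valuation_not_MInf [simp]: "valuation x \<noteq> -\<infinity>"
  by (cases "x = 0") (auto elim: valuation_attained)

text \<open>The monomial T to the power g. Scaling by it lowers the filtration by
  \<open>incl g\<close>, which moves the level of a basis vector within its class modulo
  \<Gamma>.\<close>

definition nov_T :: "'g::real_subgroup \<Rightarrow> ('k::field, 'g) novikov" where
  "nov_T g = Novikov (\<lambda>h. if h = g then 1 else 0)"

lemma coeff_nov_T: "coeff (nov_T g :: ('k::field, 'g::real_subgroup) novikov) h = (if h = g then 1 else 0)"
  unfolding nov_T_def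
proof (subst coeff_Novikov)
  show "finite {h. incl h < C \<and> (if h = g then 1 else 0) \<noteq> (0 :: 'k)}" for C
    by (rule finite_subset[of _ "{g}"]) (auto split: if_splits)
qed simp

lemma valuation_nov_T [simp]: "valuation (nov_T g) = ereal (incl g)"
  by (rule valuation_eqI) (auto simp: coeff_nov_T split: if_splits)

lemma nov_T_zero [simp]: "nov_T 0 = 1"
  by (rule novikov_eqI) (simp add: coeff_nov_T coeff_one)

lemma nov_T_mult: "nov_T g * nov_T h = (nov_T (g + h) :: ('k::field, 'g::real_subgroup) novikov)"
proof (rule novikov_eqI)
  fix f :: 'g
  have "coeff (nov_T g * nov_T h :: ('k, 'g) novikov) f =
    (\<Sum>e\<in>{g}. coeff (nov_T g :: ('k, 'g) novikov) e * coeff (nov_T h :: ('k, 'g) novikov) (f - e))"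
    by (rule coeff_times_superset) (auto simp: coeff_nov_T split: if_splits)
  then show "coeff (nov_T g * nov_T h :: ('k, 'g) novikov) f = coeff (nov_T (g + h) :: ('k, 'g) novikov) f"
    by (auto simp: coeff_nov_T algebra_simps)
qed

lemma valuation_minus [simp]: "valuation (- x) = valuation x"
  by (simp add: valuation_def)

lemma valuation_one [simp]: "valuation 1 = 0"
  by (metis nov_T_zero valuation_nov_T incl_zero zero_ereal_def)


section \<open>A rank inequality for matrices over the Novikov field\<close>

text \<open>Gaussian elimination, one equation per induction step: a pivot p for equation n is
  eliminated, and the induction hypothesis solves the reduced system in the remaining
  unknowns.\<close>

lemma underdetermined_system:
  fixes M :: "'a \<Rightarrow> 'b \<Rightarrow> 'f::field"
  assumes "finite N" "finite A" "card N < card A"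
  shows "\<exists>v. (\<exists>i\<in>A. v i \<noteq> 0) \<and> (\<forall>j\<in>N. (\<Sum>i\<in>A. v i * M i j) = 0)"
  using assms
proof (induction N arbitrary: A M rule: finite_induct)
  case empty
  then show ?case by (intro exI[of _ "\<lambda>_. 1"]) (auto simp: card_gt_0_iff)
next
  case (insert n N)
  show ?case
  proof (cases "\<forall>i\<in>A. M i n = 0")
    case True
    have "card N < card A" using insert by simp
    from insert.IH[OF insert.prems(1) this, of M] True show ?thesis by auto
  next
    case False
    then obtain p where p: "p \<in> A" "M p n \<noteq> 0" by blast
    define A' where "A' = A - {p}"
    have A': "finite A'" "card N < card A'" "p \<notin> A'" "A = insert p A'"
      using insert p by (auto simp: A'_def card_Diff_singleton)
    obtain v where v: "\<exists>i\<in>A'. v i \<noteq> 0"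
      "\<And>j. j \<in> N \<Longrightarrow> (\<Sum>i\<in>A'. v i * (M i j - M i n / M p n * M p j)) = 0"
      using insert.IH[OF A'(1,2), of "\<lambda>i j. M i j - M i n / M p n * M p j"] by blast
    \<comment> \<open>Equation n forces this value of the pivot coordinate; the correction term in
      the reduced matrix makes the same value work for the other equations.\<close>
    define c where "c = - (\<Sum>i\<in>A'. v i * M i n / M p n)"
    define w where "w = v(p := c)"
    have w: "(\<Sum>i\<in>A. w i * M i j) = c * M p j + (\<Sum>i\<in>A'. v i * M i j)" for j
    proof -
      have "(\<Sum>i\<in>A'. w i * M i j) = (\<Sum>i\<in>A'. v i * M i j)"
        using A' by (intro sum.cong) (auto simp: w_def)
      then show ?thesis using A' by (simp add: w_def)
    qed
    have "(\<Sum>i\<in>A. w i * M i j) = 0" if "j \<in> insert n N" for j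
    proof (cases "j = n")
      case True
      have "(\<Sum>i\<in>A'. v i * M i n / M p n) * M p n = (\<Sum>i\<in>A'. v i * M i n)"
        unfolding sum_distrib_right using p by (intro sum.cong) auto
      then show ?thesis using True by (simp add: w c_def)
    next
      case False
      then have "(\<Sum>i\<in>A'. v i * (M i j - M i n / M p n * M p j)) = 0" using that v by blast
      then have "(\<Sum>i\<in>A'. v i * M i j) = (\<Sum>i\<in>A'. v i * M i n / M p n) * M p j"
        by (simp add: right_diff_distrib sum_subtractf sum_distrib_right mult.assoc)
      then show ?thesis by (simp add: w c_def)
    qed
    moreover have "\<exists>i\<in>A. w i \<noteq> 0" using v(1) A' by (auto simp: w_def)
    ultimately show ?thesis by blast
  qed
qed

text \<open>Every term of M beyond the identity lowers the weight m, which makes M invertible, like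
  1 plus a topologically nilpotent matrix. In a kernel vector take the coordinate p whose valuation
  minus weight is smallest: its leading term in equation p could only be cancelled by a coordinate
  where that difference is smaller still.\<close>

lemma weighted_unipotent_kernel:
  fixes M :: "'i \<Rightarrow> 'i \<Rightarrow> ('k::field, 'g::real_subgroup) novikov" and m :: "'i \<Rightarrow> real"
  assumes A: "finite A"
    and M: "\<And>i i' g. i \<in> A \<Longrightarrow> i' \<in> A \<Longrightarrow> coeff (M i i' - (if i = i' then 1 else 0)) g \<noteq> 0
              \<Longrightarrow> m i' - m i < incl g"
    and v: "\<And>i'. i' \<in> A \<Longrightarrow> (\<Sum>i\<in>A. v i * M i i') = 0"
    and i: "i \<in> A"
  shows "v i = 0"
proof (rule ccontr)
  assume vi: "v i \<noteq> 0"
  define B where "B = {i\<in>A. v i \<noteq> 0}"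
  have B: "finite B" "B \<noteq> {}" using A i vi by (auto simp: B_def)
  have "\<forall>i\<in>B. \<exists>g. coeff (v i) g \<noteq> 0 \<and> (\<forall>h. coeff (v i) h \<noteq> 0 \<longrightarrow> incl g \<le> incl h)"
    using novikov_min_support by (auto simp: B_def)
  then obtain G where G: "\<And>i. i \<in> B \<Longrightarrow> coeff (v i) (G i) \<noteq> 0"
    "\<And>i h. i \<in> B \<Longrightarrow> coeff (v i) h \<noteq> 0 \<Longrightarrow> incl (G i) \<le> incl h" by metis
  define p where "p = arg_min_on (\<lambda>i. incl (G i) - m i) B"
  have p: "p \<in> B" "\<And>i. i \<in> B \<Longrightarrow> incl (G p) - m p \<le> incl (G i) - m i"
    unfolding p_def by (rule arg_min_if_finite(1)[OF B], rule arg_min_least[OF B])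
  have pA: "p \<in> A" using p by (simp add: B_def)
  have "(\<Sum>i\<in>A. v i * (M i p - (if i = p then 1 else 0))) = (\<Sum>i\<in>A. v i * M i p) - v p"
  proof -
    have "(\<Sum>i\<in>A. v i * (if i = p then 1 else 0)) = (\<Sum>i\<in>A. if i = p then v i else 0)"
      by (intro sum.cong) auto
    also have "\<dots> = v p" using A pA by simp
    finally show ?thesis by (simp only: right_diff_distrib sum_subtractf)
  qed
  \<comment> \<open>By equation p this sum is \<open>- v p\<close>, so its coefficient at the
    leading exponent of \<open>v p\<close> survives and comes from some q.\<close>
  then have "coeff (\<Sum>i\<in>A. v i * (M i p - (if i = p then 1 else 0))) (G p) \<noteq> 0"
    using v[OF pA] G(1)[OF p(1)] by simp
  then obtain q where q: "q \<in> A" "coeff (v q * (M q p - (if q = p then 1 else 0))) (G p) \<noteq> 0"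
    unfolding coeff_sum by (meson sum.neutral)
  obtain h where h: "coeff (v q) h \<noteq> 0" "coeff (M q p - (if q = p then 1 else 0)) (G p - h) \<noteq> 0"
    using coeff_times_nonzero[OF q(2)] by blast
  have "q \<in> B" using q(1) h(1) by (auto simp: B_def)
  have "m p - m q < incl (G p) - incl h" using M[OF q(1) pA h(2)] by (simp add: incl_diff)
  moreover have "incl (G q) \<le> incl h" using G(2)[OF \<open>q \<in> B\<close> h(1)] .
  ultimately show False using p(2)[OF \<open>q \<in> B\<close>] by linarith
qed

text \<open>If N had fewer elements than A, some nonzero row vector would be killed by \<phi>, hence
  by the product, against \<open>weighted_unipotent_kernel\<close>.\<close>

lemma card_le_of_weighted_unipotent_product:
  fixes \<phi> :: "'i \<Rightarrow> 'j \<Rightarrow> ('k::field, 'g::real_subgroup) novikov" and m :: "'i \<Rightarrow> real"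
  assumes A: "finite A" and N: "finite N"
    and M: "\<And>i i' g. i \<in> A \<Longrightarrow> i' \<in> A \<Longrightarrow>
              coeff ((\<Sum>j\<in>N. \<phi> i j * \<psi> j i') - (if i = i' then 1 else 0)) g \<noteq> 0 \<Longrightarrow> m i' - m i < incl g"
  shows "card A \<le> card N"
proof (rule ccontr)
  assume "\<not> card A \<le> card N"
  then obtain v where v: "\<exists>i\<in>A. v i \<noteq> 0" "\<And>j. j \<in> N \<Longrightarrow> (\<Sum>i\<in>A. v i * \<phi> i j) = 0"
    using underdetermined_system[OF N A, of \<phi>] by force
  have "(\<Sum>i\<in>A. v i * (\<Sum>j\<in>N. \<phi> i j * \<psi> j i')) = (\<Sum>j\<in>N. (\<Sum>i\<in>A. v i * \<phi> i j) * \<psi> j i')" for i'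
    unfolding sum_distrib_left sum_distrib_right by (subst sum.swap) (simp add: mult.assoc)
  then have "(\<Sum>i\<in>A. v i * (\<Sum>j\<in>N. \<phi> i j * \<psi> j i')) = 0" for i'
    using v(2) by simp
  note kernel = this
  have "v i = 0" if "i \<in> A" for i
  proof (rule weighted_unipotent_kernel[where M = "\<lambda>i i'. \<Sum>j\<in>N. \<phi> i j * \<psi> j i'" and m = m])
    show "finite A" "i \<in> A" by fact+
    show "m i2 - m i1 < incl g"
      if "i1 \<in> A" "i2 \<in> A" "coeff ((\<Sum>j\<in>N. \<phi> i1 j * \<psi> j i2) - (if i1 = i2 then 1 else 0)) g \<noteq> 0" for i1 i2 g
      using M[OF that] .
    show "(\<Sum>i\<in>A. v i * (\<Sum>j\<in>N. \<phi> i j * \<psi> j i')) = 0" for i'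
      by (rule kernel)
  qed
  with v(1) show False by blast
qed

text \<open>
  A path \<open>i \<rightarrow> j \<rightarrow> T\<^sup>g i'\<close> through nonzero coefficients that does not lower the midpoint
  must have \<open>j\<close> close to one of its ends.  Hence, after restricting the intermediate indices to those
  close to \<open>A\<close>, the product still agrees with the identity up to terms lowering the midpoint.
\<close>

lemma card_le_card_close:
  fixes \<phi> :: "'i \<Rightarrow> 'j \<Rightarrow> ('k::field, 'g::real_subgroup) novikov" and a b :: "'i \<Rightarrow> real"
  assumes I: "A \<subseteq> I" "finite A" and J: "finite J"
    and \<phi>: "\<And>i j g. i \<in> I \<Longrightarrow> j \<in> J \<Longrightarrow> coeff (\<phi> i j) g \<noteq> 0 \<Longrightarrow>
              a' j - incl g \<le> a i + \<delta> \<and> b' j - incl g \<le> b i + \<delta>"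
    and \<psi>: "\<And>i j g. i \<in> I \<Longrightarrow> j \<in> J \<Longrightarrow> coeff (\<psi> j i) g \<noteq> 0 \<Longrightarrow>
              a i - incl g \<le> a' j + \<delta> \<and> b i - incl g \<le> b' j + \<delta>"
    and \<kappa>: "\<And>i i' g. i \<in> I \<Longrightarrow> i' \<in> I \<Longrightarrow>
              coeff ((\<Sum>j\<in>J. \<phi> i j * \<psi> j i') - (if i = i' then 1 else 0)) g \<noteq> 0 \<Longrightarrow>
              b i' - incl g \<le> a i + 2 * \<delta>"
    and long: "\<And>i. i \<in> A \<Longrightarrow> b i - a i > 2 * \<delta>"
  shows "card A \<le> card {j\<in>J. \<exists>i\<in>A. \<exists>g :: 'g. \<bar>a' j - incl g - a i\<bar> \<le> \<delta> \<and> \<bar>b' j - incl g - b i\<bar> \<le> \<delta>}"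
    (is "_ \<le> card ?N")
proof (rule card_le_of_weighted_unipotent_product[where \<phi> = \<phi> and \<psi> = \<psi> and m = "\<lambda>i. (a i + b i) / 2"])
  show "finite A" "finite ?N" using I J by auto
  fix i i' g assume i: "i \<in> A" "i' \<in> A"
    and g: "coeff ((\<Sum>j\<in>?N. \<phi> i j * \<psi> j i') - (if i = i' then 1 else 0)) g \<noteq> 0"
  have iI: "i \<in> I" "i' \<in> I" using i I by auto
  show "(a i' + b i') / 2 - (a i + b i) / 2 < incl g"
  proof (rule ccontr)
    assume neg: "\<not> ?thesis"
    have "coeff (\<phi> i j * \<psi> j i') g = 0" if j: "j \<in> J - ?N" for j
    proof (rule ccontr)
      assume "coeff (\<phi> i j * \<psi> j i') g \<noteq> 0"
      then obtain h where h: "coeff (\<phi> i j) h \<noteq> 0" "coeff (\<psi> j i') (g - h) \<noteq> 0"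
        using coeff_times_nonzero by blast
      have 1: "a' j - incl h \<le> a i + \<delta>" "b' j - incl h \<le> b i + \<delta>"
        using \<phi>[OF iI(1) _ h(1)] j by auto
      have 2: "a i' - (incl g - incl h) \<le> a' j + \<delta>" "b i' - (incl g - incl h) \<le> b' j + \<delta>"
        using \<psi>[OF iI(2) _ h(2)] j by (auto simp: incl_diff)
      have "\<not> (\<bar>a' j - incl h - a i\<bar> \<le> \<delta> \<and> \<bar>b' j - incl h - b i\<bar> \<le> \<delta>)"
        using j i by blast
      moreover have "\<not> (\<bar>a' j - incl (h - g) - a i'\<bar> \<le> \<delta> \<and> \<bar>b' j - incl (h - g) - b i'\<bar> \<le> \<delta>)"
        using j i by blast
      \<comment> \<open>On each leg birth and death rise by at most \<delta> and one of them falls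
        by more than \<delta>, so the path lowers the midpoint strictly, against
        \<open>neg\<close>.\<close>
      ultimately show False
        using 1 2 neg unfolding incl_diff by argo
    qed
    then have "coeff (\<Sum>j\<in>J. \<phi> i j * \<psi> j i') g = coeff (\<Sum>j\<in>?N. \<phi> i j * \<psi> j i') g"
      unfolding coeff_sum using J by (intro sum.mono_neutral_right) auto
    then have "coeff ((\<Sum>j\<in>J. \<phi> i j * \<psi> j i') - (if i = i' then 1 else 0)) g \<noteq> 0"
      using g by simp
    \<comment> \<open>A term beyond the identity puts the shifted death of i' at most 2 \<delta>
      above the birth of i. As both bars are longer than 2 \<delta>, birth and death both fall, and
      so does the midpoint.\<close>
    from \<kappa>[OF iI this] long[OF i(1)] long[OF i(2)] neg show False by argo
  qed
qed


section \<open>Matchings in bipartite graphs\<close>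

text \<open>The induction of Halmos and Vaughan. A proper nonempty subset B with equality splits the
  problem: B uses up its neighbours U, and Hall's condition for unions with B leaves enough
  neighbours outside U for the rest. Without such a subset every proper nonempty subset has a
  neighbour to spare, so any one pair can be fixed.\<close>

theorem hall_marriage:
  fixes S :: "'i \<Rightarrow> 'j set"
  assumes "finite A" "\<And>i. i \<in> A \<Longrightarrow> finite (S i)"
    and "\<And>B. B \<subseteq> A \<Longrightarrow> card B \<le> card (\<Union>i\<in>B. S i)"
  shows "\<exists>f. inj_on f A \<and> (\<forall>i\<in>A. f i \<in> S i)"
  using assms
proof (induction "card A" arbitrary: A S rule: less_induct)
  case less
  show ?case
  proof (cases "\<exists>B. B \<subset> A \<and> B \<noteq> {} \<and> card B = card (\<Union>i\<in>B. S i)")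
    case True
    then obtain B where B: "B \<subset> A" "B \<noteq> {}" "card B = card (\<Union>i\<in>B. S i)" by blast
    have finB: "finite B" using B less.prems finite_subset by blast
    define U where "U = (\<Union>i\<in>B. S i)"
    have finU: "finite U" unfolding U_def using finB B less.prems(2) by auto
    have "card B < card A" using B(1) less.prems(1) by (rule psubset_card_mono[rotated])
    then have "\<exists>f. inj_on f B \<and> (\<forall>i\<in>B. f i \<in> S i)"
      using finB B(1) less.prems(2,3) by (intro less.hyps) auto
    then obtain f where f: "inj_on f B" "\<forall>i\<in>B. f i \<in> S i" by blast
    have "\<exists>f. inj_on f (A - B) \<and> (\<forall>i\<in>A - B. f i \<in> S i - U)"
    proof (rule less.hyps)
      show "card (A - B) < card A"
        using B less.prems(1) by (intro psubset_card_mono) auto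
      fix E assume E: "E \<subseteq> A - B"
      have finE: "finite E" using E less.prems(1) finite_subset by blast
      have "card E + card B = card (E \<union> B)"
        using E by (intro card_Un_disjoint[symmetric] finE finB) auto
      also have "\<dots> \<le> card (\<Union>i\<in>E \<union> B. S i)"
        using E B by (intro less.prems(3)) auto
      also have "(\<Union>i\<in>E \<union> B. S i) = (\<Union>i\<in>E. S i - U) \<union> U"
        by (auto simp: U_def)
      also have "card \<dots> = card (\<Union>i\<in>E. S i - U) + card U"
        using E less.prems(2) by (intro card_Un_disjoint finU finite_UN_I finE finite_Diff) auto
      finally show "card E \<le> card (\<Union>i\<in>E. S i - U)" using B(3) by (simp add: U_def)
    qed (use less.prems in auto)
    then obtain f' where f': "inj_on f' (A - B)" "\<forall>i\<in>A - B. f' i \<in> S i - U" by blast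
    have "f i \<in> U" if "i \<in> B" for i using f(2) that by (auto simp: U_def)
    then have "inj_on (\<lambda>i. if i \<in> B then f i else f' i) A"
      using f f' unfolding inj_on_def by (metis Diff_iff)
    then show ?thesis using f f' by (intro exI[of _ "\<lambda>i. if i \<in> B then f i else f' i"]) auto
  next
    case False
    show ?thesis
    proof (cases "A = {}")
      case False
      then obtain p where p: "p \<in> A" by blast
      have "card {p} \<le> card (\<Union>i\<in>{p}. S i)" using p by (intro less.prems(3)) auto
      then have "S p \<noteq> {}" by auto
      then obtain y where y: "y \<in> S p" by blast
      have "\<exists>f. inj_on f (A - {p}) \<and> (\<forall>i\<in>A - {p}. f i \<in> S i - {y})"
      proof (rule less.hyps)
        show "card (A - {p}) < card A"
          using p less.prems(1) by (intro psubset_card_mono) auto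
        fix E assume E: "E \<subseteq> A - {p}"
        show "card E \<le> card (\<Union>i\<in>E. S i - {y})"
        proof (cases "E = {}")
          case False
          have "E \<subset> A" using E p by auto
          then have "card E \<noteq> card (\<Union>i\<in>E. S i)" "card E \<le> card (\<Union>i\<in>E. S i)"
            using False \<open>\<not> (\<exists>B. _ B)\<close> less.prems(3) by blast+
          moreover have "(\<Union>i\<in>E. S i - {y}) = (\<Union>i\<in>E. S i) - {y}" by auto
          ultimately show ?thesis by (cases "y \<in> (\<Union>i\<in>E. S i)") (auto simp: card_Diff_singleton)
        qed simp
      qed (use less.prems in auto)
      then obtain f where f: "inj_on f (A - {p})" "\<forall>i\<in>A - {p}. f i \<in> S i - {y}" by blast
      have "inj_on (f(p := y)) A" using f unfolding inj_on_def by auto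
      then show ?thesis using f y by (intro exI[of _ "f(p := y)"]) auto
    qed simp
  qed
qed

text \<open>The chain argument of the Schroeder-Bernstein theorem.\<close>

inductive_set md_chain :: "'i set \<Rightarrow> 'j set \<Rightarrow> ('i \<Rightarrow> 'j) \<Rightarrow> ('j \<Rightarrow> 'i) \<Rightarrow> 'i set"
  for A B f g where
    start: "x \<in> A \<Longrightarrow> x \<notin> g ` B \<Longrightarrow> x \<in> md_chain A B f g"
  | step: "x \<in> md_chain A B f g \<Longrightarrow> x \<in> A \<Longrightarrow> f x \<in> B \<Longrightarrow> g (f x) \<in> md_chain A B f g"

text \<open>The matching follows f on the chains that start outside the image of g, and the inverse
  of g elsewhere. Since f is defined only on A, a chain may run into a point outside A; that point
  is left unmatched, as its g-partner is already covered by the preceding f-edge.\<close>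

theorem mendelsohn_dulmage:
  assumes f: "inj_on f A" "\<And>x. x \<in> A \<Longrightarrow> f x \<in> Y \<and> R x (f x)" and A: "A \<subseteq> X"
    and g: "inj_on g B" "\<And>y. y \<in> B \<Longrightarrow> g y \<in> X \<and> R (g y) y" and B: "B \<subseteq> Y"
  shows "\<exists>X' Y' h. A \<subseteq> X' \<and> X' \<subseteq> X \<and> B \<subseteq> Y' \<and> Y' \<subseteq> Y \<and> bij_betw h X' Y' \<and> (\<forall>x\<in>X'. R x (h x))"
proof -
  define P where "P = md_chain A B f g"
  define h where "h x = (if x \<in> P then f x else the_inv_into B g x)" for x
  define X' where "X' = (P \<inter> A) \<union> (g ` B - P)"
  have inv: "the_inv_into B g (g y) = y" if "y \<in> B" for y
    using the_inv_into_f_f[OF g(1) that] .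
  have R: "R x (h x) \<and> h x \<in> Y" if "x \<in> X'" for x
    using that f(2) g(2) inv B by (auto simp: X'_def h_def)
  have no: "f x \<noteq> y" if "x \<in> P" "x \<in> A" "y \<in> B" "g y \<notin> P" for x y
    using that md_chain.step[of x A B f g] by (auto simp: P_def)
  have "inj_on h X'"
  proof (rule inj_onI)
    fix x x' assume x: "x \<in> X'" "x' \<in> X'" "h x = h x'"
    have cl: "z \<in> P \<and> z \<in> A \<and> h z = f z \<or> z \<notin> P \<and> (\<exists>y\<in>B. z = g y \<and> h z = y)" if "z \<in> X'" for z
      using that inv by (auto simp: X'_def h_def)
    show "x = x'"
      using cl[OF x(1)] cl[OF x(2)] x(3) no[of x] no[of x'] inj_onD[OF f(1), of x x'] by metis
  qed
  moreover have "A \<subseteq> X'"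
    using md_chain.start[of _ A g B f] by (auto simp: X'_def P_def)
  moreover have "B \<subseteq> h ` X'"
  proof
    fix y assume y: "y \<in> B"
    show "y \<in> h ` X'"
    proof (cases "g y \<in> P")
      case False
      then show ?thesis using y inv[OF y] by (intro image_eqI[of _ _ "g y"]) (auto simp: h_def X'_def)
    next
      case True
      then obtain x where x: "x \<in> P" "x \<in> A" "f x \<in> B" "g y = g (f x)"
        using y unfolding P_def by (cases rule: md_chain.cases) auto
      then have "y = f x" using g(1) y by (auto dest: inj_onD)
      then show ?thesis using x by (intro image_eqI[of _ _ x]) (auto simp: h_def X'_def)
    qed
  qed
  moreover have "X' \<subseteq> X" using A g(2) by (auto simp: X'_def)
  moreover have "h ` X' \<subseteq> Y" using R by auto
  ultimately show ?thesis using R by (intro exI[of _ X'] exI[of _ "h ` X'"] exI[of _ h]) (auto simp: bij_betw_def)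
qed

section \<open>Orthogonal bases as indexed families\<close>

locale na_normed = vector_space s
  for s :: "('k::field, 'g::real_subgroup) novikov \<Rightarrow> 'c::ab_group_add \<Rightarrow> 'c" +
  fixes V :: "'c set" and l :: "'c \<Rightarrow> ereal"
  assumes subspace_V: "subspace V"
    and l_not_PInf: "x \<in> V \<Longrightarrow> l x \<noteq> \<infinity>"
    and l_eq_MInf_iff: "x \<in> V \<Longrightarrow> l x = -\<infinity> \<longleftrightarrow> x = 0"
    and l_scale: "x \<in> V \<Longrightarrow> l (s c x) = l x - valuation c"
    and l_add: "x \<in> V \<Longrightarrow> y \<in> V \<Longrightarrow> l (x + y) \<le> max (l x) (l y)"

lemma na_normed_iff: "na_normed s V l \<longleftrightarrow> na_normed_space s V l"
proof -
  have "module.subspace s V \<Longrightarrow> vector_space s \<Longrightarrow> 0 \<in> V"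
    using module.subspace_0 module_iff_vector_space by blast
  then show ?thesis
    unfolding na_normed_def na_normed_axioms_def na_normed_space_def by auto
qed

text \<open>Indexing by an arbitrary finite set lets bases be exchanged, reindexed and spliced by
  disjoint sums without reference to an order. The inequality is the half of orthogonality that the
  ultrametric inequality does not give; for nonzero vectors it also contains linear
  independence.\<close>

definition orth_basis ::
  "(('k::field, 'g::real_subgroup) novikov \<Rightarrow> 'c \<Rightarrow> 'c) \<Rightarrow> 'c::ab_group_add set \<Rightarrow> ('c \<Rightarrow> ereal)
    \<Rightarrow> 'i set \<Rightarrow> ('i \<Rightarrow> 'c) \<Rightarrow> bool"
where
  "orth_basis s V l I e \<longleftrightarrow>
     finite I \<and> (\<forall>i\<in>I. e i \<in> V \<and> e i \<noteq> 0) \<and>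
     (\<forall>x\<in>V. \<exists>c. x = (\<Sum>i\<in>I. s (c i) (e i))) \<and>
     (\<forall>c. \<forall>i\<in>I. l (s (c i) (e i)) \<le> l (\<Sum>i\<in>I. s (c i) (e i)))"

lemma orth_basisD:
  assumes "orth_basis s V l I e"
  shows "finite I" "\<And>i. i \<in> I \<Longrightarrow> e i \<in> V" "\<And>i. i \<in> I \<Longrightarrow> e i \<noteq> 0"
    "\<And>x. x \<in> V \<Longrightarrow> \<exists>c. x = (\<Sum>i\<in>I. s (c i) (e i))"
    "\<And>c i. i \<in> I \<Longrightarrow> l (s (c i) (e i)) \<le> l (\<Sum>i\<in>I. s (c i) (e i))"
  using assms unfolding orth_basis_def by blast+

lemma orth_basis_reindex:
  assumes e: "orth_basis s V l I e" and \<pi>: "bij_betw \<pi> K I"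
  shows "orth_basis s V l K (e \<circ> \<pi>)"
proof -
  have im: "\<pi> ` K = I" and inj: "inj_on \<pi> K" using \<pi> by (auto simp: bij_betw_def)
  have sum: "(\<Sum>k\<in>K. s (c (\<pi> k)) (e (\<pi> k))) = (\<Sum>i\<in>I. s (c i) (e i))" for c
    using sum.reindex_bij_betw[OF \<pi>, of "\<lambda>i. s (c i) (e i)"] .
  have sum': "(\<Sum>k\<in>K. s (c k) (e (\<pi> k))) = (\<Sum>i\<in>I. s (c (the_inv_into K \<pi> i)) (e i))" for c
    by (subst sum[symmetric]) (auto intro!: sum.cong simp: the_inv_into_f_f[OF inj])
  show ?thesis
    unfolding orth_basis_def o_def
  proof (intro conjI ballI allI)
    show "finite K" using orth_basisD(1)[OF e] bij_betw_finite[OF \<pi>] by simp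
    show "e (\<pi> k) \<in> V" "e (\<pi> k) \<noteq> 0" if "k \<in> K" for k
      using that im orth_basisD(2,3)[OF e] by auto
    show "\<exists>c. x = (\<Sum>k\<in>K. s (c k) (e (\<pi> k)))" if "x \<in> V" for x
      using orth_basisD(4)[OF e that] sum by metis
    show "l (s (c k) (e (\<pi> k))) \<le> l (\<Sum>k\<in>K. s (c k) (e (\<pi> k)))" if "k \<in> K" for c k
      using orth_basisD(5)[OF e, of "\<pi> k" "\<lambda>i. c (the_inv_into K \<pi> i)"] that im
      unfolding sum' by (auto simp: the_inv_into_f_f[OF inj])
  qed
qed

lemma orth_basis_cong:
  assumes "\<And>i. i \<in> I \<Longrightarrow> e i = e' i"
  shows "orth_basis s V l I e = orth_basis s V l I e'"
  using assms unfolding orth_basis_def by (simp cong: sum.cong)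

context na_normed
begin

lemma zero_in_V [simp]: "0 \<in> V"
  by (rule subspace_0[OF subspace_V])

lemma l_zero [simp]: "l 0 = -\<infinity>"
  by (simp add: l_eq_MInf_iff)

lemma scale_in_V: "x \<in> V \<Longrightarrow> s c x \<in> V"
  by (rule subspace_scale[OF subspace_V])

lemma sum_in_V: "(\<And>i. i \<in> I \<Longrightarrow> e i \<in> V) \<Longrightarrow> (\<Sum>i\<in>I. s (c i) (e i)) \<in> V"
  by (intro subspace_sum[OF subspace_V] scale_in_V)

lemma l_minus: "x \<in> V \<Longrightarrow> l (- x) = l x"
  using l_scale[of x "- 1"] by simp

lemma l_finite: "x \<in> V \<Longrightarrow> x \<noteq> 0 \<Longrightarrow> \<exists>r. l x = ereal r"
  by (metis l_eq_MInf_iff l_not_PInf ereal_cases)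

lemma l_diff: "x \<in> V \<Longrightarrow> y \<in> V \<Longrightarrow> l (x - y) \<le> max (l x) (l y)"
  using l_add[of x "- y"] l_minus[of y] subspace_neg[OF subspace_V] by simp

lemma l_sum_le:
  assumes "\<And>i. i \<in> I \<Longrightarrow> x i \<in> V" "\<And>i. i \<in> I \<Longrightarrow> l (x i) \<le> B"
  shows "l (\<Sum>i\<in>I. x i) \<le> B"
  using assms
proof (induction I rule: infinite_finite_induct)
  case (insert i I)
  have "l (x i + (\<Sum>i\<in>I. x i)) \<le> max (l (x i)) (l (\<Sum>i\<in>I. x i))"
    using insert.prems by (intro l_add subspace_sum[OF subspace_V]) auto
  also have "\<dots> \<le> B" using insert by auto
  finally show ?case using insert by simp
qed auto

lemma l_scale_mono:
  assumes "x \<in> V" "y \<in> V" "l x \<le> l y"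
  shows "l (s c x) \<le> l (s c y)"
  using assms by (simp add: l_scale ereal_minus_mono)

lemma l_scale_le_iff:
  assumes "x \<in> V" "y \<in> V" "c \<noteq> 0"
  shows "l (s c x) \<le> l (s c y) \<longleftrightarrow> l x \<le> l y"
proof
  assume "l (s c x) \<le> l (s c y)"
  then have "l (s (inverse c) (s c x)) \<le> l (s (inverse c) (s c y))"
    using assms by (meson l_scale_mono scale_in_V)
  then show "l x \<le> l y" using assms by simp
qed (use l_scale_mono assms in auto)

text \<open>The difference of the two sums vanishes, so it has level -\<infinity>, and by
  orthogonality so has each of its terms.\<close>

lemma orth_basis_unique:
  assumes e: "orth_basis s V l I e" and eq: "(\<Sum>i\<in>I. s (c i) (e i)) = (\<Sum>i\<in>I. s (d i) (e i))"
    and i: "i \<in> I"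
  shows "c i = d i"
proof -
  have "(\<Sum>i\<in>I. s (c i - d i) (e i)) = 0"
    using eq by (simp add: scale_left_diff_distrib sum_subtractf)
  then have "l (s (c i - d i) (e i)) = -\<infinity>"
    using orth_basisD(5)[OF e i, of "\<lambda>i. c i - d i"] by simp
  then show ?thesis
    using orth_basisD(2,3)[OF e i] by (auto simp: l_eq_MInf_iff scale_in_V)
qed

lemma sum_restrict_scale:
  assumes "finite I" "K \<subseteq> I"
  shows "(\<Sum>i\<in>K. s (c i) (e i)) = (\<Sum>i\<in>I. s (if i \<in> K then c i else 0) (e i))"
  using assms by (intro sum.mono_neutral_cong_left) auto

lemma orth_basis_subset:
  assumes e: "orth_basis s V l I e" and K: "K \<subseteq> I" and U: "\<And>k. k \<in> K \<Longrightarrow> e k \<in> U"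
    and span: "\<And>x. x \<in> U \<Longrightarrow> \<exists>c. x = (\<Sum>i\<in>K. s (c i) (e i))"
  shows "orth_basis s U l K e"
  unfolding orth_basis_def
proof (intro conjI ballI allI)
  have fin: "finite I" by (rule orth_basisD(1)[OF e])
  show "finite K" by (rule finite_subset[OF K fin])
  show "l (s (c k) (e k)) \<le> l (\<Sum>k\<in>K. s (c k) (e k))" if "k \<in> K" for c k
    using orth_basisD(5)[OF e, of k "\<lambda>i. if i \<in> K then c i else 0"] that K
    unfolding sum_restrict_scale[OF fin K] by auto
qed (use K U span orth_basisD(2,3)[OF e] in auto)

lemma na_normed_subspace:
  assumes "subspace U" "U \<subseteq> V"
  shows "na_normed s U l"
proof
  show "l x \<noteq> \<infinity>" "l x = -\<infinity> \<longleftrightarrow> x = 0" "l (s c x) = l x - valuation c" if "x \<in> U" for x c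
    using subsetD[OF assms(2) that] by (simp_all add: l_not_PInf l_eq_MInf_iff l_scale)
  show "l (x + y) \<le> max (l x) (l y)" if "x \<in> U" "y \<in> U" for x y
    using subsetD[OF assms(2)] that by (simp add: l_add)
qed (rule assms(1))

lemma orthogonal_ordered_basis_iff:
  "orthogonal_ordered_basis s V l ws \<longleftrightarrow> orth_basis s V l {..<length ws} (\<lambda>i. ws ! i)"
proof
  assume "orthogonal_ordered_basis s V l ws"
  then have ws: "distinct ws" "independent (set ws)" "span (set ws) = V" "orthogonal s l ws"
    by (auto simp: orthogonal_ordered_basis_def ordered_basis_def)
  show "orth_basis s V l {..<length ws} (\<lambda>i. ws ! i)"
    unfolding orth_basis_def
  proof (intro conjI ballI allI)
    show "ws ! i \<in> V" if "i \<in> {..<length ws}" for i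
      using that ws(3) span_base[of "ws ! i" "set ws"] by simp
    show "ws ! i \<noteq> 0" if "i \<in> {..<length ws}" for i
      using that ws(2) by (metis dependent_zero lessThan_iff nth_mem)
    show "\<exists>c. x = (\<Sum>i<length ws. s (c i) (ws ! i))" if "x \<in> V" for x
    proof -
      obtain u where "x = (\<Sum>v\<in>set ws. s (u v) v)"
        using \<open>x \<in> V\<close> unfolding ws(3)[symmetric] span_finite[OF finite_set] by auto
      also have "\<dots> = (\<Sum>i<length ws. s (u (ws ! i)) (ws ! i))"
        using sum.reindex_bij_betw[OF bij_betw_nth[OF ws(1) refl refl], of "\<lambda>v. s (u v) v"] by simp
      finally show ?thesis by (rule exI[of _ "\<lambda>i. u (ws ! i)"])
    qed
    show "l (s (c i) (ws ! i)) \<le> l (\<Sum>i<length ws. s (c i) (ws ! i))" if "i \<in> {..<length ws}" for c i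
      using ws(4) that unfolding orthogonal_def by (auto intro!: SUP_upper)
  qed auto
next
  assume e: "orth_basis s V l {..<length ws} (\<lambda>i. ws ! i)"
  have inV: "ws ! i \<in> V" if "i < length ws" for i
    using orth_basisD(2)[OF e] that by auto
  have "distinct ws"
  proof (rule ccontr)
    assume "\<not> distinct ws"
    then obtain i j where ij: "i < length ws" "j < length ws" "i \<noteq> j" "ws ! i = ws ! j"
      by (auto simp: distinct_conv_nth)
    have delta: "(\<Sum>k<length ws. s (if k = i then 1 else 0) (ws ! k)) = ws ! i" if "i < length ws" for i
      using that by (simp add: if_distrib[of "\<lambda>c. s c _"] cong: if_cong)
    have "(if i = i then 1 else 0 :: ('k, 'g) novikov) = (if i = j then 1 else 0)"
      by (rule orth_basis_unique[OF e]) (use ij delta in auto)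
    then show False using ij by simp
  qed
  have bij: "bij_betw ((!) ws) {..<length ws} (set ws)"
    by (rule bij_betw_nth[OF \<open>distinct ws\<close> refl refl])
  have sum: "(\<Sum>v\<in>set ws. s (u v) v) = (\<Sum>i<length ws. s (u (ws ! i)) (ws ! i))" for u
    using sum.reindex_bij_betw[OF bij, of "\<lambda>v. s (u v) v"] by simp
  have "independent (set ws)"
  proof (rule independent_if_scalars_zero)
    fix u x assume u: "(\<Sum>v\<in>set ws. s (u v) v) = 0" "x \<in> set ws"
    then obtain i where i: "i < length ws" "x = ws ! i" by (auto simp: in_set_conv_nth)
    have "u (ws ! i) = 0"
      by (rule orth_basis_unique[OF e, of _ "\<lambda>_. 0"]) (use u i sum in auto)
    then show "u x = 0" using i by simp
  qed auto
  moreover have "span (set ws) = V"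
  proof (rule span_subspace)
    show "set ws \<subseteq> V" using inV by (auto simp: in_set_conv_nth)
    show "V \<subseteq> span (set ws)"
    proof
      fix x assume "x \<in> V"
      then obtain c where c: "x = (\<Sum>i<length ws. s (c i) (ws ! i))" using orth_basisD(4)[OF e] by blast
      show "x \<in> span (set ws)" unfolding c by (intro span_sum span_scale span_base) auto
    qed
  qed (rule subspace_V)
  moreover have "orthogonal s l ws"
    unfolding orthogonal_def
  proof (intro allI antisym)
    fix c
    show "l (\<Sum>i<length ws. s (c i) (ws ! i)) \<le> (SUP i\<in>{..<length ws}. l (s (c i) (ws ! i)))"
      by (intro l_sum_le scale_in_V inV SUP_upper) auto
    show "(SUP i\<in>{..<length ws}. l (s (c i) (ws ! i))) \<le> l (\<Sum>i<length ws. s (c i) (ws ! i))"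
      by (intro SUP_least orth_basisD(5)[OF e])
  qed
  ultimately show "orthogonal_ordered_basis s V l ws"
    using \<open>distinct ws\<close> by (simp add: orthogonal_ordered_basis_def ordered_basis_def)
qed

lemma orthogonal_ordered_basis_map:
  assumes e: "orth_basis s V l I e" and ks: "distinct ks" "set ks = I"
  shows "orthogonal_ordered_basis s V l (map e ks)"
  unfolding orthogonal_ordered_basis_iff
proof -
  have "orth_basis s V l {..<length ks} (e \<circ> (!) ks)"
    using ks by (intro orth_basis_reindex[OF e] bij_betw_nth) auto
  then show "orth_basis s V l {..<length (map e ks)} (\<lambda>i. map e ks ! i)"
    using orth_basis_cong[of "{..<length ks}" "\<lambda>i. e (ks ! i)" "\<lambda>i. map e ks ! i"] by (auto simp: o_def)
qed

subsection \<open>Elementary transformations of orthogonal bases\<close>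

text \<open>In the old basis only the coefficient at p changes. The other terms are therefore
  bounded as before, and the old p-term is recovered by subtracting the added multiples of
  \<open>v p\<close>, each of which is dominated by the term of its own index.\<close>

lemma orth_basis_shear:
  assumes v: "orth_basis s V l I v" and p: "p \<in> I" "q p = 0"
    and q: "\<And>i. i \<in> I \<Longrightarrow> l (s (q i) (v p)) \<le> l (v i)"
  shows "orth_basis s V l I (\<lambda>i. v i + s (q i) (v p))" (is "orth_basis s V l I ?v")
  unfolding orth_basis_def
proof (intro conjI ballI allI)
  have fin: "finite I" by (rule orth_basisD(1)[OF v])
  have vV: "v i \<in> V" if "i \<in> I" for i using orth_basisD(2)[OF v that] .
  have v'V: "?v i \<in> V" if "i \<in> I" for i
    using that p by (intro subspace_add[OF subspace_V] scale_in_V vV)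
  have expand: "(\<Sum>i\<in>I. s (c i) (?v i)) =
      (\<Sum>i\<in>I. s (c i + (if i = p then \<Sum>k\<in>I. c k * q k else 0)) (v i))" for c
  proof -
    have "(\<Sum>i\<in>I. s (if i = p then \<Sum>k\<in>I. c k * q k else 0) (v i)) = s (\<Sum>k\<in>I. c k * q k) (v p)"
      using p fin by (simp add: if_distrib[of "\<lambda>c. s c _"] cong: if_cong)
    then show ?thesis
      by (simp add: scale_right_distrib scale_left_distrib sum.distrib scale_sum_left)
  qed
  have l_le: "l (s c (?v i)) \<le> l (s c (v i))" if "i \<in> I" for c i
  proof (rule l_scale_mono[OF v'V[OF that] vV[OF that]])
    show "l (?v i) \<le> l (v i)"
      using l_add[of "v i" "s (q i) (v p)"] q[OF that] vV[OF that] vV[OF p(1)] scale_in_V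
      by (metis max.absorb1)
  qed
  show orth: "l (s (c i) (?v i)) \<le> l (\<Sum>i\<in>I. s (c i) (?v i))" (is "_ \<le> ?B") if i: "i \<in> I" for c i
  proof -
    have le: "l (s (c i + (if i = p then \<Sum>k\<in>I. c k * q k else 0)) (v i)) \<le> ?B" if "i \<in> I" for i
      unfolding expand by (rule orth_basisD(5)[OF v that])
    have ne: "l (s (c i) (v i)) \<le> ?B" if "i \<in> I" "i \<noteq> p" for i
      using le[OF that(1)] that(2) by simp
    have "l (s (c p) (v p)) \<le> ?B"
    proof -
      have "s (c p) (v p) = s (c p + (\<Sum>k\<in>I. c k * q k)) (v p) - (\<Sum>k\<in>I. s (c k) (s (q k) (v p)))"
        by (simp add: scale_left_distrib scale_sum_left)
      also have "l \<dots> \<le> max (l (s (c p + (\<Sum>k\<in>I. c k * q k)) (v p))) (l (\<Sum>k\<in>I. s (c k) (s (q k) (v p))))"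
        by (intro l_diff scale_in_V vV p sum_in_V)
      also have "\<dots> \<le> ?B"
      proof (rule max.boundedI)
        show "l (s (c p + (\<Sum>k\<in>I. c k * q k)) (v p)) \<le> ?B" using le[OF p(1)] by simp
        show "l (\<Sum>k\<in>I. s (c k) (s (q k) (v p))) \<le> ?B"
        proof (rule l_sum_le)
          show "s (c k) (s (q k) (v p)) \<in> V" for k by (intro scale_in_V vV p)
          fix k assume k: "k \<in> I"
          show "l (s (c k) (s (q k) (v p))) \<le> ?B"
          proof (cases "k = p")
            case False
            then show ?thesis
              using l_scale_mono[OF _ vV[OF k] q[OF k], of "c k"] ne[OF k] scale_in_V vV[OF p(1)]
              by (meson order_trans)
          qed (simp add: p)
        qed
      qed
      finally show ?thesis .
    qed
    then have "l (s (c i) (v i)) \<le> ?B" using ne[OF i] by (cases "i = p") auto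
    then show ?thesis using l_le[OF i] order_trans by blast
  qed
  show "finite I" by (rule fin)
  show "?v i \<in> V" if "i \<in> I" for i by (rule v'V[OF that])
  show "?v i \<noteq> 0" if i: "i \<in> I" for i
  proof (cases "i = p")
    case False
    have "?v i = (\<Sum>k\<in>I. s ((if k = i then 1 else 0) + (if k = p then q i else 0)) (v k))"
      using fin i p by (simp add: scale_left_distrib sum.distrib if_distrib[of "\<lambda>c. s c _"] cong: if_cong)
    then have "l (v i) \<le> l (?v i)"
      using orth_basisD(5)[OF v i, of "\<lambda>k. (if k = i then 1 else 0) + (if k = p then q i else 0)"] False
      by simp
    moreover have "l (v i) \<noteq> -\<infinity>"
      using orth_basisD(3)[OF v i] l_eq_MInf_iff[OF vV[OF i]] by simp
    ultimately have "l (?v i) \<noteq> - \<infinity>" by auto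
    then show ?thesis by auto
  qed (use p orth_basisD(3)[OF v p(1)] in simp)
  show "\<exists>c. x = (\<Sum>i\<in>I. s (c i) (?v i))" if "x \<in> V" for x
  proof -
    obtain d where d: "x = (\<Sum>i\<in>I. s (d i) (v i))" using orth_basisD(4)[OF v \<open>x \<in> V\<close>] by blast
    define c where "c i = d i - (if i = p then \<Sum>k\<in>I. d k * q k else 0)" for i
    have "(\<Sum>k\<in>I. c k * q k) = (\<Sum>k\<in>I. d k * q k)"
      using p by (intro sum.cong) (auto simp: c_def)
    then have "x = (\<Sum>i\<in>I. s (c i) (?v i))"
      unfolding expand d by (intro sum.cong) (auto simp: c_def)
    then show ?thesis by blast
  qed
qed

text \<open>The p-term dominates u, so u has the level of that term and can stand in for
  \<open>w p\<close>. The old terms are recovered by subtracting multiples of \<open>w i\<close>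
  that the p-term dominates.\<close>

lemma orth_basis_exchange:
  assumes w: "orth_basis s V l I w" and p: "p \<in> I" "b p \<noteq> 0"
    and b: "\<And>i. i \<in> I \<Longrightarrow> l (s (b i) (w i)) \<le> l (s (b p) (w p))"
    and u: "u = (\<Sum>i\<in>I. s (b i) (w i))"
  shows "orth_basis s V l I (w(p := u))" (is "orth_basis s V l I ?w")
  unfolding orth_basis_def
proof (intro conjI ballI allI)
  have fin: "finite I" by (rule orth_basisD(1)[OF w])
  have wV: "w i \<in> V" if "i \<in> I" for i using orth_basisD(2)[OF w that] .
  have uV: "u \<in> V" unfolding u by (intro sum_in_V wV)
  have expand: "(\<Sum>i\<in>I. s (c i) (?w i)) =
      (\<Sum>i\<in>I. s ((if i = p then 0 else c i) + c p * b i) (w i))" for c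
  proof -
    have "(\<Sum>i\<in>I. s (c i) (?w i)) = s (c p) u + (\<Sum>i\<in>I - {p}. s (c i) (?w i))"
      using sum.remove[OF fin p(1), of "\<lambda>i. s (c i) (?w i)"] by simp
    also have "(\<Sum>i\<in>I - {p}. s (c i) (?w i)) = (\<Sum>i\<in>I. s (if i = p then 0 else c i) (w i))"
      using fin p by (intro sum.mono_neutral_cong_left) auto
    also have "s (c p) u = (\<Sum>i\<in>I. s (c p * b i) (w i))"
      by (simp add: u scale_sum_right)
    finally show ?thesis by (simp add: scale_left_distrib sum.distrib)
  qed
  have lu: "l u \<le> l (s (b p) (w p))"
    unfolding u by (intro l_sum_le scale_in_V wV b)
  show orth: "l (s (c i) (?w i)) \<le> l (\<Sum>i\<in>I. s (c i) (?w i))" (is "_ \<le> ?B") if i: "i \<in> I" for c i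
  proof -
    have le: "l (s ((if i = p then 0 else c i) + c p * b i) (w i)) \<le> ?B" if "i \<in> I" for i
      unfolding expand by (rule orth_basisD(5)[OF w that])
    have P: "l (s (c p) (s (b p) (w p))) \<le> ?B" using le[OF p(1)] by simp
    show ?thesis
    proof (cases "i = p")
      case True
      have "l (s (c p) u) \<le> l (s (c p) (s (b p) (w p)))"
        by (intro l_scale_mono uV lu scale_in_V wV p)
      then show ?thesis using True P by simp
    next
      case False
      have "s (c i) (w i) = s (c i + c p * b i) (w i) - s (c p) (s (b i) (w i))"
        by (simp add: scale_left_distrib)
      also have "l \<dots> \<le> max (l (s (c i + c p * b i) (w i))) (l (s (c p) (s (b i) (w i))))"
        by (intro l_diff scale_in_V wV i)
      also have "\<dots> \<le> ?B"
      proof (rule max.boundedI)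
        show "l (s (c i + c p * b i) (w i)) \<le> ?B" using le[OF i] False by simp
        have "l (s (c p) (s (b i) (w i))) \<le> l (s (c p) (s (b p) (w p)))"
          by (intro l_scale_mono scale_in_V wV i p b)
        then show "l (s (c p) (s (b i) (w i))) \<le> ?B" using P by (rule order_trans)
      qed
      finally show ?thesis using False by simp
    qed
  qed
  show "finite I" by (rule fin)
  show "?w i \<in> V" if "i \<in> I" for i using wV[OF that] uV by simp
  show "?w i \<noteq> 0" if i: "i \<in> I" for i
  proof (cases "i = p")
    case True
    have "l (s (b p) (w p)) \<le> l u" unfolding u by (rule orth_basisD(5)[OF w p(1)])
    moreover have "l (s (b p) (w p)) \<noteq> -\<infinity>"
      using p orth_basisD(3)[OF w p(1)] l_eq_MInf_iff[OF scale_in_V[OF wV[OF p(1)]]] by simp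
    ultimately have "l u \<noteq> - \<infinity>" by auto
    then show ?thesis using True by auto
  qed (use i orth_basisD(3)[OF w i] in simp)
  show "\<exists>c. x = (\<Sum>i\<in>I. s (c i) (?w i))" if "x \<in> V" for x
  proof -
    obtain d where d: "x = (\<Sum>i\<in>I. s (d i) (w i))" using orth_basisD(4)[OF w \<open>x \<in> V\<close>] by blast
    define c where "c i = (if i = p then d p / b p else d i - d p / b p * b i)" for i
    have "x = (\<Sum>i\<in>I. s (c i) (?w i))"
      unfolding expand d using p by (intro sum.cong) (auto simp: c_def)
    then show ?thesis by blast
  qed
qed

end

section \<open>Singular value decompositions\<close>

text \<open>Gaussian elimination with full pivoting. The rows in I0 are finished: each is sent to
  the target vector that \<pi> assigns to it, and the images of the remaining rows involve only the
  remaining target vectors. A step treats one pivot (p, q), using a shear in the source and an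
  exchange in the target.\<close>

lemma diagonalization_step:
  fixes w :: "'j \<Rightarrow> 'd::ab_group_add" and v :: "'i \<Rightarrow> 'c::ab_group_add"
  assumes V: "na_normed s V lV" and W: "na_normed t W lW" and A: "Vector_Spaces.linear s t A"
    and "orth_basis s V lV I v" "orth_basis t W lW J w" "I0 \<subseteq> I" "inj_on \<pi> I0" "\<pi> ` I0 \<subseteq> J"
    and "\<And>i. i \<in> I0 \<Longrightarrow> A (v i) = w (\<pi> i)"
    and "\<And>i. i \<in> I - I0 \<Longrightarrow> \<exists>a. A (v i) = (\<Sum>j\<in>J - \<pi> ` I0. t (a j) (w j))"
  shows "\<exists>v w I0 \<pi>. orth_basis s V lV I v \<and> orth_basis t W lW J w \<and> I0 \<subseteq> I \<and> inj_on \<pi> I0 \<and>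
    \<pi> ` I0 \<subseteq> J \<and> (\<forall>i\<in>I0. A (v i) = w (\<pi> i)) \<and> (\<forall>i\<in>I - I0. A (v i) = 0)"
  using assms(4-)
proof (induction "card (I - I0)" arbitrary: v w I0 \<pi> rule: less_induct)
  case less
  interpret V: na_normed s V lV by (rule V)
  interpret W: na_normed t W lW by (rule W)
  interpret A: Vector_Spaces.linear s t A by (rule A)
  note v = less.prems(1) and w = less.prems(2) and I0 = less.prems(3)
    and inj = less.prems(4) and im = less.prems(5)
  have finI: "finite I" and finJ: "finite J" using v w by (auto dest: orth_basisD)
  note vV = orth_basisD(2)[OF v] and wW = orth_basisD(2)[OF w]
  show ?case
  proof (cases "\<forall>i\<in>I - I0. A (v i) = 0")
    case True
    then show ?thesis using less.prems by blast
  next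
    case False
    define T where "T = J - \<pi> ` I0"
    have T: "finite T" "T \<subseteq> J" using finJ by (auto simp: T_def)
    have "\<forall>i\<in>I - I0. \<exists>a. A (v i) = (\<Sum>j\<in>T. t (a j) (w j))"
      using less.prems(7) unfolding T_def by (rule ballI)
    from bchoice[OF this] obtain a where "\<forall>i\<in>I - I0. A (v i) = (\<Sum>j\<in>T. t (a i j) (w j))" ..
    note a = bspec[OF this]
    \<comment> \<open>The level of entry (i, j) relative to its source vector. Maximality over j
      makes the q-term dominant in \<open>A (v p)\<close>, as the exchange requires; maximality over
      i makes the multiples of \<open>v p\<close> small enough for the shear.\<close>
    define F where "F = (\<lambda>(i, j). lW (t (a i j) (w j)) - lV (v i))"
    obtain i1 where i1: "i1 \<in> I - I0" "A (v i1) \<noteq> 0" using False by blast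
    have "\<exists>j\<in>T. a i1 j \<noteq> 0"
    proof (rule ccontr)
      assume "\<not> ?thesis"
      then have "A (v i1) = 0" unfolding a[OF i1(1)] by (intro sum.neutral) simp
      then show False using i1(2) by simp
    qed
    then obtain j1 where j1: "j1 \<in> T" "a i1 j1 \<noteq> 0" by blast
    define S where "S = (I - I0) \<times> T"
    have S: "finite S" "S \<noteq> {}" using finI T i1 j1 by (auto simp: S_def)
    have "Max (F ` S) \<in> F ` S" using S by (intro Max_in) auto
    then obtain p q where pq: "(p, q) \<in> S" "F (p, q) = Max (F ` S)" by auto
    have max: "F (i, j) \<le> F (p, q)" if "i \<in> I - I0" "j \<in> T" for i j
      using S that unfolding pq(2) by (intro Max_ge) (auto simp: S_def)
    have p: "p \<in> I" "p \<notin> I0" and q: "q \<in> T" "q \<in> J" "q \<notin> \<pi> ` I0"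
      using pq(1) by (auto simp: S_def T_def)
    have lv: "\<exists>r. lV (v i) = ereal r" if "i \<in> I" for i
      using V.l_finite vV orth_basisD(3)[OF v] that by blast
    have lw: "\<exists>r. lW (w j) = ereal r" if "j \<in> J" for j
      using W.l_finite wW orth_basisD(3)[OF w] that by blast
    have law: "lW (t (a i j) (w j)) = lW (w j) - valuation (a i j)" if "j \<in> J" for i j
      by (rule W.l_scale[OF wW[OF that]])
    \<comment> \<open>A zero pivot would make the maximum of F equal to -\<infinity>, but F is
      finite at (i1, j1).\<close>
    have apq: "a p q \<noteq> 0"
    proof
      assume 0: "a p q = 0"
      obtain r r' g where "lV (v i1) = ereal r" "lW (w j1) = ereal r'" "valuation (a i1 j1) = ereal g"
        using lv[of i1] lw[of j1] i1 j1 T valuation_attained by (metis DiffD1 subsetD)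
      moreover obtain r'' where "lV (v p) = ereal r''" using lv p by blast
      ultimately show False using max[OF i1(1) j1(1)] 0 law[of j1] j1 T by (auto simp: F_def)
    qed
    obtain rp rq gpq where r: "lV (v p) = ereal rp" "lW (w q) = ereal rq" "valuation (a p q) = ereal gpq"
      using lv[OF p(1)] lw[OF q(2)] valuation_attained[OF apq] by metis
    \<comment> \<open>These multiples of row p clear column q from the remaining rows.\<close>
    define c where "c i = (if i \<in> I - I0 - {p} then - (a i q / a p q) else 0)" for i
    define v' where "v' i = v i + s (c i) (v p)" for i
    have v': "orth_basis s V lV I v'"
      unfolding v'_def
    proof (rule V.orth_basis_shear[OF v p(1)])
      show "c p = 0" by (simp add: c_def)
      fix i assume i: "i \<in> I"
      show "lV (s (c i) (v p)) \<le> lV (v i)"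
      proof (cases "i \<in> I - I0 - {p} \<and> a i q \<noteq> 0")
        case True
        obtain ri g where ri: "lV (v i) = ereal ri" "valuation (a i q) = ereal g"
          using lv[OF i] valuation_attained[of "a i q"] True by metis
        \<comment> \<open>Scaling both sides by the pivot removes the quotient in c, so that only
          valuations of entries have to be compared.\<close>
        have "lV (s (a p q) (s (c i) (v p))) = lV (s (- a i q) (v p))"
          using True apq by (simp add: c_def)
        also have "\<dots> = ereal (rp - g)"
          by (subst V.l_scale[OF vV[OF p(1)]]) (simp add: r ri)
        also have "\<dots> \<le> ereal (ri - gpq)"
          using max[of i q] True q r ri law[of q] by (simp add: F_def)
        also have "\<dots> = lV (s (a p q) (v i))"
          by (subst V.l_scale[OF vV[OF i]]) (simp add: r ri)
        finally show ?thesis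
          using V.l_scale_le_iff[OF V.scale_in_V[OF vV[OF p(1)]] vV[OF i] apq] by blast
      qed (auto simp: c_def)
    qed
    have Ap: "A (v p) = (\<Sum>j\<in>T. t (a p j) (w j))" using a p by blast
    define w' where "w' = w(q := A (v p))"
    have w': "orth_basis t W lW J w'"
      unfolding w'_def
    proof (rule W.orth_basis_exchange[OF w q(2), where b = "\<lambda>j. if j \<in> T then a p j else 0"])
      show "A (v p) = (\<Sum>j\<in>J. t (if j \<in> T then a p j else 0) (w j))"
        unfolding Ap by (rule W.sum_restrict_scale[OF finJ T(2)])
      fix j assume j: "j \<in> J"
      show "lW (t (if j \<in> T then a p j else 0) (w j)) \<le> lW (t (if q \<in> T then a p q else 0) (w q))"
      proof (cases "j \<in> T")
        case True
        have "lW (t (a p j) (w j)) - ereal rp \<le> lW (t (a p q) (w q)) - ereal rp"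
          using max[of p j] p True r by (simp add: F_def)
        then show ?thesis using True q(1)
          by (cases "lW (t (a p j) (w j))"; cases "lW (t (a p q) (w q))") auto
      qed auto
    qed (use q apq in simp)
    have "\<exists>v w I0 \<pi>. orth_basis s V lV I v \<and> orth_basis t W lW J w \<and> I0 \<subseteq> I \<and> inj_on \<pi> I0 \<and>
      \<pi> ` I0 \<subseteq> J \<and> (\<forall>i\<in>I0. A (v i) = w (\<pi> i)) \<and> (\<forall>i\<in>I - I0. A (v i) = 0)"
    proof (rule less.hyps[of "insert p I0" v' w' "\<pi>(p := q)"])
      show "card (I - insert p I0) < card (I - I0)"
        using finI p by (intro psubset_card_mono) auto
      show "inj_on (\<pi>(p := q)) (insert p I0)" using inj p q by (auto simp: inj_on_def)
      show "(\<pi>(p := q)) ` insert p I0 \<subseteq> J" using im q by auto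
      show "A (v' i) = w' ((\<pi>(p := q)) i)" if "i \<in> insert p I0" for i
        using that less.prems(6)[of i] p q by (auto simp: v'_def w'_def c_def)
      fix i assume i: "i \<in> I - insert p I0"
      have ci: "c i = - (a i q / a p q)" using i by (simp add: c_def)
      have "A (v' i) = (\<Sum>j\<in>T. t (a i j + c i * a p j) (w j))"
        using i a[of i] by (simp add: v'_def A.add A.scale Ap W.scale_sum_right W.scale_left_distrib sum.distrib)
      \<comment> \<open>The coefficient at q vanishes by the choice of c, and away from q the old
        and the new target vectors agree.\<close>
      also have "\<dots> = (\<Sum>j\<in>T - {q}. t (a i j + c i * a p j) (w' j))"
        using T q apq ci by (intro sum.mono_neutral_cong_right) (auto simp: w'_def)
      also have "T - {q} = J - (\<pi>(p := q)) ` insert p I0"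
        using p by (auto simp: T_def)
      finally show "\<exists>a. A (v' i) = (\<Sum>j\<in>J - (\<pi>(p := q)) ` insert p I0. t (a j) (w' j))"
        by (rule exI[of _ "\<lambda>j. a i j + c i * a p j"])
    qed (use v' w' p I0 in auto)
    then show ?thesis .
  qed
qed

lemma orth_diagonalization:
  assumes V: "na_normed s V lV" and W: "na_normed t W lW" and A: "Vector_Spaces.linear s t A" "A ` V \<subseteq> W"
    and v: "orth_basis s V lV I v0" and w: "orth_basis t W lW J w0"
  obtains v w I0 \<pi> where "orth_basis s V lV I v" "orth_basis t W lW J w" "I0 \<subseteq> I" "inj_on \<pi> I0"
    "\<pi> ` I0 \<subseteq> J" "\<And>i. i \<in> I0 \<Longrightarrow> A (v i) = w (\<pi> i)" "\<And>i. i \<in> I - I0 \<Longrightarrow> A (v i) = 0"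
proof -
  have "\<exists>v w I0 \<pi>. orth_basis s V lV I v \<and> orth_basis t W lW J w \<and> I0 \<subseteq> I \<and> inj_on \<pi> I0 \<and>
    \<pi> ` I0 \<subseteq> J \<and> (\<forall>i\<in>I0. A (v i) = w (\<pi> i)) \<and> (\<forall>i\<in>I - I0. A (v i) = 0)"
  proof (rule diagonalization_step[OF V W A(1) v w, of "{}" undefined])
    show "\<exists>a. A (v0 i) = (\<Sum>j\<in>J - undefined ` {}. t (a j) (w0 j))" if "i \<in> I - {}" for i
    proof -
      have "A (v0 i) \<in> W" using orth_basisD(2)[OF v, of i] that A(2) by auto
      then show ?thesis using orth_basisD(4)[OF w] by simp
    qed
  qed auto
  then show ?thesis by (elim exE conjE, intro that) (assumption | erule (1) bspec)+
qed

lemma (in na_normed) map_rank_eqI: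
  assumes "orthogonal_ordered_basis s (A ` U) l ws"
  shows "map_rank s U A = length ws"
proof -
  have ws: "distinct ws" "independent (set ws)" "span (set ws) = A ` U"
    using assms by (auto simp: orthogonal_ordered_basis_def ordered_basis_def)
  have "dim (A ` U) = card (set ws)"
    using dim_span_eq_card_independent[OF ws(2)] ws(3) by simp
  then show ?thesis using distinct_card[OF ws(1)] by (simp add: map_rank_def)
qed

lemma kernel_subspace:
  assumes "na_normed s V l" "Vector_Spaces.linear s t A"
  shows "na_normed s {x \<in> V. A x = 0} l"
proof -
  interpret V: na_normed s V l by (rule assms)
  interpret A: Vector_Spaces.linear s t A by (rule assms)
  have "{x \<in> V. A x = 0} = V \<inter> {x. A x = 0}" by auto
  then have "V.subspace {x \<in> V. A x = 0}"
    using V.subspace_inter[OF V.subspace_V A.subspace_kernel] by simp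
  then show ?thesis by (intro V.na_normed_subspace) auto
qed

lemma svd_exists:
  assumes V: "na_normed s V lV" and W: "na_normed t W lW" and A: "Vector_Spaces.linear s t A" "A ` V \<subseteq> W"
    and v0: "orth_basis s V lV I v0" and w0: "orth_basis t W lW J w0"
  shows "\<exists>ys xs. is_svd s V lV t W lW A ys xs"
proof -
  interpret V: na_normed s V lV by (rule V)
  interpret W: na_normed t W lW by (rule W)
  interpret A: Vector_Spaces.linear s t A by (rule A)
  obtain v w I0 \<pi> where v: "orth_basis s V lV I v" and w: "orth_basis t W lW J w" and I0: "I0 \<subseteq> I"
    and inj: "inj_on \<pi> I0" and im: "\<pi> ` I0 \<subseteq> J"
    and A1: "\<And>i. i \<in> I0 \<Longrightarrow> A (v i) = w (\<pi> i)" and A0: "\<And>i. i \<in> I - I0 \<Longrightarrow> A (v i) = 0"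
    by (rule orth_diagonalization[OF V W A v0 w0]) (rule that; assumption)
  have finI: "finite I" and finJ: "finite J" using v w by (auto dest: orth_basisD)
  have fin0: "finite I0" using finI I0 finite_subset by blast
  \<comment> \<open>Negated, since \<open>sort_key\<close> sorts upwards and the bar lengths have to
    be nonincreasing.\<close>
  define key where "key i = - (lV (v i) - lW (w (\<pi> i)))" for i
  obtain is0 where is0: "set is0 = I0" "distinct is0" "sorted (map key is0)"
  proof -
    obtain ks where "set ks = I0" "distinct ks" using finite_distinct_list[OF fin0] by blast
    then show ?thesis using that[of "sort_key key ks"] by simp
  qed
  obtain is1 where is1: "set is1 = I - I0" "distinct is1"
    using finite_distinct_list[of "I - I0"] finI by blast
  obtain js1 where js1: "set js1 = J - \<pi> ` I0" "distinct js1"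
    using finite_distinct_list[of "J - \<pi> ` I0"] finJ by blast
  define ys where "ys = map v (is0 @ is1)"
  define xs where "xs = map w (map \<pi> is0 @ js1)"
  define r where "r = length is0"
  have ys: "orthogonal_ordered_basis s V lV ys"
    unfolding ys_def using is0 is1 I0 by (intro V.orthogonal_ordered_basis_map[OF v]) auto
  have xs: "orthogonal_ordered_basis t W lW xs"
    unfolding xs_def using is0 js1 im inj
    by (intro W.orthogonal_ordered_basis_map[OF w]) (auto simp: distinct_map)
  have AV: "A x = (\<Sum>i\<in>I0. t (c i) (w (\<pi> i)))" if x: "x = (\<Sum>i\<in>I. s (c i) (v i))" for x c
  proof -
    have "A x = (\<Sum>i\<in>I. t (c i) (A (v i)))" unfolding x by (simp add: A.sum A.scale)
    also have "\<dots> = (\<Sum>i\<in>I0. t (c i) (w (\<pi> i)))"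
      using finI I0 A0 A1 by (intro sum.mono_neutral_cong_right) auto
    finally show ?thesis .
  qed
  have reindex: "(\<Sum>i\<in>I0. t (c i) (w (\<pi> i))) = (\<Sum>j\<in>\<pi> ` I0. t (c (the_inv_into I0 \<pi> j)) (w j))" for c
    by (simp add: sum.reindex[OF inj] the_inv_into_f_f[OF inj])
  have ker: "orth_basis s {x \<in> V. A x = 0} lV (I - I0) v"
  proof (rule V.orth_basis_subset[OF v])
    show "v k \<in> {x \<in> V. A x = 0}" if "k \<in> I - I0" for k
      using that A0 orth_basisD(2)[OF v] by auto
    fix x assume x: "x \<in> {x \<in> V. A x = 0}"
    then obtain c where c: "x = (\<Sum>i\<in>I. s (c i) (v i))" using orth_basisD(4)[OF v] by blast
    have "0 = (\<Sum>j\<in>J. t (if j \<in> \<pi> ` I0 then c (the_inv_into I0 \<pi> j) else 0) (w j))"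
      using x AV[OF c] W.sum_restrict_scale[OF finJ im] reindex by auto
    then have z: "(\<Sum>j\<in>J. t (if j \<in> \<pi> ` I0 then c (the_inv_into I0 \<pi> j) else 0) (w j)) = (\<Sum>j\<in>J. t 0 (w j))"
      by simp
    have "c i = 0" if "i \<in> I0" for i
      using W.orth_basis_unique[OF w z, of "\<pi> i"] that im the_inv_into_f_f[OF inj that] by auto
    then have "x = (\<Sum>i\<in>I - I0. s (c i) (v i))"
      unfolding c using finI I0 by (intro sum.mono_neutral_right) auto
    then show "\<exists>c. x = (\<Sum>i\<in>I - I0. s (c i) (v i))" by blast
  qed auto
  have img: "orth_basis t (A ` V) lW (\<pi> ` I0) w"
  proof (rule W.orth_basis_subset[OF w im])
    show "w k \<in> A ` V" if "k \<in> \<pi> ` I0" for k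
      using that A1 I0 orth_basisD(2)[OF v] by (metis (no_types, opaque_lifting) image_iff subsetD)
    fix x assume "x \<in> A ` V"
    then obtain y c where y: "x = A y" "y = (\<Sum>i\<in>I. s (c i) (v i))" using orth_basisD(4)[OF v] by blast
    show "\<exists>c. x = (\<Sum>i\<in>\<pi> ` I0. t (c i) (w i))" using AV[OF y(2)] y(1) reindex by metis
  qed
  interpret K: na_normed s "{x \<in> V. A x = 0}" lV by (rule kernel_subspace[OF V A(1)])
  interpret M: na_normed t "A ` V" lW
    by (rule W.na_normed_subspace[OF A.subspace_image[OF V.subspace_V] A(2)])
  have drop: "orthogonal_ordered_basis s {x \<in> V. A x = 0} lV (drop r ys)"
    unfolding ys_def r_def using K.orthogonal_ordered_basis_map[OF ker is1(2,1)] by simp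
  have take: "orthogonal_ordered_basis t (A ` V) lW (take r xs)"
    unfolding xs_def r_def using M.orthogonal_ordered_basis_map[OF img, of "map \<pi> is0"] is0 inj
    by (simp add: distinct_map)
  have rank: "map_rank t V A = r"
    using W.map_rank_eqI[OF take] by (simp add: xs_def r_def)
  have nth: "ys ! i = v (is0 ! i)" "xs ! i = w (\<pi> (is0 ! i))" if "i < r" for i
    using that by (simp_all add: ys_def xs_def r_def nth_append)
  have "is_svd s V lV t W lW A ys xs"
    unfolding is_svd_def Let_def rank
  proof (intro conjI allI impI)
    show "A (ys ! i) = xs ! i" if "i < r" for i
    proof -
      have "is0 ! i \<in> I0" using that is0(1) nth_mem r_def by blast
      then show ?thesis using that by (simp add: nth A1)
    qed
    show "lV (ys ! j) - lW (xs ! j) \<le> lV (ys ! i) - lW (xs ! i)" if "i \<le> j" "j < r" for i j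
    proof -
      have "key (is0 ! i) \<le> key (is0 ! j)"
        using sorted_nth_mono[OF is0(3), of i j] that by (simp add: r_def)
      then show ?thesis using that by (simp add: nth key_def)
    qed
  qed (fact ys xs drop take)+
  then show ?thesis by blast
qed

lemma is_svdD:
  assumes V: "na_normed s V lV" and W: "na_normed t W lW" and A: "Vector_Spaces.linear s t A" "A ` V \<subseteq> W"
    and svd: "is_svd s V lV t W lW A ys xs"
  defines "r \<equiv> map_rank t V A"
  shows "orth_basis s V lV {..<length ys} (\<lambda>i. ys ! i)"
    and "orth_basis t W lW {..<length xs} (\<lambda>i. xs ! i)"
    and "r \<le> length ys" "r \<le> length xs"
    and "\<And>i. i < r \<Longrightarrow> A (ys ! i) = xs ! i"
    and "\<And>i. r \<le> i \<Longrightarrow> i < length ys \<Longrightarrow> A (ys ! i) = 0"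
proof -
  interpret V: na_normed s V lV by (rule V)
  interpret W: na_normed t W lW by (rule W)
  interpret A: Vector_Spaces.linear s t A by (rule A)
  have d: "orthogonal_ordered_basis s V lV ys" "orthogonal_ordered_basis t W lW xs"
    "orthogonal_ordered_basis s {x \<in> V. A x = 0} lV (drop r ys)"
    "orthogonal_ordered_basis t (A ` V) lW (take r xs)"
    and Ai: "\<And>i. i < r \<Longrightarrow> A (ys ! i) = xs ! i"
    using svd unfolding is_svd_def r_def Let_def by blast+
  show ys: "orth_basis s V lV {..<length ys} (\<lambda>i. ys ! i)"
    using d(1) V.orthogonal_ordered_basis_iff by simp
  show "orth_basis t W lW {..<length xs} (\<lambda>i. xs ! i)"
    using d(2) W.orthogonal_ordered_basis_iff by simp
  show "r \<le> length xs"
    using W.map_rank_eqI[OF d(4)] by (simp add: r_def)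
  have "A ` V \<subseteq> W.span (A ` set ys)"
    using d(1) A.span_image[of "set ys"] by (simp add: orthogonal_ordered_basis_def ordered_basis_def)
  then have "W.dim (A ` V) \<le> card (A ` set ys)" by (rule W.dim_le_card) auto
  also have "\<dots> \<le> card (set ys)" by (rule card_image_le) auto
  also have "\<dots> \<le> length ys" by (rule card_length)
  finally show "r \<le> length ys" by (simp add: r_def map_rank_def)
  show "A (ys ! i) = xs ! i" if "i < r" for i by (rule Ai[OF that])
  interpret K: na_normed s "{x \<in> V. A x = 0}" lV by (rule kernel_subspace[OF V A(1)])
  show "A (ys ! i) = 0" if "r \<le> i" "i < length ys" for i
  proof -
    have "orth_basis s {x \<in> V. A x = 0} lV {..<length (drop r ys)} (\<lambda>i. drop r ys ! i)"
      using d(3) K.orthogonal_ordered_basis_iff by simp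
    from orth_basisD(2)[OF this, of "i - r"] have "drop r ys ! (i - r) \<in> {x \<in> V. A x = 0}"
      using that by simp
    then show ?thesis using that by simp
  qed
qed

section \<open>The chosen singular value decompositions of a Floer-type complex\<close>

text \<open>The same choice term as in \<open>verbose_barcode\<close>, so that the barcode can be
  read off from this decomposition by unfolding.\<close>

definition svd_pair :: "('k::field, 'g::real_subgroup, 'c::ab_group_add) floer \<Rightarrow> int \<Rightarrow> 'c list \<times> 'c list" where
  "svd_pair C k = (SOME (ys, xs).
     is_svd (smul C) (grade C (k + 1)) (filt C) (smul C) (cycles C k) (filt C) (bdry C) ys xs)"

definition svd_y :: "('k::field, 'g::real_subgroup, 'c::ab_group_add) floer \<Rightarrow> int \<Rightarrow> nat \<Rightarrow> 'c" where
  "svd_y C k i = fst (svd_pair C k) ! i"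

definition svd_x :: "('k::field, 'g::real_subgroup, 'c::ab_group_add) floer \<Rightarrow> int \<Rightarrow> nat \<Rightarrow> 'c" where
  "svd_x C k i = snd (svd_pair C k) ! i"

definition svd_n :: "('k::field, 'g::real_subgroup, 'c::ab_group_add) floer \<Rightarrow> int \<Rightarrow> nat" where
  "svd_n C k = length (fst (svd_pair C k))"

definition svd_m :: "('k::field, 'g::real_subgroup, 'c::ab_group_add) floer \<Rightarrow> int \<Rightarrow> nat" where
  "svd_m C k = length (snd (svd_pair C k))"

definition svd_r :: "('k::field, 'g::real_subgroup, 'c::ab_group_add) floer \<Rightarrow> int \<Rightarrow> nat" where
  "svd_r C k = map_rank (smul C) (grade C (k + 1)) (bdry C)"

definition birth :: "('k::field, 'g::real_subgroup, 'c::ab_group_add) floer \<Rightarrow> int \<Rightarrow> nat \<Rightarrow> real" where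
  "birth C k i = real_of_ereal (filt C (svd_x C k i))"

text \<open>Only meaningful for the finite bars, those with index below \<^const>\<open>svd_r\<close>.\<close>

definition death :: "('k::field, 'g::real_subgroup, 'c::ab_group_add) floer \<Rightarrow> int \<Rightarrow> nat \<Rightarrow> real" where
  "death C k i = real_of_ereal (filt C (svd_y C k i))"

definition bar_length :: "('k::field, 'g::real_subgroup, 'c::ab_group_add) floer \<Rightarrow> int \<Rightarrow> nat \<Rightarrow> ereal" where
  "bar_length C k i = (if i < svd_r C k then ereal (death C k i - birth C k i) else \<infinity>)"

definition bar_at :: "('k::field, 'g::real_subgroup, 'c::ab_group_add) floer \<Rightarrow> int \<Rightarrow> nat \<Rightarrow> bar" where
  "bar_at C k i = (coset_mod TYPE('g) (birth C k i), bar_length C k i)"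

text \<open>The index set of the concise barcode. Bijections are built on indices, because equal
  bars have to be told apart.\<close>

definition pos_bars :: "('k::field, 'g::real_subgroup, 'c::ab_group_add) floer \<Rightarrow> int \<Rightarrow> nat set" where
  "pos_bars C k = {i. i < svd_m C k \<and> bar_length C k i > 0}"

text \<open>A component in U is expanded back in the old basis, where orthogonality separates it
  from the indices outside K; within U the orthogonality of the new basis takes over. This splices
  the bases of two singular value decompositions.\<close>

lemma (in na_normed) orth_basis_replace:
  fixes v :: "'i \<Rightarrow> 'c" and w :: "'j \<Rightarrow> 'c"
  assumes v: "orth_basis s V l I v" and K: "K \<subseteq> I" and U: "U \<subseteq> V"
    and span: "\<And>x. x \<in> U \<Longrightarrow> \<exists>c. x = (\<Sum>i\<in>K. s (c i) (v i))"
    and vU: "\<And>i. i \<in> K \<Longrightarrow> v i \<in> U" and subU: "subspace U"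
    and w: "orth_basis s U l J w"
  shows "orth_basis s V l ((I - K) <+> J) (case_sum v w)"
proof -
  have fin: "finite I" "finite J" using v w by (auto dest: orth_basisD)
  have sum: "(\<Sum>i\<in>(I - K) <+> J. s (c i) (case_sum v w i)) =
      (\<Sum>i\<in>I - K. s (c (Inl i)) (v i)) + (\<Sum>j\<in>J. s (c (Inr j)) (w j))" for c
    using fin by (simp add: sum.Plus)
  have split: "(\<Sum>i\<in>I. s (if i \<in> K then d i else c i) (v i)) =
      (\<Sum>i\<in>I - K. s (c i) (v i)) + (\<Sum>i\<in>K. s (d i) (v i))" for c d
  proof -
    have "(\<Sum>i\<in>I. s (if i \<in> K then d i else c i) (v i)) =
        (\<Sum>i\<in>I - K. s (if i \<in> K then d i else c i) (v i)) + (\<Sum>i\<in>K. s (if i \<in> K then d i else c i) (v i))"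
      by (rule sum.subset_diff[OF K fin(1)])
    then show ?thesis by simp
  qed
  have vV: "v i \<in> V" if "i \<in> I" for i by (rule orth_basisD(2)[OF v that])
  have wU: "w j \<in> U" if "j \<in> J" for j by (rule orth_basisD(2)[OF w that])
  show ?thesis
    unfolding orth_basis_def
  proof (intro conjI ballI allI)
    show "finite ((I - K) <+> J)" using fin by simp
    show "case_sum v w i \<in> V" if "i \<in> (I - K) <+> J" for i using that vV wU U by auto
    show "case_sum v w i \<noteq> 0" if "i \<in> (I - K) <+> J" for i
      using that orth_basisD(3)[OF v] orth_basisD(3)[OF w] by auto
    show "\<exists>c. x = (\<Sum>i\<in>(I - K) <+> J. s (c i) (case_sum v w i))" if xV: "x \<in> V" for x
    proof -
      obtain c where c: "x = (\<Sum>i\<in>I. s (c i) (v i))" using orth_basisD(4)[OF v xV] by blast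
      have "(\<Sum>i\<in>K. s (c i) (v i)) \<in> U"
        by (intro subspace_sum[OF subU] subspace_scale[OF subU] vU)
      then obtain d where d: "(\<Sum>i\<in>K. s (c i) (v i)) = (\<Sum>j\<in>J. s (d j) (w j))"
        using orth_basisD(4)[OF w] by blast
      have "x = (\<Sum>i\<in>(I - K) <+> J. s (case_sum c d i) (case_sum v w i))"
        unfolding sum using split[of c c] by (simp add: c d)
      then show ?thesis by blast
    qed
    fix c :: "'i + 'j \<Rightarrow> ('k, 'g) novikov" and i assume i: "i \<in> (I - K) <+> J"
    define u where "u = (\<Sum>j\<in>J. s (c (Inr j)) (w j))"
    have "u \<in> U" unfolding u_def by (intro subspace_sum[OF subU] subspace_scale[OF subU] wU)
    then obtain d where d: "u = (\<Sum>i\<in>K. s (d i) (v i))" using span by blast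
    define e where "e k = (if k \<in> K then d k else c (Inl k))" for k
    have x: "(\<Sum>i\<in>(I - K) <+> J. s (c i) (case_sum v w i)) = (\<Sum>i\<in>I. s (e i) (v i))"
      unfolding sum e_def split by (simp add: u_def[symmetric] d)
    have le: "l (s (e i) (v i)) \<le> l (\<Sum>i\<in>I. s (e i) (v i))" if "i \<in> I" for i
      by (rule orth_basisD(5)[OF v that])
    have lu: "l u \<le> l (\<Sum>i\<in>I. s (e i) (v i))"
      unfolding d
    proof (rule l_sum_le)
      fix k assume k: "k \<in> K"
      show "s (d k) (v k) \<in> V" using k K by (intro scale_in_V vV) auto
      show "l (s (d k) (v k)) \<le> l (\<Sum>i\<in>I. s (e i) (v i))"
        using le[of k] k K by (auto simp: e_def)
    qed
    show "l (s (c i) (case_sum v w i)) \<le> l (\<Sum>i\<in>(I - K) <+> J. s (c i) (case_sum v w i))"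
    proof (cases i)
      case (Inl k)
      then show ?thesis using i le[of k] unfolding x by (auto simp: e_def)
    next
      case (Inr j)
      then have "l (s (c i) (w j)) \<le> l u"
        unfolding u_def using orth_basisD(5)[OF w, of j "\<lambda>j. c (Inr j)"] i by auto
      then show ?thesis using Inr lu unfolding x by auto
    qed
  qed
qed

section \<open>Bases and barcodes of a Floer-type complex\<close>

locale floer_cx =
  fixes C :: "('k::field, 'g::real_subgroup, 'c::ab_group_add) floer"
  assumes floer: "floer_complex C"
begin

sublocale vector_space "smul C"
  using floer by (simp add: floer_complex_def)

sublocale bdry: Vector_Spaces.linear "smul C" "smul C" "bdry C"
  using floer by (simp add: floer_complex_def)

sublocale grade: na_normed "smul C" "grade C k" "filt C" for k
  using floer by (simp add: floer_complex_def orthogonalizable_space_def na_normed_iff)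

lemma bdry_linear: "Vector_Spaces.linear (smul C) (smul C) (bdry C)"
  by (rule bdry.linear_axioms)

lemma bdry_grade: "x \<in> grade C k \<Longrightarrow> bdry C x \<in> grade C (k - 1)"
  using floer by (auto simp: floer_complex_def)

lemma bdry_bdry: "bdry C (bdry C x) = 0"
  using floer by (simp add: floer_complex_def)

lemma direct_sum: "internal_direct_sum (grade C)"
  using floer by (simp add: floer_complex_def)

lemma cycles_normed: "na_normed (smul C) (cycles C k) (filt C)"
  unfolding cycles_def by (rule kernel_subspace[OF grade.na_normed_axioms bdry_linear])

lemma grade_orth_basis: "\<exists>n e. orth_basis (smul C) (grade C k) (filt C) {..<n::nat} e"
proof -
  obtain ws where "orthogonal_ordered_basis (smul C) (grade C k) (filt C) ws"
    using floer unfolding floer_complex_def orthogonalizable_space_def by blast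
  then show ?thesis unfolding grade.orthogonal_ordered_basis_iff by blast
qed

lemma bdry_cycles: "bdry C ` grade C (k + 1) \<subseteq> cycles C k"
  using bdry_grade[of _ "k + 1"] by (auto simp: cycles_def bdry_bdry)

text \<open>The barcode uses a decomposition with target \<open>cycles C k\<close>, which needs an
  orthogonal basis of the cycles to start from. The kernel part of a decomposition of the boundary
  map into the whole of \<open>grade C (k - 1)\<close> supplies it.\<close>

lemma cycles_orth_basis: "\<exists>n e. orth_basis (smul C) (cycles C k) (filt C) {..<n::nat} e"
proof -
  obtain n e where e: "orth_basis (smul C) (grade C k) (filt C) {..<n::nat} e" using grade_orth_basis by blast
  obtain n' e' where e': "orth_basis (smul C) (grade C (k - 1)) (filt C) {..<n'::nat} e'" using grade_orth_basis by blast
  have im: "bdry C ` grade C k \<subseteq> grade C (k - 1)" using bdry_grade by auto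
  obtain ys xs where svd: "is_svd (smul C) (grade C k) (filt C) (smul C) (grade C (k - 1)) (filt C) (bdry C) ys xs"
    using svd_exists[OF grade.na_normed_axioms grade.na_normed_axioms bdry_linear im e e'] by blast
  interpret Z: na_normed "smul C" "cycles C k" "filt C" by (rule cycles_normed)
  have "orthogonal_ordered_basis (smul C) (cycles C k) (filt C) (drop (map_rank (smul C) (grade C k) (bdry C)) ys)"
    using svd unfolding is_svd_def Let_def cycles_def by blast
  then show ?thesis unfolding Z.orthogonal_ordered_basis_iff by blast
qed

lemma svd_pair: "is_svd (smul C) (grade C (k + 1)) (filt C) (smul C) (cycles C k) (filt C) (bdry C)
  (fst (svd_pair C k)) (snd (svd_pair C k))"
proof -
  obtain n e where e: "orth_basis (smul C) (grade C (k + 1)) (filt C) {..<n::nat} e" using grade_orth_basis by blast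
  obtain n' e' where e': "orth_basis (smul C) (cycles C k) (filt C) {..<n'::nat} e'" using cycles_orth_basis by blast
  obtain ys xs where "is_svd (smul C) (grade C (k + 1)) (filt C) (smul C) (cycles C k) (filt C) (bdry C) ys xs"
    using svd_exists[OF grade.na_normed_axioms cycles_normed bdry_linear bdry_cycles e e'] by blast
  then have "\<exists>p. case p of (ys, xs) \<Rightarrow>
    is_svd (smul C) (grade C (k + 1)) (filt C) (smul C) (cycles C k) (filt C) (bdry C) ys xs"
    by blast
  from someI_ex[OF this] show ?thesis unfolding svd_pair_def[symmetric] by (simp only: split_beta)
qed

lemmas svd_facts = is_svdD[OF grade.na_normed_axioms cycles_normed bdry_linear bdry_cycles svd_pair,
    folded svd_y_def svd_x_def svd_n_def svd_m_def svd_r_def]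

lemma y_basis: "orth_basis (smul C) (grade C (k + 1)) (filt C) {..<svd_n C k} (svd_y C k)"
  using svd_facts(1)[of k] by simp

lemma x_basis: "orth_basis (smul C) (cycles C k) (filt C) {..<svd_m C k} (svd_x C k)"
  using svd_facts(2)[of k] by simp

lemma r_le_n: "svd_r C k \<le> svd_n C k" and r_le_m: "svd_r C k \<le> svd_m C k"
  by (rule svd_facts)+

lemma bdry_y: "i < svd_r C k \<Longrightarrow> bdry C (svd_y C k i) = svd_x C k i"
  by (rule svd_facts)

lemma bdry_y_kernel: "svd_r C k \<le> i \<Longrightarrow> i < svd_n C k \<Longrightarrow> bdry C (svd_y C k i) = 0"
  by (rule svd_facts)

lemma x_cycle: "i < svd_m C k \<Longrightarrow> svd_x C k i \<in> cycles C k"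
  using orth_basisD(2)[OF x_basis] by simp

lemma x_grade: "i < svd_m C k \<Longrightarrow> svd_x C k i \<in> grade C k"
  and bdry_x: "i < svd_m C k \<Longrightarrow> bdry C (svd_x C k i) = 0"
  using x_cycle by (auto simp: cycles_def)

lemma y_grade: "i < svd_n C k \<Longrightarrow> svd_y C k i \<in> grade C (k + 1)"
  using orth_basisD(2)[OF y_basis] by simp

lemma filt_x: "i < svd_m C k \<Longrightarrow> filt C (svd_x C k i) = ereal (birth C k i)"
  using grade.l_finite[OF x_grade] orth_basisD(3)[OF x_basis] by (force simp: birth_def)

lemma filt_y: "i < svd_r C k \<Longrightarrow> filt C (svd_y C k i) = ereal (death C k i)"
  using grade.l_finite[OF y_grade] orth_basisD(3)[OF y_basis, of i k] r_le_n[of k]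
  by (metis death_def lessThan_iff order_less_le_trans real_of_ereal.simps(1))

lemma bdry_y_sum:
  "bdry C (\<Sum>i<svd_n C k. smul C (c i) (svd_y C k i)) =
    (\<Sum>i<svd_m C k. smul C (if i < svd_r C k then c i else 0) (svd_x C k i))"
proof -
  have "bdry C (\<Sum>i<svd_n C k. smul C (c i) (svd_y C k i)) = (\<Sum>i<svd_n C k. smul C (c i) (bdry C (svd_y C k i)))"
    by (simp add: bdry.sum bdry.scale)
  also have "\<dots> = (\<Sum>i<svd_r C k. smul C (c i) (svd_x C k i))"
    using r_le_n[of k] by (intro sum.mono_neutral_cong_right) (auto simp: bdry_y bdry_y_kernel)
  also have "\<dots> = (\<Sum>i<svd_m C k. smul C (if i < svd_r C k then c i else 0) (svd_x C k i))"
    using r_le_m[of k] by (intro sum.mono_neutral_cong_left) auto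
  finally show ?thesis .
qed

lemma x_unique:
  assumes "(\<Sum>i<svd_m C k. smul C (c i) (svd_x C k i)) = (\<Sum>i<svd_m C k. smul C (d i) (svd_x C k i))"
    and "i < svd_m C k"
  shows "c i = d i"
  using na_normed.orth_basis_unique[OF cycles_normed x_basis assms(1)] assms(2) by simp

lemma verbose_barcode_eq: "verbose_barcode C k = image_mset (bar_at C k) (mset_set {..<svd_m C k})"
proof -
  define f where "f i = (coset_mod TYPE('g) (birth C k i), filt C (svd_y C k i) - filt C (svd_x C k i))" for i
  define g where "g i = (coset_mod TYPE('g) (birth C k i), \<infinity> :: ereal)" for i
  have "verbose_barcode C k = mset (map f [0..<svd_r C k]) + mset (map g [svd_r C k..<svd_m C k])"
    unfolding verbose_barcode_def svd_pair_def[symmetric] svd_barcode_def Let_def split_beta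
      svd_r_def svd_m_def f_def g_def birth_def svd_x_def svd_y_def ..
  also have "map f [0..<svd_r C k] = map (bar_at C k) [0..<svd_r C k]"
    using r_le_m[of k] by (auto simp: f_def bar_at_def bar_length_def filt_x filt_y)
  also have "map g [svd_r C k..<svd_m C k] = map (bar_at C k) [svd_r C k..<svd_m C k]"
    by (auto simp: g_def bar_at_def bar_length_def)
  also have "mset (map (bar_at C k) [0..<svd_r C k]) + mset (map (bar_at C k) [svd_r C k..<svd_m C k]) =
      mset (map (bar_at C k) [0..<svd_m C k])"
    using upt_add_eq_append[of 0 "svd_r C k" "svd_m C k - svd_r C k"] r_le_m[of k] by simp
  also have "\<dots> = image_mset (bar_at C k) (mset_set {..<svd_m C k})"
    by (simp add: lessThan_atLeast0)
  finally show ?thesis .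
qed

lemma concise_barcode_eq: "concise_barcode C k = image_mset (bar_at C k) (mset_set (pos_bars C k))"
proof -
  have "{i \<in> {..<svd_m C k}. (\<lambda>(A, L). L > 0) (bar_at C k i)} = pos_bars C k"
    by (auto simp: pos_bars_def bar_at_def)
  then show ?thesis
    unfolding concise_barcode_def verbose_barcode_eq filter_mset_image_mset by (simp add: filter_mset_mset_set)
qed

end

section \<open>Closeness of bars, and matchings of indices\<close>

text \<open>Closeness with the shift g made explicit and without the slack \<epsilon>. The minus
  sign is that of scaling by \<open>nov_T g\<close>; two infinite bars are compared by their births
  alone.\<close>

definition index_close ::
  "real \<Rightarrow> ('k::field, 'g::real_subgroup, 'c::ab_group_add) floer \<Rightarrow>
    ('k, 'g, 'd::ab_group_add) floer \<Rightarrow> int \<Rightarrow> nat \<Rightarrow> nat \<Rightarrow> 'g \<Rightarrow> bool"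
where
  "index_close \<delta> C D k i j g \<longleftrightarrow>
     \<bar>birth D k j - incl g - birth C k i\<bar> \<le> \<delta> \<and> (i < svd_r C k \<longleftrightarrow> j < svd_r D k) \<and>
     (i < svd_r C k \<longrightarrow> \<bar>death D k j - incl g - death C k i\<bar> \<le> \<delta>)"

lemma index_close_swap: "index_close \<delta> C D k i j g \<Longrightarrow> index_close \<delta> D C k j i (- g)"
  using incl_diff[of 0 g] by (auto simp: index_close_def abs_le_iff)

lemma index_close_imp_bars_close:
  fixes C :: "('k::field, 'g::real_subgroup, 'c::ab_group_add) floer"
  assumes "index_close \<delta> C D k i j g"
  shows "bars_close \<delta> (bar_at C k i) (bar_at D k j)"
  unfolding bars_close_def bar_at_def prod.case
proof (intro ballI allI impI)
  fix a \<epsilon> :: real assume a: "a \<in> coset_mod TYPE('g) (birth C k i)" and \<epsilon>: "0 < \<epsilon>"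
  then obtain h :: 'g where h: "a = birth C k i + incl h" by (auto simp: coset_mod_def)
  \<comment> \<open>The given representative is the birth of i moved by h, so the close one is the
    shifted birth of j moved by the same h.\<close>
  define a' where "a' = birth D k j + incl (h - g)"
  have "a' \<in> coset_mod TYPE('g) (birth D k j)" by (auto simp: coset_mod_def a'_def)
  moreover have "\<bar>a' - a\<bar> \<le> \<delta> + \<epsilon>"
    using assms \<epsilon> by (auto simp: index_close_def a'_def h incl_diff)
  moreover have "bar_length C k i = \<infinity> \<and> bar_length D k j = \<infinity> \<or>
      \<bar>(ereal a' + bar_length D k j) - (ereal a + bar_length C k i)\<bar> \<le> ereal (\<delta> + \<epsilon>)"
    using assms \<epsilon> by (auto simp: index_close_def bar_length_def a'_def h incl_diff)
  ultimately show "\<exists>a'\<in>coset_mod TYPE('g) (birth D k j). \<bar>a' - a\<bar> \<le> \<delta> + \<epsilon> \<and>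
      (bar_length C k i = \<infinity> \<and> bar_length D k j = \<infinity> \<or>
       \<bar>(ereal a' + bar_length D k j) - (ereal a + bar_length C k i)\<bar> \<le> ereal (\<delta> + \<epsilon>))"
    by blast
qed

text \<open>The gap \<delta>' - \<delta> is spent as \<epsilon>. For dense \<Gamma> no single shift
  need work for all \<epsilon>, so \<delta>' cannot simply be taken equal to \<delta>.\<close>

lemma bars_close_imp_index_close:
  fixes C :: "('k::field, 'g::real_subgroup, 'c::ab_group_add) floer"
  assumes "bars_close \<delta> (bar_at C k i) (bar_at D k j)" "\<delta> < \<delta>'"
  shows "\<exists>g :: 'g. index_close \<delta>' C D k i j g"
proof -
  have a: "birth C k i \<in> coset_mod TYPE('g) (birth C k i)"
    unfolding coset_mod_def using incl_zero by (metis (mono_tags, lifting) add.right_neutral mem_Collect_eq)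
  have "0 < \<delta>' - \<delta>" using assms by simp
  with assms(1) a obtain a' where a': "a' \<in> coset_mod TYPE('g) (birth D k j)" "\<bar>a' - birth C k i\<bar> \<le> \<delta> + (\<delta>' - \<delta>)"
      "bar_length C k i = \<infinity> \<and> bar_length D k j = \<infinity> \<or>
       \<bar>(ereal a' + bar_length D k j) - (ereal (birth C k i) + bar_length C k i)\<bar> \<le> ereal (\<delta> + (\<delta>' - \<delta>))"
    unfolding bars_close_def bar_at_def prod.case by blast
  obtain g :: 'g where g: "a' = birth D k j + incl g" using a'(1) by (auto simp: coset_mod_def)
  have "index_close \<delta>' C D k i j (- g)"
    using a'(2,3) incl_diff[of 0 g]
    unfolding index_close_def g bar_length_def by (auto split: if_splits)
  then show ?thesis by blast
qed

section \<open>Stability of barcodes\<close>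

text \<open>\<open>quasiequivalence\<close> is symmetric in C and D. Cutting it into a chain map
  condition and a homotopy condition lets each lemma serve in both directions.\<close>

definition filtered_chain_map ::
  "real \<Rightarrow> ('k::field, 'g::real_subgroup, 'c::ab_group_add) floer \<Rightarrow>
    ('k, 'g, 'd::ab_group_add) floer \<Rightarrow> ('c \<Rightarrow> 'd) \<Rightarrow> bool"
where
  "filtered_chain_map \<delta> C D \<Phi> \<longleftrightarrow>
     Vector_Spaces.linear (smul C) (smul D) \<Phi> \<and>
     (\<forall>k. \<Phi> ` grade C k \<subseteq> grade D k) \<and>
     (\<forall>c. \<Phi> (bdry C c) = bdry D (\<Phi> c)) \<and>
     (\<forall>k. \<forall>c\<in>grade C k. filt D (\<Phi> c) \<le> filt C c + ereal \<delta>)"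

definition filtered_homotopy ::
  "real \<Rightarrow> ('k::field, 'g::real_subgroup, 'c::ab_group_add) floer \<Rightarrow> ('c \<Rightarrow> 'c) \<Rightarrow> ('c \<Rightarrow> 'c) \<Rightarrow> bool"
where
  "filtered_homotopy \<epsilon> C F K \<longleftrightarrow>
     Vector_Spaces.linear (smul C) (smul C) K \<and>
     (\<forall>k. K ` grade C k \<subseteq> grade C (k + 1)) \<and>
     (\<forall>c. F c - c = bdry C (K c) + K (bdry C c)) \<and>
     (\<forall>k. \<forall>c\<in>grade C k. filt C (K c) \<le> filt C c + ereal \<epsilon>)"

lemma quasiequivalence_iff:
  "quasiequivalence \<delta> C D \<Phi> \<Psi> KC KD \<longleftrightarrow>
     filtered_chain_map \<delta> C D \<Phi> \<and> filtered_chain_map \<delta> D C \<Psi> \<and>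
     filtered_homotopy (2 * \<delta>) C (\<Psi> \<circ> \<Phi>) KC \<and> filtered_homotopy (2 * \<delta>) D (\<Phi> \<circ> \<Psi>) KD"
  unfolding quasiequivalence_def filtered_chain_map_def filtered_homotopy_def o_def
  by (intro iffI conjI; elim conjE; assumption)

text \<open>
  Infinite bars are given the death \<open>birth + R\<close> for a large \<open>R\<close>, which lets them take part in the
  same estimates as the finite ones.
\<close>

definition capped_death ::
  "real \<Rightarrow> ('k::field, 'g::real_subgroup, 'c::ab_group_add) floer \<Rightarrow> int \<Rightarrow> nat \<Rightarrow> real"
where
  "capped_death R C k i = (if i < svd_r C k then death C k i else birth C k i + R)"

section \<open>Coefficients of filtered maps in the chosen bases\<close>

lemma (in floer_cx) x_coeff_bound:
  assumes j: "j < svd_m C k" and c: "filt C (\<Sum>j<svd_m C k. smul C (c j) (svd_x C k j)) \<le> ereal B"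
    and g: "coeff (c j) g \<noteq> 0"
  shows "birth C k j - incl g \<le> B"
proof -
  have "filt C (smul C (c j) (svd_x C k j)) \<le> ereal B"
    using orth_basisD(5)[OF x_basis, of j k c] j c by (meson lessThan_iff order_trans)
  then have "ereal (birth C k j) - valuation (c j) \<le> ereal B"
    using grade.l_scale[OF x_grade[OF j]] by (simp add: filt_x j)
  then show ?thesis
    using valuation_le_incl[OF g] by (cases "valuation (c j)") auto
qed

lemma (in floer_cx) y_coeff_bound:
  assumes j: "j < svd_r C k" and c: "filt C (\<Sum>j<svd_n C k. smul C (c j) (svd_y C k j)) \<le> ereal B"
    and g: "coeff (c j) g \<noteq> 0"
  shows "death C k j - incl g \<le> B"
proof -
  have jn: "j < svd_n C k" using j r_le_n[of k] by simp
  have "filt C (smul C (c j) (svd_y C k j)) \<le> ereal B"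
    using orth_basisD(5)[OF y_basis, of j k c] jn c by (meson lessThan_iff order_trans)
  then have "ereal (death C k j) - valuation (c j) \<le> ereal B"
    using grade.l_scale[OF y_grade[OF jn]] by (simp add: filt_y j)
  then show ?thesis
    using valuation_le_incl[OF g] by (cases "valuation (c j)") auto
qed

text \<open>The same coefficients occur in \<Phi> of \<open>svd_x\<close> and, for finite bars, in
  \<Phi> of \<open>svd_y\<close>; the filtration bound on the first controls births, that on the
  second controls deaths.\<close>

lemma chain_map_coefficients:
  assumes C: "floer_complex C" and D: "floer_complex D" and \<Phi>: "filtered_chain_map \<delta> C D \<Phi>"
    and R: "\<And>j. j < svd_r D k \<Longrightarrow> death D k j - birth D k j \<le> R"
  shows "\<exists>\<phi>. (\<forall>i<svd_m C k. \<Phi> (svd_x C k i) = (\<Sum>j<svd_m D k. smul D (\<phi> i j) (svd_x D k j))) \<and>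
    (\<forall>i<svd_m C k. \<forall>j<svd_m D k. \<forall>g. coeff (\<phi> i j) g \<noteq> 0 \<longrightarrow>
      birth D k j - incl g \<le> birth C k i + \<delta> \<and>
      capped_death R D k j - incl g \<le> capped_death R C k i + \<delta>)"
proof -
  interpret C: floer_cx C by standard (rule C)
  interpret D: floer_cx D by standard (rule D)
  interpret \<Phi>: Vector_Spaces.linear "smul C" "smul D" \<Phi> using \<Phi> by (simp add: filtered_chain_map_def)
  have grade: "\<Phi> c \<in> grade D k" if "c \<in> grade C k" for c k
    using \<Phi> that by (auto simp: filtered_chain_map_def)
  have comm: "\<Phi> (bdry C c) = bdry D (\<Phi> c)" for c
    using \<Phi> by (simp add: filtered_chain_map_def)
  have filt: "filt D (\<Phi> c) \<le> filt C c + ereal \<delta>" if "c \<in> grade C k" for c k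
    using \<Phi> that by (auto simp: filtered_chain_map_def)
  have "\<forall>i\<in>{..<svd_m C k}. \<exists>\<phi>. \<Phi> (svd_x C k i) = (\<Sum>j<svd_m D k. smul D (\<phi> j) (svd_x D k j))"
  proof
    fix i assume i: "i \<in> {..<svd_m C k}"
    have "\<Phi> (svd_x C k i) \<in> cycles D k"
      using grade[OF C.x_grade, of i k] comm[of "svd_x C k i"] C.bdry_x[of i k] i by (simp add: cycles_def)
    then show "\<exists>\<phi>. \<Phi> (svd_x C k i) = (\<Sum>j<svd_m D k. smul D (\<phi> j) (svd_x D k j))"
      by (rule orth_basisD(4)[OF D.x_basis])
  qed
  from bchoice[OF this] obtain \<phi> where
    \<phi>: "\<forall>i\<in>{..<svd_m C k}. \<Phi> (svd_x C k i) = (\<Sum>j<svd_m D k. smul D (\<phi> i j) (svd_x D k j))" ..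
  have bound: "birth D k j - incl g \<le> birth C k i + \<delta> \<and> capped_death R D k j - incl g \<le> capped_death R C k i + \<delta>"
    if i: "i < svd_m C k" and j: "j < svd_m D k" and g: "coeff (\<phi> i j) g \<noteq> 0" for i j g
  proof
    have "filt D (\<Phi> (svd_x C k i)) \<le> ereal (birth C k i + \<delta>)"
      using filt[OF C.x_grade[OF i]] by (simp add: C.filt_x i)
    then show b: "birth D k j - incl g \<le> birth C k i + \<delta>"
      using D.x_coeff_bound[OF j, where c = "\<phi> i", OF _ g] \<phi> i by simp
    show "capped_death R D k j - incl g \<le> capped_death R C k i + \<delta>"
    proof (cases "i < svd_r C k")
      case False
      \<comment> \<open>An infinite source bar is capped at birth plus R, and R bounds the length of
        every finite bar of D, so the estimate for births carries over.\<close>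
      then show ?thesis using b R[of j] by (auto simp: capped_death_def)
    next
      case True
      have y: "svd_y C k i \<in> grade C (k + 1)"
        using True C.r_le_n[of k] by (intro C.y_grade) simp
      obtain e where e: "\<Phi> (svd_y C k i) = (\<Sum>j<svd_n D k. smul D (e j) (svd_y D k j))"
        using orth_basisD(4)[OF D.y_basis grade[OF y]] by blast
      have "\<Phi> (svd_x C k i) = bdry D (\<Phi> (svd_y C k i))"
        using comm[of "svd_y C k i"] True by (simp add: C.bdry_y)
      \<comment> \<open>Two expansions of one cycle. Comparing them shows that a finite bar reaches
        only finite bars, with the coefficients of \<Phi> on \<open>svd_y\<close>.\<close>
      then have "(\<Sum>j<svd_m D k. smul D (\<phi> i j) (svd_x D k j)) =
          (\<Sum>j<svd_m D k. smul D (if j < svd_r D k then e j else 0) (svd_x D k j))"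
        unfolding e D.bdry_y_sum using \<phi> i by simp
      from D.x_unique[OF this j] have eq: "\<phi> i j = (if j < svd_r D k then e j else 0)" .
      then have j': "j < svd_r D k" "coeff (e j) g \<noteq> 0" using g by (auto split: if_splits)
      have "filt D (\<Phi> (svd_y C k i)) \<le> ereal (death C k i + \<delta>)"
        using filt[OF y] by (simp add: C.filt_y True)
      then have "death D k j - incl g \<le> death C k i + \<delta>"
        using D.y_coeff_bound[OF j'(1), where c = e, OF _ j'(2)] e by simp
      then show ?thesis using True j' by (simp add: capped_death_def)
    qed
  qed
  show ?thesis using \<phi> bound by (intro exI[of _ \<phi>]) auto
qed

lemma card_le_card_index_close:
  fixes C :: "('k::field, 'g::real_subgroup, 'c::ab_group_add) floer"
    and D :: "('k, 'g, 'd::ab_group_add) floer"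
  assumes C: "floer_complex C" and D: "floer_complex D"
    and \<Phi>: "filtered_chain_map \<delta> C D \<Phi>" and \<Psi>: "filtered_chain_map \<delta> D C \<Psi>"
    and K: "filtered_homotopy (2 * \<delta>) C (\<Psi> \<circ> \<Phi>) K" and \<delta>: "0 \<le> \<delta>"
    and A: "A \<subseteq> {i. i < svd_m C k \<and> bar_length C k i > ereal (2 * \<delta>)}"
  shows "card A \<le> card {j \<in> {..<svd_m D k}. \<exists>i\<in>A. \<exists>g. index_close \<delta> C D k i j g}"
proof -
  interpret C: floer_cx C by standard (rule C)
  interpret D: floer_cx D by standard (rule D)
  define Ls where "Ls = (\<lambda>i. death C k i - birth C k i) ` {..<svd_r C k} \<union>
    (\<lambda>j. death D k j - birth D k j) ` {..<svd_r D k}"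
  \<comment> \<open>R exceeds every finite length by more than 2 \<delta>, so that close capped
    deaths never pair a finite bar with an infinite one. The inserted 0 makes R itself exceed 2
    \<delta>, hence the capped infinite bars are long.\<close>
  define R where "R = Max (insert 0 Ls) + 2 * \<delta> + 1"
  have R: "L + 2 * \<delta> < R" if "L \<in> insert 0 Ls" for L
  proof -
    have "L \<le> Max (insert 0 Ls)" using that by (intro Max_ge) (auto simp: Ls_def)
    then show ?thesis by (simp add: R_def)
  qed
  have RC: "death C k i - birth C k i + 2 * \<delta> < R" if "i < svd_r C k" for i
    using that by (intro R) (auto simp: Ls_def)
  have RD: "death D k j - birth D k j + 2 * \<delta> < R" if "j < svd_r D k" for j
    using that by (intro R) (auto simp: Ls_def)
  obtain \<phi> where \<phi>: "\<And>i. i < svd_m C k \<Longrightarrow> \<Phi> (svd_x C k i) = (\<Sum>j<svd_m D k. smul D (\<phi> i j) (svd_x D k j))"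
    "\<And>i j g. i < svd_m C k \<Longrightarrow> j < svd_m D k \<Longrightarrow> coeff (\<phi> i j) g \<noteq> 0 \<Longrightarrow>
      birth D k j - incl g \<le> birth C k i + \<delta> \<and> capped_death R D k j - incl g \<le> capped_death R C k i + \<delta>"
    using chain_map_coefficients[OF C D \<Phi>, of k R] RD \<delta> by (smt (verit, best))
  obtain \<psi> where \<psi>: "\<And>j. j < svd_m D k \<Longrightarrow> \<Psi> (svd_x D k j) = (\<Sum>i<svd_m C k. smul C (\<psi> j i) (svd_x C k i))"
    "\<And>j i g. j < svd_m D k \<Longrightarrow> i < svd_m C k \<Longrightarrow> coeff (\<psi> j i) g \<noteq> 0 \<Longrightarrow>
      birth C k i - incl g \<le> birth D k j + \<delta> \<and> capped_death R C k i - incl g \<le> capped_death R D k j + \<delta>"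
    using chain_map_coefficients[OF D C \<Psi>, of k R] RC \<delta> by (smt (verit, best))
  interpret \<Psi>: Vector_Spaces.linear "smul D" "smul C" \<Psi> using \<Psi> by (simp add: filtered_chain_map_def)
  interpret K: Vector_Spaces.linear "smul C" "smul C" K using K by (simp add: filtered_homotopy_def)
  have \<kappa>: "capped_death R C k i' - incl g \<le> birth C k i + 2 * \<delta>"
    if i: "i < svd_m C k" and i': "i' < svd_m C k"
      and g: "coeff ((\<Sum>j<svd_m D k. \<phi> i j * \<psi> j i') - (if i = i' then 1 else 0)) g \<noteq> 0" for i i' g
  proof -
    have KX: "K (svd_x C k i) \<in> grade C (k + 1)"
      using K C.x_grade[OF i] by (auto simp: filtered_homotopy_def)
    obtain e where e: "K (svd_x C k i) = (\<Sum>i<svd_n C k. smul C (e i) (svd_y C k i))"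
      using orth_basisD(4)[OF C.y_basis KX] by blast
    \<comment> \<open>On a cycle only the boundary of K is left of the homotopy. The error therefore
      involves finite bars alone, with the coefficients of \<open>K (svd_x C k i)\<close> in the
      basis \<open>svd_y\<close>, where the bound on K limits the deaths.\<close>
    have "\<Psi> (\<Phi> (svd_x C k i)) - svd_x C k i = bdry C (K (svd_x C k i))"
      using K by (simp add: filtered_homotopy_def C.bdry_x i)
    also have "\<dots> = (\<Sum>i<svd_m C k. smul C (if i < svd_r C k then e i else 0) (svd_x C k i))"
      unfolding e C.bdry_y_sum ..
    finally have 1: "\<Psi> (\<Phi> (svd_x C k i)) - svd_x C k i =
      (\<Sum>i<svd_m C k. smul C (if i < svd_r C k then e i else 0) (svd_x C k i))" .
    have "\<Psi> (\<Phi> (svd_x C k i)) = (\<Sum>j<svd_m D k. \<Sum>i'<svd_m C k. smul C (\<phi> i j * \<psi> j i') (svd_x C k i'))"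
      by (simp add: \<phi>(1) i \<Psi>.sum \<Psi>.scale \<psi>(1) C.scale_sum_right)
    also have "\<dots> = (\<Sum>i'<svd_m C k. smul C (\<Sum>j<svd_m D k. \<phi> i j * \<psi> j i') (svd_x C k i'))"
      by (subst sum.swap) (simp add: C.scale_sum_left)
    finally have 2: "\<Psi> (\<Phi> (svd_x C k i)) =
      (\<Sum>i'<svd_m C k. smul C (\<Sum>j<svd_m D k. \<phi> i j * \<psi> j i') (svd_x C k i'))" .
    have 3: "(\<Sum>i'<svd_m C k. smul C (if i = i' then 1 else 0) (svd_x C k i')) = svd_x C k i"
      using i by (simp add: if_distrib[of "\<lambda>c. smul C c _"] cong: if_cong)
    have "(\<Sum>i'<svd_m C k. smul C ((\<Sum>j<svd_m D k. \<phi> i j * \<psi> j i') - (if i = i' then 1 else 0)) (svd_x C k i')) =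
      (\<Sum>i<svd_m C k. smul C (if i < svd_r C k then e i else 0) (svd_x C k i))"
      using 1 2 3 by (simp add: C.scale_left_diff_distrib sum_subtractf)
    from C.x_unique[OF this i'] g have e': "i' < svd_r C k" "coeff (e i') g \<noteq> 0"
      by (auto split: if_splits)
    have "filt C (K (svd_x C k i)) \<le> ereal (birth C k i + 2 * \<delta>)"
      using K C.x_grade[OF i] C.filt_x[OF i] by (fastforce simp: filtered_homotopy_def)
    then have "death C k i' - incl g \<le> birth C k i + 2 * \<delta>"
      using C.y_coeff_bound[OF e'(1), where c = e, OF _ e'(2)] e by simp
    then show ?thesis using e' by (simp add: capped_death_def)
  qed
  have "card A \<le> card {j \<in> {..<svd_m D k}. \<exists>i\<in>A. \<exists>g :: 'g.
      \<bar>birth D k j - incl g - birth C k i\<bar> \<le> \<delta> \<and> \<bar>capped_death R D k j - incl g - capped_death R C k i\<bar> \<le> \<delta>}"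
  proof (rule card_le_card_close[of A "{..<svd_m C k}" "{..<svd_m D k}" \<phi> _ _ _ _ _ \<psi>])
    show "A \<subseteq> {..<svd_m C k}" using A by auto
    then show "finite A" by (rule finite_subset) simp
    show "2 * \<delta> < capped_death R C k i - birth C k i" if "i \<in> A" for i
      using that A R[of 0] \<delta> by (auto simp: capped_death_def bar_length_def split: if_splits)
  qed (use \<phi>(2) \<psi>(2) \<kappa> in auto)
  also have "\<dots> \<le> card {j \<in> {..<svd_m D k}. \<exists>i\<in>A. \<exists>g. index_close \<delta> C D k i j g}"
  proof (rule card_mono)
    \<comment> \<open>In a mixed pair the birth estimate would force R to be at most the finite
      length plus 2 \<delta>, against \<open>RC\<close> or \<open>RD\<close>.\<close>
    have "index_close \<delta> C D k i j g"
      if "\<bar>birth D k j - incl g - birth C k i\<bar> \<le> \<delta>" "\<bar>capped_death R D k j - incl g - capped_death R C k i\<bar> \<le> \<delta>"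
      for i j g
      using that RC[of i] RD[of j] unfolding index_close_def capped_death_def by (auto split: if_splits)
    then show "{j \<in> {..<svd_m D k}. \<exists>i\<in>A. \<exists>g :: 'g.
        \<bar>birth D k j - incl g - birth C k i\<bar> \<le> \<delta> \<and> \<bar>capped_death R D k j - incl g - capped_death R C k i\<bar> \<le> \<delta>}
      \<subseteq> {j \<in> {..<svd_m D k}. \<exists>i\<in>A. \<exists>g. index_close \<delta> C D k i j g}" by blast
  qed simp
  finally show ?thesis .
qed

lemma long_bars_injection:
  fixes k :: int
  assumes C: "floer_complex C" and D: "floer_complex D"
    and \<Phi>: "filtered_chain_map \<delta> C D \<Phi>" and \<Psi>: "filtered_chain_map \<delta> D C \<Psi>"
    and K: "filtered_homotopy (2 * \<delta>) C (\<Psi> \<circ> \<Phi>) K" and \<delta>: "0 \<le> \<delta>"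
  defines "A \<equiv> {i. i < svd_m C k \<and> bar_length C k i > ereal (2 * \<delta>)}"
  shows "\<exists>f. inj_on f A \<and> (\<forall>i\<in>A. f i \<in> pos_bars D k \<and> (\<exists>g. index_close \<delta> C D k i (f i) g))"
proof -
  have "\<exists>f. inj_on f A \<and> (\<forall>i\<in>A. f i \<in> {j \<in> {..<svd_m D k}. \<exists>g. index_close \<delta> C D k i j g})"
  proof (rule hall_marriage)
    fix B assume "B \<subseteq> A"
    then have "card B \<le> card {j \<in> {..<svd_m D k}. \<exists>i\<in>B. \<exists>g. index_close \<delta> C D k i j g}"
      unfolding A_def by (rule card_le_card_index_close[OF C D \<Phi> \<Psi> K \<delta>])
    also have "{j \<in> {..<svd_m D k}. \<exists>i\<in>B. \<exists>g. index_close \<delta> C D k i j g} =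
        (\<Union>i\<in>B. {j \<in> {..<svd_m D k}. \<exists>g. index_close \<delta> C D k i j g})" by blast
    finally show "card B \<le> card (\<Union>i\<in>B. {j \<in> {..<svd_m D k}. \<exists>g. index_close \<delta> C D k i j g})" .
  qed (auto simp: A_def)
  then obtain f where f: "inj_on f A" "\<forall>i\<in>A. f i \<in> {j \<in> {..<svd_m D k}. \<exists>g. index_close \<delta> C D k i j g}"
    by blast
  have "f i \<in> pos_bars D k" if i: "i \<in> A" for i
  proof -
    obtain g where g: "index_close \<delta> C D k i (f i) g" "f i < svd_m D k" using f(2) i by auto
    \<comment> \<open>Closeness shortens a finite bar by at most 2 \<delta>, so the partner of a
      long bar still has positive length.\<close>
    then have "bar_length D k (f i) > 0"
      using i \<delta> by (auto simp: A_def bar_length_def index_close_def split: if_splits)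
    then show ?thesis using g by (simp add: pos_bars_def)
  qed
  then show ?thesis using f by auto
qed

section \<open>From bijections of indices to matchings of multisets\<close>

lemma mset_set_subset_diff:
  assumes "finite X" "X' \<subseteq> X"
  shows "mset_set X = mset_set (X - X') + mset_set X'"
  using assms by (metis mset_set_Union finite_subset Diff_disjoint Diff_subset Int_commute Un_Diff_cancel2 sup.absorb1)

lemma rel_mset_image_bij:
  assumes h: "bij_betw h X Y" and R: "\<And>x. x \<in> X \<Longrightarrow> R (f x) (g (h x))"
  shows "rel_mset R (image_mset f (mset_set X)) (image_mset g (mset_set Y))"
proof (cases "finite X")
  case True
  have "mset_set Y = image_mset h (mset_set X)"
    using h by (metis bij_betw_def image_mset_mset_set)
  then have "image_mset g (mset_set Y) = image_mset (\<lambda>x. g (h x)) (mset_set X)"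
    by (simp add: multiset.map_comp o_def)
  moreover have "rel_mset R (image_mset f (mset_set X)) (image_mset (\<lambda>x. g (h x)) (mset_set X))"
    unfolding multiset.rel_map by (intro multiset.rel_refl_strong R) (use True in auto)
  ultimately show ?thesis by simp
next
  case False
  then have "infinite Y" using h bij_betw_finite by blast
  then show ?thesis using False by simp
qed

theorem matching_of_quasiequivalence:
  assumes C: "floer_complex C" and D: "floer_complex D" and \<delta>: "0 \<le> \<delta>"
    and q: "quasiequivalence \<delta> C D \<Phi> \<Psi> KC KD"
  shows "matching \<delta> (concise_barcode C k) (concise_barcode D k)"
proof -
  interpret C: floer_cx C by standard (rule C)
  interpret D: floer_cx D by standard (rule D)
  note q = q[unfolded quasiequivalence_iff]
  define A where "A = {i. i < svd_m C k \<and> bar_length C k i > ereal (2 * \<delta>)}"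
  define B where "B = {j. j < svd_m D k \<and> bar_length D k j > ereal (2 * \<delta>)}"
  obtain f where f: "inj_on f A" "\<And>i. i \<in> A \<Longrightarrow> f i \<in> pos_bars D k \<and> (\<exists>g. index_close \<delta> C D k i (f i) g)"
    using long_bars_injection[of C D \<delta> \<Phi> \<Psi> KC k] C D q \<delta> unfolding A_def by blast
  obtain f' where f': "inj_on f' B" "\<And>j. j \<in> B \<Longrightarrow> f' j \<in> pos_bars C k \<and> (\<exists>g. index_close \<delta> D C k j (f' j) g)"
    using long_bars_injection[of D C \<delta> \<Psi> \<Phi> KD k] C D q \<delta> unfolding B_def by blast
  have "\<exists>X' Y' h. A \<subseteq> X' \<and> X' \<subseteq> pos_bars C k \<and> B \<subseteq> Y' \<and> Y' \<subseteq> pos_bars D k \<and> bij_betw h X' Y' \<and>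
      (\<forall>x\<in>X'. \<exists>g. index_close \<delta> C D k x (h x) g)"
  proof (rule mendelsohn_dulmage[where R = "\<lambda>i j. \<exists>g. index_close \<delta> C D k i j g", OF f _ f'(1)])
    have "0 < L" if "ereal (2 * \<delta>) < L" for L
      by (rule le_less_trans[OF _ that]) (use \<delta> in simp)
    then show "A \<subseteq> pos_bars C k" "B \<subseteq> pos_bars D k"
      by (auto simp: A_def B_def pos_bars_def)
    show "f' j \<in> pos_bars C k \<and> (\<exists>g. index_close \<delta> C D k (f' j) j g)" if "j \<in> B" for j
      using f'(2)[OF that] index_close_swap by blast
  qed
  then obtain X' Y' h where X': "A \<subseteq> X'" "X' \<subseteq> pos_bars C k" and Y': "B \<subseteq> Y'" "Y' \<subseteq> pos_bars D k"
    and h: "bij_betw h X' Y'" "\<And>x. x \<in> X' \<Longrightarrow> \<exists>g. index_close \<delta> C D k x (h x) g" by blast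
  have fin: "finite (pos_bars C k)" "finite (pos_bars D k)" by (auto simp: pos_bars_def)
  define Ss where "Ss = image_mset (bar_at C k) (mset_set (pos_bars C k - X'))"
  define Ts where "Ts = image_mset (bar_at D k) (mset_set (pos_bars D k - Y'))"
  have S: "concise_barcode C k = Ss + image_mset (bar_at C k) (mset_set X')"
    unfolding C.concise_barcode_eq Ss_def using mset_set_subset_diff[OF fin(1) X'(2)] by simp
  have T: "concise_barcode D k = Ts + image_mset (bar_at D k) (mset_set Y')"
    unfolding D.concise_barcode_eq Ts_def using mset_set_subset_diff[OF fin(2) Y'(2)] by simp
  \<comment> \<open>The combined bijection covers A on one side and B on the other, so every bar
    left over has length at most 2 \<delta>.\<close>
  have "\<forall>(A, L)\<in>#Ss + Ts. L \<le> ereal (2 * \<delta>)"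
    using X'(1) Y'(1) fin by (fastforce simp: Ss_def Ts_def A_def B_def pos_bars_def bar_at_def not_le)
  moreover have "rel_mset (bars_close \<delta>) (concise_barcode C k - Ss) (concise_barcode D k - Ts)"
    unfolding S T add_diff_cancel_left' using h(2) index_close_imp_bars_close
    by (intro rel_mset_image_bij[OF h(1)]) blast
  ultimately show ?thesis
    unfolding matching_def using S T by (intro exI[of _ Ss] exI[of _ Ts]) auto
qed

section \<open>Linear maps defined on adapted bases\<close>

text \<open>The vectors \<open>svd_y C (k - 1)\<close> live in degree k, hence the shift of index.
  Below the rank they map onto basis vectors of the boundaries in degree k - 1; the cycles in degree
  k are spanned by \<open>svd_x C k\<close>.\<close>

definition adapted :: "('k::field, 'g::real_subgroup, 'c::ab_group_add) floer \<Rightarrow> int \<Rightarrow> nat + nat \<Rightarrow> 'c" where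
  "adapted C k = case_sum (svd_y C (k - 1)) (svd_x C k)"

definition adapted_index :: "('k::field, 'g::real_subgroup, 'c::ab_group_add) floer \<Rightarrow> int \<Rightarrow> (nat + nat) set" where
  "adapted_index C k = {..<svd_r C (k - 1)} <+> {..<svd_m C k}"

lemma direct_sum_zero:
  fixes V :: "int \<Rightarrow> 'c::ab_group_add set"
  assumes V: "internal_direct_sum V" "\<And>k. 0 \<in> V k" and K: "finite K" "\<And>k. k \<in> K \<Longrightarrow> f k \<in> V k"
    and sum: "(\<Sum>k\<in>K. f k) = 0" and k: "k \<in> K"
  shows "f k = 0"
proof -
  define f' where "f' k = (if k \<in> K then f k else 0)" for k
  let ?P = "\<lambda>f. (\<forall>k. f k \<in> V k) \<and> finite {k. f k \<noteq> 0} \<and> (0 :: 'c) = (\<Sum>k | f k \<noteq> 0. f k)"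
  have sub: "{k. f' k \<noteq> 0} \<subseteq> K" by (auto simp: f'_def)
  have "(\<Sum>k | f' k \<noteq> 0. f' k) = (\<Sum>k\<in>K. f k)"
    using K(1) by (intro sum.mono_neutral_cong_left) (auto simp: f'_def)
  then have P: "?P f'"
    using finite_subset[OF sub K(1)] sum V(2) K(2) by (simp add: f'_def)
  have P0: "?P (\<lambda>_. 0)" using V(2) by simp
  have ex1: "\<exists>!f. ?P f" using V(1) unfolding internal_direct_sum_def by (rule spec)
  have "f' = (\<lambda>_. 0)"
    by (rule trans[OF the1_equality[where P = ?P, OF ex1 P, symmetric] the1_equality[where P = ?P, OF ex1 P0]])
  then have "f' k = 0" by simp
  then show ?thesis using k by (simp add: f'_def)
qed

text \<open>Prescribing values by index keeps degree and position of a basis vector available;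
  independence makes the family injective, so the values are well defined on its image.\<close>

lemma linear_family_extend:
  fixes e :: "'i \<Rightarrow> 'c::ab_group_add" and h :: "'i \<Rightarrow> 'd::ab_group_add"
  assumes s: "vector_space s" and t: "vector_space t"
    and indep: "\<And>F c b. finite F \<Longrightarrow> F \<subseteq> B \<Longrightarrow> (\<Sum>b\<in>F. s (c b) (e b)) = 0 \<Longrightarrow> b \<in> F \<Longrightarrow> c b = 0"
  shows "\<exists>\<Phi>. Vector_Spaces.linear s t \<Phi> \<and> (\<forall>b\<in>B. \<Phi> (e b) = h b)"
proof -
  interpret s: vector_space s by (rule s)
  interpret t: vector_space t by (rule t)
  interpret vector_space_pair s t ..
  have inj: "inj_on e B"
  proof (rule inj_onI, rule ccontr)
    fix b b' assume b: "b \<in> B" "b' \<in> B" "e b = e b'" "b \<noteq> b'"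
    have "(if b = b then 1 else - 1 :: 'a) = 0"
      by (rule indep[of "{b, b'}" "\<lambda>a. if a = b then 1 else - 1"]) (use b in auto)
    then show False by simp
  qed
  have "s.independent (e ` B)"
    unfolding s.independent_explicit_module
  proof (intro allI impI)
    fix T u x assume T: "finite T" "T \<subseteq> e ` B" "(\<Sum>v\<in>T. s (u v) v) = 0" "x \<in> T"
    obtain F where F: "F \<subseteq> B" "finite F" "T = e ` F" using finite_subset_image[OF T(1,2)] by metis
    have "inj_on e F" using inj F(1) inj_on_subset by blast
    then have "(\<Sum>b\<in>F. s (u (e b)) (e b)) = 0" using T(3) F(3) by (simp add: sum.reindex)
    then show "u x = 0" using indep[OF F(2,1), of "\<lambda>b. u (e b)"] T(4) F(3) by auto
  qed
  then obtain \<Phi> where "Vector_Spaces.linear s t \<Phi>" "\<forall>x\<in>e ` B. \<Phi> x = h (the_inv_into B e x)"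
    using linear_independent_extend[of "e ` B" "\<lambda>x. h (the_inv_into B e x)"] by blast
  then show ?thesis by (intro exI[of _ \<Phi>]) (auto simp: the_inv_into_f_f[OF inj])
qed

text \<open>The ultrametric inequality bounds the image by its largest term, and orthogonality in
  the source bounds each term by the level of x.\<close>

lemma filtered_on_orth_basis:
  assumes V: "na_normed s V l" and W: "na_normed t W l'" and \<Phi>: "Vector_Spaces.linear s t \<Phi>"
    and e: "orth_basis s V l I e"
    and b: "\<And>i. i \<in> I \<Longrightarrow> \<Phi> (e i) \<in> W" "\<And>i. i \<in> I \<Longrightarrow> l' (\<Phi> (e i)) \<le> l (e i) + ereal \<epsilon>"
    and x: "x \<in> V"
  shows "\<Phi> x \<in> W" "l' (\<Phi> x) \<le> l x + ereal \<epsilon>"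
proof -
  interpret V: na_normed s V l by (rule V)
  interpret W: na_normed t W l' by (rule W)
  interpret \<Phi>: Vector_Spaces.linear s t \<Phi> by (rule \<Phi>)
  obtain c where c: "x = (\<Sum>i\<in>I. s (c i) (e i))" using orth_basisD(4)[OF e x] by blast
  have \<Phi>x: "\<Phi> x = (\<Sum>i\<in>I. t (c i) (\<Phi> (e i)))" unfolding c by (simp add: \<Phi>.sum \<Phi>.scale)
  show "\<Phi> x \<in> W" unfolding \<Phi>x by (intro W.sum_in_V b)
  show "l' (\<Phi> x) \<le> l x + ereal \<epsilon>"
    unfolding \<Phi>x
  proof (rule W.l_sum_le)
    fix i assume i: "i \<in> I"
    show "t (c i) (\<Phi> (e i)) \<in> W" by (intro W.scale_in_V b i)
    have "l' (t (c i) (\<Phi> (e i))) = l' (\<Phi> (e i)) - valuation (c i)"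
      by (rule W.l_scale[OF b(1)[OF i]])
    also have "\<dots> \<le> (l (e i) + ereal \<epsilon>) - valuation (c i)"
      by (intro ereal_minus_mono b(2) i order_refl)
    also have "\<dots> = (l (e i) - valuation (c i)) + ereal \<epsilon>"
      using valuation_not_MInf[of "c i"] V.l_not_PInf[OF orth_basisD(2)[OF e i]]
      by (cases "l (e i)"; cases "valuation (c i)") auto
    also have "\<dots> = l (s (c i) (e i)) + ereal \<epsilon>"
      using V.l_scale[OF orth_basisD(2)[OF e i]] by simp
    also have "\<dots> \<le> l x + ereal \<epsilon>"
      unfolding c by (intro add_right_mono orth_basisD(5)[OF e i])
    finally show "l' (t (c i) (\<Phi> (e i))) \<le> l x + ereal \<epsilon>" .
  qed
qed

context floer_cx
begin

text \<open>The vectors \<open>svd_y C (k - 1)\<close> from the rank onwards span the cycles, since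
  the coefficients below the rank reappear in the boundary. \<open>orth_basis_replace\<close>
  exchanges them for \<open>svd_x C k\<close>.\<close>

lemma adapted_basis: "orth_basis (smul C) (grade C k) (filt C) (adapted_index C k) (adapted C k)"
proof -
  define K where "K = {svd_r C (k - 1)..<svd_n C (k - 1)}"
  interpret Z: na_normed "smul C" "cycles C k" "filt C" by (rule cycles_normed)
  have y: "orth_basis (smul C) (grade C k) (filt C) {..<svd_n C (k - 1)} (svd_y C (k - 1))"
    using y_basis[of "k - 1"] by simp
  have "orth_basis (smul C) (grade C k) (filt C) (({..<svd_n C (k - 1)} - K) <+> {..<svd_m C k})
      (case_sum (svd_y C (k - 1)) (svd_x C k))"
  proof (rule grade.orth_basis_replace[OF y _ _ _ _ Z.subspace_V x_basis])
    show "K \<subseteq> {..<svd_n C (k - 1)}" by (auto simp: K_def)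
    show "cycles C k \<subseteq> grade C k" by (auto simp: cycles_def)
    show "svd_y C (k - 1) i \<in> cycles C k" if "i \<in> K" for i
      using that y_grade[of i "k - 1"] bdry_y_kernel[of "k - 1" i] by (simp add: K_def cycles_def)
    fix x assume x: "x \<in> cycles C k"
    then have "x \<in> grade C k" by (simp add: cycles_def)
    then obtain c where c: "x = (\<Sum>i<svd_n C (k - 1). smul C (c i) (svd_y C (k - 1) i))"
      using orth_basisD(4)[OF y] by blast
    have "(\<Sum>i<svd_m C (k - 1). smul C (if i < svd_r C (k - 1) then c i else 0) (svd_x C (k - 1) i)) =
        (\<Sum>i<svd_m C (k - 1). smul C 0 (svd_x C (k - 1) i))"
      using x unfolding bdry_y_sum[symmetric] c[symmetric] by (simp add: cycles_def)
    note zero = x_unique[OF this]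
    have "c i = 0" if "i < svd_r C (k - 1)" for i
      using zero[of i] that r_le_m[of "k - 1"] by simp
    then have "x = (\<Sum>i\<in>K. smul C (c i) (svd_y C (k - 1) i))"
      unfolding c by (intro sum.mono_neutral_right) (auto simp: K_def)
    then show "\<exists>c. x = (\<Sum>i\<in>K. smul C (c i) (svd_y C (k - 1) i))" by blast
  qed
  moreover have "{..<svd_n C (k - 1)} - K = {..<svd_r C (k - 1)}"
    using r_le_n[of "k - 1"] by (auto simp: K_def)
  ultimately show ?thesis by (simp add: adapted_def adapted_index_def)
qed

text \<open>Identities between linear maps, such as those of chain maps and homotopies, need
  checking on adapted basis vectors only.\<close>

lemma adapted_induct [case_names zero add scale y x]:
  assumes "P 0" "\<And>x y. P x \<Longrightarrow> P y \<Longrightarrow> P (x + y)" "\<And>c x. P x \<Longrightarrow> P (smul C c x)"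
    and "\<And>k i. i < svd_r C k \<Longrightarrow> P (svd_y C k i)" "\<And>k i. i < svd_m C k \<Longrightarrow> P (svd_x C k i)"
  shows "P x"
proof -
  have sum: "P (\<Sum>i\<in>I. f i)" if "\<And>i. i \<in> I \<Longrightarrow> P (f i)" for I :: "'i set" and f
    using that assms(1,2) by (induction I rule: infinite_finite_induct) auto
  have grade: "P x" if x: "x \<in> grade C k" for x k
  proof -
    obtain c where c: "x = (\<Sum>i\<in>adapted_index C k. smul C (c i) (adapted C k i))"
      using orth_basisD(4)[OF adapted_basis x] by blast
    show ?thesis unfolding c
      by (intro sum assms(3)) (use assms(4,5) in \<open>auto simp: adapted_index_def adapted_def\<close>)
  qed
  obtain f where "\<forall>k. f k \<in> grade C k" "x = (\<Sum>k | f k \<noteq> 0. f k)"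
    using direct_sum unfolding internal_direct_sum_def by metis
  then show ?thesis using sum[of "{k. f k \<noteq> 0}" f] grade by blast
qed

text \<open>The adapted bases of all degrees are independent together: the direct sum splits a
  relation by degree, and orthogonality settles each degree.\<close>

lemma linear_extension:
  assumes t: "vector_space t"
  shows "\<exists>\<Phi>. Vector_Spaces.linear (smul C) t \<Phi> \<and>
    (\<forall>k. \<forall>i<svd_r C k. \<Phi> (svd_y C k i) = hy k i) \<and> (\<forall>k. \<forall>i<svd_m C k. \<Phi> (svd_x C k i) = hx k i)"
proof -
  define h where "h = (\<lambda>(k, i). case_sum (hy (k - 1)) (hx k) i)"
  define e where "e = (\<lambda>(k, i). adapted C k i)"
  define B where "B = Sigma UNIV (adapted_index C)"
  have "\<exists>\<Phi>. Vector_Spaces.linear (smul C) t \<Phi> \<and> (\<forall>b\<in>B. \<Phi> (e b) = h b)"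
  proof (rule linear_family_extend[OF vector_space_axioms t])
    fix F c b assume F: "finite F" "F \<subseteq> B" "(\<Sum>b\<in>F. smul C (c b) (e b)) = 0" "b \<in> F"
    define I where "I k = {i. (k, i) \<in> F}" for k
    have FI: "F = Sigma (fst ` F) I" by (force simp: I_def)
    have I: "I k \<subseteq> adapted_index C k" for k using F(2) by (auto simp: I_def B_def)
    have finI: "finite (I k)" for k
      using F(1) by (intro finite_subset[of "I k" "snd ` F"]) (force simp: I_def)+
    have eV: "adapted C k i \<in> grade C k" if "i \<in> I k" for k i
      using that I orth_basisD(2)[OF adapted_basis] by blast
    define f where "f k = (\<Sum>i\<in>I k. smul C (c (k, i)) (adapted C k i))" for k
    have "(\<Sum>k\<in>fst ` F. f k) = (\<Sum>b\<in>F. smul C (c b) (e b))"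
      unfolding f_def by (subst (2) FI, subst sum.Sigma) (use F(1) finI in \<open>auto simp: e_def split_beta\<close>)
    then have sum0: "(\<Sum>k\<in>fst ` F. f k) = 0" using F(3) by simp
    obtain k i where b: "b = (k, i)" by (cases b)
    have k: "k \<in> fst ` F" and i: "i \<in> I k" using F(4) b by (force simp: I_def)+
    have "f k = 0"
      by (rule direct_sum_zero[OF direct_sum _ _ _ sum0 k]) (auto simp: F(1) f_def intro!: grade.sum_in_V eV)
    then have "(\<Sum>i\<in>adapted_index C k. smul C (if i \<in> I k then c (k, i) else 0) (adapted C k i)) =
        (\<Sum>i\<in>adapted_index C k. smul C 0 (adapted C k i))"
      using grade.sum_restrict_scale[OF orth_basisD(1)[OF adapted_basis] I] unfolding f_def by simp
    from grade.orth_basis_unique[OF adapted_basis this, of i] show "c b = 0" using i I b by auto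
  qed
  then obtain \<Phi> where \<Phi>: "Vector_Spaces.linear (smul C) t \<Phi>" "\<And>b. b \<in> B \<Longrightarrow> \<Phi> (e b) = h b" by blast
  have "\<Phi> (svd_y C k i) = hy k i" if "i < svd_r C k" for k i
    using \<Phi>(2)[of "(k + 1, Inl i)"] that by (auto simp: B_def e_def h_def adapted_def adapted_index_def)
  moreover have "\<Phi> (svd_x C k i) = hx k i" if "i < svd_m C k" for k i
    using \<Phi>(2)[of "(k, Inr i)"] that by (auto simp: B_def e_def h_def adapted_def adapted_index_def)
  ultimately show ?thesis using \<Phi>(1) by blast
qed

text \<open>The offset d is the degree of \<Phi>: 0 for chain maps, 1 for homotopies.\<close>

lemma filtered_on_adapted:
  fixes D :: "('k, 'g, 'd::ab_group_add) floer"
  assumes D: "floer_complex D" and \<Phi>: "Vector_Spaces.linear (smul C) (smul D) \<Phi>"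
    and y: "\<And>k i. i < svd_r C k \<Longrightarrow> \<Phi> (svd_y C k i) \<in> grade D (k + 1 + d) \<and>
              filt D (\<Phi> (svd_y C k i)) \<le> filt C (svd_y C k i) + ereal \<epsilon>"
    and x: "\<And>k i. i < svd_m C k \<Longrightarrow> \<Phi> (svd_x C k i) \<in> grade D (k + d) \<and>
              filt D (\<Phi> (svd_x C k i)) \<le> filt C (svd_x C k i) + ereal \<epsilon>"
    and c: "c \<in> grade C k"
  shows "\<Phi> c \<in> grade D (k + d) \<and> filt D (\<Phi> c) \<le> filt C c + ereal \<epsilon>"
proof -
  interpret D: floer_cx D by standard (rule D)
  have "\<Phi> (adapted C k i) \<in> grade D (k + d) \<and> filt D (\<Phi> (adapted C k i)) \<le> filt C (adapted C k i) + ereal \<epsilon>"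
    if "i \<in> adapted_index C k" for i
    using that y[of _ "k - 1"] x[of _ k] by (auto simp: adapted_index_def adapted_def)
  then show ?thesis
    using filtered_on_orth_basis[OF grade.na_normed_axioms D.grade.na_normed_axioms \<Phi> adapted_basis _ _ c] by blast
qed

end


section \<open>Quasiequivalences from matchings\<close>

text \<open>Both ends of a matched finite bar are shifted by the same power of T, and both ends of
  an unmatched one are killed; either way the map commutes with the boundary. Closeness makes
  partners finite together, so the image of \<open>svd_y\<close> again has the right
  boundary.\<close>

lemma matched_chain_map:
  fixes C :: "('k::field, 'g::real_subgroup, 'c::ab_group_add) floer"
    and D :: "('k, 'g, 'd::ab_group_add) floer"
  assumes C: "floer_complex C" and D: "floer_complex D"
    and M: "\<And>k i. i \<in> X k \<Longrightarrow> i < svd_m C k \<and> h k i < svd_m D k \<and> index_close \<delta> C D k i (h k i) (G k i)"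
  shows "\<exists>\<Phi>. filtered_chain_map \<delta> C D \<Phi> \<and>
    (\<forall>k. \<forall>i<svd_r C k. \<Phi> (svd_y C k i) = (if i \<in> X k then smul D (nov_T (G k i)) (svd_y D k (h k i)) else 0)) \<and>
    (\<forall>k. \<forall>i<svd_m C k. \<Phi> (svd_x C k i) = (if i \<in> X k then smul D (nov_T (G k i)) (svd_x D k (h k i)) else 0))"
proof -
  interpret C: floer_cx C by standard (rule C)
  interpret D: floer_cx D by standard (rule D)
  obtain \<Phi> where \<Phi>: "Vector_Spaces.linear (smul C) (smul D) \<Phi>"
    and \<Phi>y: "\<And>k i. i < svd_r C k \<Longrightarrow> \<Phi> (svd_y C k i) = (if i \<in> X k then smul D (nov_T (G k i)) (svd_y D k (h k i)) else 0)"
    and \<Phi>x: "\<And>k i. i < svd_m C k \<Longrightarrow> \<Phi> (svd_x C k i) = (if i \<in> X k then smul D (nov_T (G k i)) (svd_x D k (h k i)) else 0)"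
    using C.linear_extension[OF D.vector_space_axioms,
        of "\<lambda>k i. if i \<in> X k then smul D (nov_T (G k i)) (svd_y D k (h k i)) else 0"
           "\<lambda>k i. if i \<in> X k then smul D (nov_T (G k i)) (svd_x D k (h k i)) else 0"]
    by blast
  interpret \<Phi>: Vector_Spaces.linear "smul C" "smul D" \<Phi> by (rule \<Phi>)
  have hr: "h k i < svd_r D k" if "i \<in> X k" "i < svd_r C k" for k i
    using M[OF that(1)] that(2) by (simp add: index_close_def)
  have yb: "\<Phi> (svd_y C k i) \<in> grade D (k + 1 + 0) \<and> filt D (\<Phi> (svd_y C k i)) \<le> filt C (svd_y C k i) + ereal \<delta>"
    if i: "i < svd_r C k" for k i
  proof (cases "i \<in> X k")
    case True
    have yD: "svd_y D k (h k i) \<in> grade D (k + 1)"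
      using hr[OF True i] D.r_le_n[of k] by (intro D.y_grade) simp
    show ?thesis
      using True M[OF True] i hr[OF True i] D.grade.scale_in_V[OF yD] D.grade.l_scale[OF yD]
      by (auto simp: \<Phi>y C.filt_y D.filt_y index_close_def)
  qed (simp add: \<Phi>y i)
  have xb: "\<Phi> (svd_x C k i) \<in> grade D (k + 0) \<and> filt D (\<Phi> (svd_x C k i)) \<le> filt C (svd_x C k i) + ereal \<delta>"
    if i: "i < svd_m C k" for k i
  proof (cases "i \<in> X k")
    case True
    have xD: "svd_x D k (h k i) \<in> grade D k"
      using M[OF True] by (intro D.x_grade) simp
    show ?thesis
      using True M[OF True] i D.grade.scale_in_V[OF xD] D.grade.l_scale[OF xD]
      by (auto simp: \<Phi>x C.filt_x D.filt_x index_close_def)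
  qed (simp add: \<Phi>x i)
  have "\<Phi> (bdry C c) = bdry D (\<Phi> c)" for c
  proof (induction c rule: C.adapted_induct)
    case (y k i)
    then have "i < svd_m C k" using C.r_le_m[of k] by simp
    then show ?case using y hr[of i k] by (simp add: \<Phi>y \<Phi>x C.bdry_y D.bdry_y D.bdry.scale)
  next
    case (x k i)
    then show ?case using M[of i k] by (simp add: \<Phi>x C.bdry_x D.bdry_x D.bdry.scale)
  qed (simp_all add: \<Phi>.add \<Phi>.scale C.bdry.add C.bdry.scale D.bdry.add D.bdry.scale)
  moreover have "\<Phi> c \<in> grade D k \<and> filt D (\<Phi> c) \<le> filt C c + ereal \<delta>" if "c \<in> grade C k" for c k
    using C.filtered_on_adapted[OF D \<Phi> yb xb that] by simp
  ultimately have "filtered_chain_map \<delta> C D \<Phi>"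
    using \<Phi> by (auto simp: filtered_chain_map_def)
  then show ?thesis using \<Phi>x \<Phi>y by (intro exI[of _ \<Phi>]) simp
qed

text \<open>Here F projects onto the matched bars. On an unmatched bar F minus the identity is minus
  the identity, which K produces from x through its boundary term and from y through the boundary of
  y. Such a bar is finite, and its length bounds the filtration shift of K.\<close>

lemma matched_homotopy:
  fixes C :: "('k::field, 'g::real_subgroup, 'c::ab_group_add) floer"
  assumes C: "floer_complex C" and F: "Vector_Spaces.linear (smul C) (smul C) F"
    and Fy: "\<And>k i. i < svd_r C k \<Longrightarrow> F (svd_y C k i) = (if i \<in> X k then svd_y C k i else 0)"
    and Fx: "\<And>k i. i < svd_m C k \<Longrightarrow> F (svd_x C k i) = (if i \<in> X k then svd_x C k i else 0)"
    and short: "\<And>k i. i < svd_m C k \<Longrightarrow> i \<notin> X k \<Longrightarrow> bar_length C k i \<le> ereal \<epsilon>"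
  shows "\<exists>K. filtered_homotopy \<epsilon> C F K"
proof -
  interpret C: floer_cx C by standard (rule C)
  interpret F: Vector_Spaces.linear "smul C" "smul C" F by (rule F)
  obtain K where K: "Vector_Spaces.linear (smul C) (smul C) K"
    and Ky: "\<And>k i. i < svd_r C k \<Longrightarrow> K (svd_y C k i) = 0"
    and Kx: "\<And>k i. i < svd_m C k \<Longrightarrow> K (svd_x C k i) = (if i \<in> X k then 0 else - svd_y C k i)"
    using C.linear_extension[OF C.vector_space_axioms, of "\<lambda>_ _. 0" "\<lambda>k i. if i \<in> X k then 0 else - svd_y C k i"]
    by blast
  interpret K: Vector_Spaces.linear "smul C" "smul C" K by (rule K)
  have r: "i < svd_r C k" "death C k i \<le> birth C k i + \<epsilon>" if "i < svd_m C k" "i \<notin> X k" for k i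
    using short[OF that] by (auto simp: bar_length_def split: if_splits)
  have xb: "K (svd_x C k i) \<in> grade C (k + 1) \<and> filt C (K (svd_x C k i)) \<le> filt C (svd_x C k i) + ereal \<epsilon>"
    if i: "i < svd_m C k" for k i
  proof (cases "i \<in> X k")
    case False
    have y: "svd_y C k i \<in> grade C (k + 1)"
      using r(1)[OF i False] C.r_le_n[of k] by (intro C.y_grade) simp
    show ?thesis
      using False r[OF i False] C.grade.l_minus[OF y] C.subspace_neg[OF C.grade.subspace_V y]
      by (simp add: Kx i C.filt_x C.filt_y)
  qed (simp add: Kx i)
  have "F c - c = bdry C (K c) + K (bdry C c)" for c
  proof (induction c rule: C.adapted_induct)
    case (y k i)
    then have "i < svd_m C k" using C.r_le_m[of k] by simp
    then show ?case using y by (simp add: Fy Ky Kx C.bdry_y)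
  next
    case (x k i)
    then show ?case using r[of i k] by (auto simp: Fx Kx C.bdry_x C.bdry_y C.bdry.neg)
  next
    case (add u v)
    have "F (u + v) - (u + v) = (F u - u) + (F v - v)" by (simp add: F.add)
    then show ?case unfolding add by (simp add: K.add C.bdry.add)
  next
    case (scale a u)
    have "F (smul C a u) - smul C a u = smul C a (F u - u)"
      by (simp add: F.scale C.scale_right_diff_distrib)
    then show ?case unfolding scale by (simp add: K.scale C.bdry.scale C.scale_right_distrib)
  qed simp
  moreover have "K c \<in> grade C (k + 1) \<and> filt C (K c) \<le> filt C c + ereal \<epsilon>" if "c \<in> grade C k" for c k
    by (rule C.filtered_on_adapted[OF C K _ xb that]) (simp_all add: Ky)
  ultimately have "filtered_homotopy \<epsilon> C F K"
    using K by (auto simp: filtered_homotopy_def)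
  then show ?thesis by blast
qed

text \<open>The powers of T attached to a matched pair are inverse to each other, so both composites
  are projections onto the matched bars and \<open>matched_homotopy\<close> applies to each.\<close>

lemma quasiequivalence_of_index_matching:
  fixes C :: "('k::field, 'g::real_subgroup, 'c::ab_group_add) floer"
    and D :: "('k, 'g, 'd::ab_group_add) floer"
  assumes C: "floer_complex C" and D: "floer_complex D"
    and X: "\<And>k. X k \<subseteq> {..<svd_m C k}" and Y: "\<And>k. Y k \<subseteq> {..<svd_m D k}"
    and h: "\<And>k. bij_betw (h k) (X k) (Y k)"
    and close: "\<And>k i. i \<in> X k \<Longrightarrow> index_close \<delta> C D k i (h k i) (G k i)"
    and shortC: "\<And>k i. i < svd_m C k \<Longrightarrow> i \<notin> X k \<Longrightarrow> bar_length C k i \<le> ereal (2 * \<delta>)"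
    and shortD: "\<And>k j. j < svd_m D k \<Longrightarrow> j \<notin> Y k \<Longrightarrow> bar_length D k j \<le> ereal (2 * \<delta>)"
  shows "\<exists>\<Phi> \<Psi> KC KD. quasiequivalence \<delta> C D \<Phi> \<Psi> KC KD"
proof -
  interpret C: floer_cx C by standard (rule C)
  interpret D: floer_cx D by standard (rule D)
  define h' where "h' k = the_inv_into (X k) (h k)" for k
  have inj: "inj_on (h k) (X k)" and im: "h k ` X k = Y k" for k
    using h[of k] by (auto simp: bij_betw_def)
  have h'h: "h' k (h k i) = i" if "i \<in> X k" for k i
    unfolding h'_def by (rule the_inv_into_f_f[OF inj that])
  have hh': "h k (h' k j) = j" and h'X: "h' k j \<in> X k" if "j \<in> Y k" for k j
    using that f_the_inv_into_f[OF inj, of j k] the_inv_into_into[OF inj, of j k "X k"]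
    unfolding h'_def im by auto
  have hY: "h k i \<in> Y k" if "i \<in> X k" for k i using that im by blast
  have "\<And>k i. i \<in> X k \<Longrightarrow> i < svd_m C k \<and> h k i < svd_m D k \<and> index_close \<delta> C D k i (h k i) (G k i)"
    using X Y hY close by (meson lessThan_iff subsetD)
  from matched_chain_map[OF C D this] obtain \<Phi> where \<Phi>: "filtered_chain_map \<delta> C D \<Phi>"
    and \<Phi>y: "\<And>k i. i < svd_r C k \<Longrightarrow> \<Phi> (svd_y C k i) = (if i \<in> X k then smul D (nov_T (G k i)) (svd_y D k (h k i)) else 0)"
    and \<Phi>x: "\<And>k i. i < svd_m C k \<Longrightarrow> \<Phi> (svd_x C k i) = (if i \<in> X k then smul D (nov_T (G k i)) (svd_x D k (h k i)) else 0)"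
    by blast
  have "j < svd_m D k \<and> h' k j < svd_m C k \<and> index_close \<delta> D C k j (h' k j) (- G k (h' k j))"
    if "j \<in> Y k" for k j
    using X Y that h'X[OF that] hh'[OF that] index_close_swap[OF close[OF h'X[OF that]]]
    by (metis lessThan_iff subsetD)
  from matched_chain_map[OF D C this] obtain \<Psi> where \<Psi>: "filtered_chain_map \<delta> D C \<Psi>"
    and \<Psi>y: "\<And>k j. j < svd_r D k \<Longrightarrow> \<Psi> (svd_y D k j) =
      (if j \<in> Y k then smul C (nov_T (- G k (h' k j))) (svd_y C k (h' k j)) else 0)"
    and \<Psi>x: "\<And>k j. j < svd_m D k \<Longrightarrow> \<Psi> (svd_x D k j) =
      (if j \<in> Y k then smul C (nov_T (- G k (h' k j))) (svd_x C k (h' k j)) else 0)"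
    by blast
  interpret \<Phi>: Vector_Spaces.linear "smul C" "smul D" \<Phi> using \<Phi> by (simp add: filtered_chain_map_def)
  interpret \<Psi>: Vector_Spaces.linear "smul D" "smul C" \<Psi> using \<Psi> by (simp add: filtered_chain_map_def)
  have hr: "h k i < svd_r D k \<longleftrightarrow> i < svd_r C k" if "i \<in> X k" for k i
    using close[OF that] by (simp add: index_close_def)
  have h'r: "h' k j < svd_r C k \<longleftrightarrow> j < svd_r D k" if "j \<in> Y k" for k j
    using hr[OF h'X[OF that]] hh'[OF that] by simp
  have hm: "h k i < svd_m D k" if "i \<in> X k" for k i using hY[OF that] Y[of k] by auto
  have h'm: "h' k j < svd_m C k" if "j \<in> Y k" for k j using h'X[OF that] X[of k] by auto
  have TT: "nov_T g * nov_T (- g) = (1 :: ('k, 'g) novikov)" "nov_T (- g) * nov_T g = (1 :: ('k, 'g) novikov)" for g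
    by (simp_all add: nov_T_mult)
  have "\<exists>KC. filtered_homotopy (2 * \<delta>) C (\<Psi> \<circ> \<Phi>) KC"
  proof (rule matched_homotopy[OF C _ _ _ shortC])
    show "Vector_Spaces.linear (smul C) (smul C) (\<Psi> \<circ> \<Phi>)"
      by (rule Vector_Spaces.linear_compose[OF \<Phi>.linear_axioms \<Psi>.linear_axioms])
    show "(\<Psi> \<circ> \<Phi>) (svd_y C k i) = (if i \<in> X k then svd_y C k i else 0)" if "i < svd_r C k" for k i
      using that by (simp add: \<Phi>y \<Psi>.scale \<Psi>y hr hY h'h TT)
    show "(\<Psi> \<circ> \<Phi>) (svd_x C k i) = (if i \<in> X k then svd_x C k i else 0)" if "i < svd_m C k" for k i
      using that by (simp add: \<Phi>x \<Psi>.scale \<Psi>x hm hY h'h TT)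
  qed
  moreover have "\<exists>KD. filtered_homotopy (2 * \<delta>) D (\<Phi> \<circ> \<Psi>) KD"
  proof (rule matched_homotopy[OF D _ _ _ shortD])
    show "Vector_Spaces.linear (smul D) (smul D) (\<Phi> \<circ> \<Psi>)"
      by (rule Vector_Spaces.linear_compose[OF \<Psi>.linear_axioms \<Phi>.linear_axioms])
    show "(\<Phi> \<circ> \<Psi>) (svd_y D k j) = (if j \<in> Y k then svd_y D k j else 0)" if "j < svd_r D k" for k j
      using that by (simp add: \<Psi>y \<Phi>.scale \<Phi>y h'r h'X hh' TT)
    show "(\<Phi> \<circ> \<Psi>) (svd_x D k j) = (if j \<in> Y k then svd_x D k j else 0)" if "j < svd_m D k" for k j
      using that by (simp add: \<Psi>x \<Phi>.scale \<Phi>x h'm h'X hh' TT)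
  qed
  ultimately show ?thesis using \<Phi> \<Psi> unfolding quasiequivalence_iff by blast
qed

section \<open>From matchings of multisets to bijections of indices\<close>

lemma image_mset_set_split:
  assumes P: "finite P" and S: "image_mset f (mset_set P) = S + T"
  shows "\<exists>Q\<subseteq>P. S = image_mset f (mset_set (P - Q)) \<and> T = image_mset f (mset_set Q)"
proof -
  obtain S' T' where ST: "mset_set P = S' + T'" "S = image_mset f S'" "T = image_mset f T'"
    using image_mset_eq_plusD[OF S] by blast
  have count: "count (mset_set P) x = count S' x + count T' x" for x using ST(1) by simp
  \<comment> \<open>A part of a multiset without repetitions has multiplicities at most 1, so it is
    determined by its support.\<close>
  have "count T' x = count (mset_set (set_mset T')) x" for x
  proof (cases "x \<in># T'")
    case True
    then have "0 < count T' x" by simp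
    moreover have "count T' x \<le> 1" using count[of x] by (auto simp: count_mset_set' split: if_splits)
    ultimately have "count T' x = 1" by linarith
    then show ?thesis using True by simp
  qed (simp add: not_in_iff)
  then have T': "T' = mset_set (set_mset T')" by (rule multiset_eqI)
  have sub: "set_mset T' \<subseteq> P"
    using arg_cong[OF ST(1), of set_mset] P by auto
  have "S' = mset_set P - mset_set (set_mset T')" using ST(1) by (simp flip: T')
  also have "\<dots> = mset_set (P - set_mset T')" using mset_set_Diff[OF P sub] by simp
  finally show ?thesis using ST(2,3) T' sub by (intro exI[of _ "set_mset T'"]) simp
qed

text \<open>Each index x receives a partner from \<open>rel_mset\<close>, which is removed before
  the next one is treated; multiplicity one in Y keeps it from being used again.\<close>

lemma rel_mset_set_bij:
  assumes "finite X" "finite Y" "rel_mset R (mset_set X) (mset_set Y)"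
  shows "\<exists>h. bij_betw h X Y \<and> (\<forall>x\<in>X. R x (h x))"
  using assms
proof (induction X arbitrary: Y rule: finite_induct)
  case empty
  then show ?case by (auto simp: mset_set_empty_iff bij_betw_def)
next
  case (insert x X)
  then have "rel_mset R (add_mset x (mset_set X)) (mset_set Y)" by simp
  then obtain N b where N: "mset_set Y = add_mset b N" "R x b" "rel_mset R (mset_set X) N"
    using msed_rel_invL[OF \<open>rel_mset R (add_mset x _) _\<close>] by (elim exE conjE)
  have b: "b \<in> Y" using N(1) insert.prems(1) by (metis finite_set_mset_mset_set union_single_eq_member)
  then have "N = mset_set (Y - {b})" using N(1) insert.prems(1) by (simp add: mset_set_Diff)
  then obtain h where h: "bij_betw h X (Y - {b})" "\<forall>x\<in>X. R x (h x)"
    using insert.IH[of "Y - {b}"] N(3) insert.prems(1) by blast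
  have "bij_betw (h(x := b)) X (Y - {b})"
    using h(1) insert.hyps(2) by (subst bij_betw_cong[of X _ h]) auto
  moreover have "bij_betw (h(x := b)) {x} {b}" by simp
  ultimately have "bij_betw (h(x := b)) (X \<union> {x}) ((Y - {b}) \<union> {b})"
    by (rule bij_betw_combine) auto
  then have "bij_betw (h(x := b)) (insert x X) Y"
    using b by (simp add: insert_absorb)
  moreover have "\<forall>y\<in>insert x X. R y ((h(x := b)) y)"
    using h(2) N(2) insert.hyps(2) by auto
  ultimately show ?case by blast
qed

text \<open>Indices whose bars have no positive length are absent from the concise barcode. They
  stay unmatched and count as short because \<delta>' is positive; raising \<delta> to \<delta>'
  also pays for the slack \<epsilon>.\<close>

lemma index_matching_of_matching:
  fixes C :: "('k::field, 'g::real_subgroup, 'c::ab_group_add) floer"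
    and D :: "('k, 'g, 'd::ab_group_add) floer"
  assumes C: "floer_complex C" and D: "floer_complex D" and \<delta>: "0 \<le> \<delta>" "\<delta> < \<delta>'"
    and m: "matching \<delta> (concise_barcode C k) (concise_barcode D k)"
  shows "\<exists>X Y h G. X \<subseteq> {..<svd_m C k} \<and> Y \<subseteq> {..<svd_m D k} \<and> bij_betw h X Y \<and>
    (\<forall>i\<in>X. index_close \<delta>' C D k i (h i) (G i)) \<and>
    (\<forall>i<svd_m C k. i \<notin> X \<longrightarrow> bar_length C k i \<le> ereal (2 * \<delta>')) \<and>
    (\<forall>j<svd_m D k. j \<notin> Y \<longrightarrow> bar_length D k j \<le> ereal (2 * \<delta>'))"
proof -
  interpret C: floer_cx C by standard (rule C)
  interpret D: floer_cx D by standard (rule D)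
  have fin: "finite (pos_bars C k)" "finite (pos_bars D k)" by (auto simp: pos_bars_def)
  obtain Ss Ts where sub: "Ss \<subseteq># concise_barcode C k" "Ts \<subseteq># concise_barcode D k"
    and short: "\<forall>(A, L)\<in>#Ss + Ts. L \<le> ereal (2 * \<delta>)"
    and rel: "rel_mset (bars_close \<delta>) (concise_barcode C k - Ss) (concise_barcode D k - Ts)"
    using m unfolding matching_def by blast
  have "image_mset (bar_at C k) (mset_set (pos_bars C k)) = Ss + (concise_barcode C k - Ss)"
    using sub(1) by (simp add: C.concise_barcode_eq)
  from image_mset_set_split[OF fin(1) this] obtain X where X: "X \<subseteq> pos_bars C k"
    "Ss = image_mset (bar_at C k) (mset_set (pos_bars C k - X))"
    "concise_barcode C k - Ss = image_mset (bar_at C k) (mset_set X)" by blast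
  have "image_mset (bar_at D k) (mset_set (pos_bars D k)) = Ts + (concise_barcode D k - Ts)"
    using sub(2) by (simp add: D.concise_barcode_eq)
  from image_mset_set_split[OF fin(2) this] obtain Y where Y: "Y \<subseteq> pos_bars D k"
    "Ts = image_mset (bar_at D k) (mset_set (pos_bars D k - Y))"
    "concise_barcode D k - Ts = image_mset (bar_at D k) (mset_set Y)" by blast
  have finXY: "finite X" "finite Y" using X Y fin finite_subset by blast+
  have "rel_mset (\<lambda>i j. bars_close \<delta> (bar_at C k i) (bar_at D k j)) (mset_set X) (mset_set Y)"
    using rel unfolding X(3) Y(3) multiset.rel_map .
  from rel_mset_set_bij[OF finXY this] obtain h where h: "bij_betw h X Y"
    "\<forall>i\<in>X. bars_close \<delta> (bar_at C k i) (bar_at D k (h i))" by blast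
  have "\<forall>i\<in>X. \<exists>g. index_close \<delta>' C D k i (h i) g"
    using h(2) bars_close_imp_index_close[OF _ \<delta>(2)] by blast
  from bchoice[OF this] obtain G where G: "\<forall>i\<in>X. index_close \<delta>' C D k i (h i) (G i)" ..
  have le: "L \<le> ereal (2 * \<delta>')" if "L \<le> ereal (2 * \<delta>)" for L
    using that \<delta> by (elim order_trans) simp
  have le0: "L \<le> ereal (2 * \<delta>')" if "\<not> 0 < L" for L :: ereal
    by (rule order_trans[of L 0]) (use that \<delta> in auto)
  have "bar_length C k i \<le> ereal (2 * \<delta>')" if "i < svd_m C k" "i \<notin> X" for i
  proof (cases "i \<in> pos_bars C k")
    case True
    then have "bar_at C k i \<in># Ss" using that fin by (simp add: X(2))
    then show ?thesis using short by (intro le) (auto simp: bar_at_def)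
  qed (use that le0 in \<open>auto simp: pos_bars_def\<close>)
  moreover have "bar_length D k j \<le> ereal (2 * \<delta>')" if "j < svd_m D k" "j \<notin> Y" for j
  proof (cases "j \<in> pos_bars D k")
    case True
    then have "bar_at D k j \<in># Ts" using that fin by (simp add: Y(2))
    then show ?thesis using short by (intro le) (auto simp: bar_at_def)
  qed (use that le0 in \<open>auto simp: pos_bars_def\<close>)
  moreover have "X \<subseteq> {..<svd_m C k}" "Y \<subseteq> {..<svd_m D k}" using X(1) Y(1) by (auto simp: pos_bars_def)
  ultimately show ?thesis using h(1) G by blast
qed

text \<open>The constant \<delta> may vary with k: a supremum below \<delta>' gives a matching with
  some smaller constant in each degree, but no common one has to be exhibited.\<close>

theorem quasiequivalence_of_matchings:
  assumes C: "floer_complex C" and D: "floer_complex D"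
    and m: "\<And>k. \<exists>\<delta>\<ge>0. \<delta> < \<delta>' \<and> matching \<delta> (concise_barcode C k) (concise_barcode D k)"
  shows "\<exists>\<Phi> \<Psi> KC KD. quasiequivalence \<delta>' C D \<Phi> \<Psi> KC KD"
proof -
  have "\<forall>k. \<exists>X Y h G. X \<subseteq> {..<svd_m C k} \<and> Y \<subseteq> {..<svd_m D k} \<and> bij_betw h X Y \<and>
    (\<forall>i\<in>X. index_close \<delta>' C D k i (h i) (G i)) \<and>
    (\<forall>i<svd_m C k. i \<notin> X \<longrightarrow> bar_length C k i \<le> ereal (2 * \<delta>')) \<and>
    (\<forall>j<svd_m D k. j \<notin> Y \<longrightarrow> bar_length D k j \<le> ereal (2 * \<delta>'))"
    (is "\<forall>k. ?P k")
  proof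
    fix k
    obtain \<delta> where "0 \<le> \<delta>" "\<delta> < \<delta>'" "matching \<delta> (concise_barcode C k) (concise_barcode D k)"
      using m by blast
    then show "?P k" by (rule index_matching_of_matching[OF C D])
  qed
  then obtain X Y h G where "\<forall>k. X k \<subseteq> {..<svd_m C k} \<and> Y k \<subseteq> {..<svd_m D k} \<and> bij_betw (h k) (X k) (Y k) \<and>
    (\<forall>i\<in>X k. index_close \<delta>' C D k i (h k i) (G k i)) \<and>
    (\<forall>i<svd_m C k. i \<notin> X k \<longrightarrow> bar_length C k i \<le> ereal (2 * \<delta>')) \<and>
    (\<forall>j<svd_m D k. j \<notin> Y k \<longrightarrow> bar_length D k j \<le> ereal (2 * \<delta>'))"
    unfolding choice_iff by blast
  then show ?thesis by (intro quasiequivalence_of_index_matching[OF C D, of X Y h \<delta>' G]) blast+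
qed


section \<open>The isometry theorem\<close>

theorem bottleneck_dist_le_quasiequivalence_dist:
  assumes "floer_complex C" "floer_complex D"
  shows "bottleneck_dist (concise_barcode C k) (concise_barcode D k) \<le> quasiequivalence_dist C D"
  unfolding quasiequivalence_dist_def bottleneck_dist_def
  using matching_of_quasiequivalence[OF assms] by (intro Inf_superset_mono) blast

theorem quasiequivalence_dist_le_bottleneck_dist:
  assumes C: "floer_complex C" and D: "floer_complex D"
  shows "quasiequivalence_dist C D \<le> bottleneck_dist_family (concise_barcode C) (concise_barcode D)"
\<comment> \<open>The infimum need not be attained, so the bound is proved for every y above the
  bottleneck distance, which leaves strict room in each degree.\<close>
proof (rule dense_ge)
  fix y assume y: "bottleneck_dist_family (concise_barcode C) (concise_barcode D) < y"
  have less: "bottleneck_dist (concise_barcode C k) (concise_barcode D k) < y" for k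
    by (rule le_less_trans[OF _ y]) (auto simp: bottleneck_dist_family_def intro: SUP_upper)
  \<comment> \<open>Any single degree shows that y is positive, which makes a real y an admissible
    constant and excludes -\<infinity>.\<close>
  have "0 \<le> bottleneck_dist (concise_barcode C 0) (concise_barcode D 0)"
    by (auto simp: bottleneck_dist_def intro: Inf_greatest)
  then have pos: "0 < y" using less[of 0] by (rule le_less_trans)
  show "quasiequivalence_dist C D \<le> y"
  proof (cases y)
    case (real \<delta>)
    have "\<exists>\<delta>'\<ge>0. \<delta>' < \<delta> \<and> matching \<delta>' (concise_barcode C k) (concise_barcode D k)" for k
      using less[of k] unfolding bottleneck_dist_def Inf_less_iff real by auto
    from quasiequivalence_of_matchings[OF C D this] pos real show ?thesis
      unfolding quasiequivalence_dist_def by (intro Inf_lower) auto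
  qed (use pos in auto)
qed

theorem theorem1p4:
  fixes C :: "('k::field, 'g::real_subgroup, 'c::ab_group_add) floer"
    and D :: "('k, 'g, 'd::ab_group_add) floer"
  assumes "floer_complex C" and "floer_complex D"
  shows
    "(quasiequivalence_dist C D
        \<le> bottleneck_dist_family (concise_barcode C) (concise_barcode D) \<and>
      bottleneck_dist_family (concise_barcode C) (concise_barcode D)
        \<le> 2 * quasiequivalence_dist C D) \<and>
     (\<forall>k. quasiequivalence_dist C D < shortest_length (concise_barcode D k) / 4 \<longrightarrow>
        bottleneck_dist (concise_barcode C k) (concise_barcode D k)
          \<le> quasiequivalence_dist C D)"
proof (intro conjI allI impI)
  note le = bottleneck_dist_le_quasiequivalence_dist[OF assms]
  show "quasiequivalence_dist C D \<le> bottleneck_dist_family (concise_barcode C) (concise_barcode D)"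
    by (rule quasiequivalence_dist_le_bottleneck_dist[OF assms])
  have "0 \<le> quasiequivalence_dist C D"
    by (auto simp: quasiequivalence_dist_def intro: Inf_greatest)
  then have "quasiequivalence_dist C D \<le> 2 * quasiequivalence_dist C D"
    by (cases "quasiequivalence_dist C D") auto
  moreover have "bottleneck_dist_family (concise_barcode C) (concise_barcode D) \<le> quasiequivalence_dist C D"
    unfolding bottleneck_dist_family_def by (rule SUP_least) (rule le)
  ultimately show "bottleneck_dist_family (concise_barcode C) (concise_barcode D) \<le> 2 * quasiequivalence_dist C D"
    by (rule order_trans[rotated])
  show "bottleneck_dist (concise_barcode C k) (concise_barcode D k) \<le> quasiequivalence_dist C D" for k
    by (rule le)
qed

end
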